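(* Let $f:\mathbb{R}^n\to\mathbb{R}^n$ be continuously differentiable and let $x_\star(t)=x(t,x^0)$ be a periodic solution of $\dot x=f(x)$ with minimal period $T>0$ and orbit $\Gamma=x_\star([0,T])$. The following statements are equivalent: i) the Andronov--Witt condition holds for $x_\star(\cdot)$, i.e. $|\varrho_2|<1$; ii) there exists a $T$-periodic, continuous, positive definite, and piecewise continuously differentiable function $t\mapsto P(t)\in\mathbb{R}^{n\times n}$ such that $\lambda_1(t)+\lambda_2(t)<0$ for all $t\ge0$; iii) there is a regular tubular neighborhood of $\Gamma$ on which the system $\dot x=f(x)$ is uniformly $2$-contractive.
   Context: $x(t,a)$ is the solution of $\dot x=f(x)$ with $x(0,a)=a$, and $\varphi^t(a):=x(t,a)$. Floquet multipliers: $M:=D\varphi^T(x^0)$ is the monodromy matrix and $\varrho_1,\dots,\varrho_n$ are its eigenvalues (repeated according to algebraic multiplicity) ordered so that $|\varrho_1|\ge|\varrho_2|\ge\dots\ge|\varrho_n|$. (The number $1$ is always among them.) For $P(\cdot)$ as in ii) (with symmetric values), $\lambda_1(t)\ge\dots\ge\lambda_n(t)$ are the $n$ (real) roots, with multiplicity, of $\det[A(t)^\top P(t)+P(t)A(t)+\dot P(t)-\lambda P(t)]=0$, where $A(t):=Df[x_\star(t)]$. At break points of $\dot P$, the inequality in ii) is understood for both one-sided derivatives. A regular tubular neighborhood of $\Gamma$ is any set $\mathbb{X}\subset\mathbb{R}^n$ that is compact, equals the closure of its interior, is positively invariant ($\varphi^t(\mathbb{X})\subset\mathbb{X}$ for all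 $t>0$), and whose interior contains $\Gamma$. Uniform contractivity on $\mathbb{X}$ is considered under the standing assumption that for some open set $O\supset\mathbb{X}$ the solutions $x(t,a)$, $a\in O$, are defined for all $t\ge0$. Hausdorff $2$-measure: for compact $K\subset\mathbb{R}^n$ and $\varepsilon>0$, $\mu_{2,\varepsilon}(K):=\inf\sum_i r_i^2$ over all coverings of $K$ by finitely many open Euclidean balls of radii $r_i\le\varepsilon$; $\mu_2(K):=\lim_{\varepsilon\to0}\mu_{2,\varepsilon}(K)$. The system is uniformly $2$-contractive on $\mathbb{X}$ if for every $\varepsilon\in(0,1)$ there exists $\mathscr{T}(\varepsilon)>0$ such that for every compact $K\subset\mathbb{X}$ with $\mu_2(K)<\infty$: $\mu_2[\varphi^{t}(K)]\le\varepsilon\,\mu_2(K)$ for all $t\ge\mathscr{T}(\varepsilon)$. *)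

theory Defs
  imports
    "HOL-Analysis.Analysis"
    "HOL-Computational_Algebra.Polynomial"
begin

section \<open>Solutions and flow of an autonomous differential equation\<close>

definition C1_map :: "(real^'n \<Rightarrow> real^'n) \<Rightarrow> bool" where
  "C1_map f \<longleftrightarrow> (\<forall>x. f differentiable (at x)) \<and> continuous_on UNIV (\<lambda>x. jacobian f (at x))"

definition is_solution :: "(real^'n \<Rightarrow> real^'n) \<Rightarrow> real set \<Rightarrow> (real \<Rightarrow> real^'n) \<Rightarrow> bool" where
  "is_solution f I x \<longleftrightarrow> (\<forall>t\<in>I. (x has_vector_derivative f (x t)) (at t within I))"

definition flow_defined :: "(real^'n \<Rightarrow> real^'n) \<Rightarrow> real \<Rightarrow> real^'n \<Rightarrow> bool" where
  "flow_defined f t a \<longleftrightarrow> (\<exists>x. is_solution f (closed_segment 0 t) x \<and> x 0 = a)"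

text \<open>The value at time \<open>t\<close> of the solution starting at \<open>a\<close>. It is meaningful only where
  \<open>flow_defined f t a\<close> holds; uniqueness is guaranteed when \<open>f\<close> is \<open>C1\<close>.\<close>

definition flow :: "(real^'n \<Rightarrow> real^'n) \<Rightarrow> real \<Rightarrow> real^'n \<Rightarrow> real^'n" where
  "flow f t a = (THE y. \<exists>x. is_solution f (closed_segment 0 t) x \<and> x 0 = a \<and> x t = y)"

definition has_minimal_period :: "(real \<Rightarrow> 'a) \<Rightarrow> real \<Rightarrow> bool" where
  "has_minimal_period x T \<longleftrightarrow>
     T > 0 \<and> (\<forall>t. x (t + T) = x t) \<and> (\<forall>s. 0 < s \<and> s < T \<longrightarrow> \<not> (\<forall>t. x (t + s) = x t))"


section \<open>Floquet multipliers and the Andronov--Witt condition\<close>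

text \<open>The polynomial \<open>det (Q - \<lambda> P)\<close> in the indeterminate \<open>\<lambda>\<close>. The multiset \<open>proots\<close> of its
  roots records algebraic multiplicities.\<close>

definition pencil_poly :: "'a::comm_ring_1^'n^'n \<Rightarrow> 'a^'n^'n \<Rightarrow> 'a poly" where
  "pencil_poly Q P = det (\<chi> i j. [:Q $ i $ j, - (P $ i $ j):])"

definition eigenvalues_mset :: "real^'n^'n \<Rightarrow> complex multiset" where
  "eigenvalues_mset M = proots (pencil_poly (\<chi> i j. complex_of_real (M $ i $ j)) (mat 1))"

definition monodromy :: "(real^'n \<Rightarrow> real^'n) \<Rightarrow> real \<Rightarrow> real^'n \<Rightarrow> real^'n^'n" where
  "monodromy f T x0 = jacobian (flow f T) (at x0)"

definition floquet_multipliers ::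
  "(real^'n \<Rightarrow> real^'n) \<Rightarrow> real \<Rightarrow> real^'n \<Rightarrow> complex list \<Rightarrow> bool" where
  "floquet_multipliers f T x0 \<rho> \<longleftrightarrow>
     mset \<rho> = eigenvalues_mset (monodromy f T x0) \<and> sorted_wrt (\<lambda>a b. cmod a \<ge> cmod b) \<rho>"

text \<open>Lists are indexed from 0, so \<open>\<rho> ! 1\<close> is the second multiplier. In dimension 1 it does not
  exist, but there are no nonconstant periodic solutions either. The orderings allowed by
  \<^const>\<open>floquet_multipliers\<close> differ only within groups of equal modulus.\<close>

definition andronov_witt :: "(real^'n \<Rightarrow> real^'n) \<Rightarrow> real \<Rightarrow> real^'n \<Rightarrow> bool" where
  "andronov_witt f T x0 \<longleftrightarrow> (\<exists>\<rho>. floquet_multipliers f T x0 \<rho> \<and> cmod (\<rho> ! 1) < 1)"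


section \<open>Lyapunov-like matrix functions\<close>

definition pos_definite :: "real^'n^'n \<Rightarrow> bool" where
  "pos_definite P \<longleftrightarrow> transpose P = P \<and> (\<forall>v. v \<noteq> 0 \<longrightarrow> v \<bullet> (P *v v) > 0)"

text \<open>On each closed piece the function is continuously differentiable, with one-sided
  derivatives at the end points. In contrast, \<^const>\<open>piecewise_C1_differentiable_on\<close> does not
  entail that one-sided derivatives exist at the break points.\<close>

definition piecewise_C1_on :: "real \<Rightarrow> real \<Rightarrow> (real \<Rightarrow> 'a::real_normed_vector) \<Rightarrow> bool" where
  "piecewise_C1_on a b P \<longleftrightarrow>
     (\<exists>m::nat. \<exists>\<tau>::nat \<Rightarrow> real. \<tau> 0 = a \<and> \<tau> m = b \<and>
        (\<forall>i<m. \<tau> i < \<tau> (Suc i) \<and>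
           (\<exists>P'. continuous_on {\<tau> i..\<tau> (Suc i)} P' \<and>
              (\<forall>t\<in>{\<tau> i..\<tau> (Suc i)}.
                 (P has_vector_derivative P' t) (at t within {\<tau> i..\<tau> (Suc i)})))))"

text \<open>The real roots of \<open>det (A\<^sup>T P + P A + D - \<lambda> P) = 0\<close> in decreasing order, with multiplicity.
  There are \<open>CARD('n)\<close> of them when \<open>P\<close> is positive definite and \<open>D\<close> is symmetric.\<close>

definition lyapunov_roots :: "real^'n^'n \<Rightarrow> real^'n^'n \<Rightarrow> real^'n^'n \<Rightarrow> real list" where
  "lyapunov_roots A P D =
     rev (sorted_list_of_multiset (proots (pencil_poly (transpose A ** P + P ** A + D) P)))"

definition top_two_sum_neg :: "real^'n^'n \<Rightarrow> real^'n^'n \<Rightarrow> real^'n^'n \<Rightarrow> bool" where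
  "top_two_sum_neg A P D \<longleftrightarrow> lyapunov_roots A P D ! 0 + lyapunov_roots A P D ! 1 < 0"


section \<open>Contraction of Hausdorff 2-measure\<close>

definition forward_complete_on :: "(real^'n \<Rightarrow> real^'n) \<Rightarrow> (real^'n) set \<Rightarrow> bool" where
  "forward_complete_on f S \<longleftrightarrow> (\<forall>a\<in>S. \<forall>t\<ge>0. flow_defined f t a)"

definition positively_invariant :: "(real^'n \<Rightarrow> real^'n) \<Rightarrow> (real^'n) set \<Rightarrow> bool" where
  "positively_invariant f X \<longleftrightarrow> forward_complete_on f X \<and> (\<forall>t>0. flow f t ` X \<subseteq> X)"

definition regular_tubular_nbhd ::
  "(real^'n \<Rightarrow> real^'n) \<Rightarrow> (real^'n) set \<Rightarrow> (real^'n) set \<Rightarrow> bool" where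
  "regular_tubular_nbhd f \<Gamma> X \<longleftrightarrow>
     compact X \<and> X = closure (interior X) \<and> positively_invariant f X \<and> \<Gamma> \<subseteq> interior X"

text \<open>A finite covering by balls is given by the finite set of its (centre, radius) pairs.\<close>

definition mu2_eps :: "real \<Rightarrow> (real^'n) set \<Rightarrow> ennreal" where
  "mu2_eps \<epsilon> K =
     (INF C \<in> {C. finite C \<and> (\<forall>(c, r)\<in>C. 0 < r \<and> r \<le> \<epsilon>) \<and> K \<subseteq> (\<Union>(c, r)\<in>C. ball c r)}.
        ennreal (\<Sum>(c, r)\<in>C. r\<^sup>2))"

definition mu2 :: "(real^'n) set \<Rightarrow> ennreal" where
  "mu2 K = Lim (at_right 0) (\<lambda>\<epsilon>. mu2_eps \<epsilon> K)"

definition uniformly_2_contractive :: "(real^'n \<Rightarrow> real^'n) \<Rightarrow> (real^'n) set \<Rightarrow> bool" where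
  "uniformly_2_contractive f X \<longleftrightarrow>
     (\<forall>\<epsilon>::real. 0 < \<epsilon> \<and> \<epsilon> < 1 \<longrightarrow>
        (\<exists>\<T>>0. \<forall>K. compact K \<and> K \<subseteq> X \<and> mu2 K < \<infinity> \<longrightarrow>
           (\<forall>t\<ge>\<T>. mu2 (flow f t ` K) \<le> ennreal \<epsilon> * mu2 K)))"

end

theory Submission
  imports Defs "HOL-Computational_Algebra.Fundamental_Theorem_Algebra"
begin

text \<open>
  Everything is compared with the linearized flow along the orbit. Let \<open>e t = f (xs t)\<close> be the flow
  direction, \<open>Phi\<close> the fundamental matrix and \<open>M = Phi T\<close> the monodromy matrix, so that \<open>M\<close> fixes
  \<open>e 0\<close>. Subtracting from \<open>M\<close> a rank-one matrix that acts like \<open>M\<close> on \<open>e 0\<close> replaces one multiplier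
  1 by 0 and keeps the others. The Andronov--Witt condition therefore says that all eigenvalues of the
  deflated matrix lie in the open unit disc (\<open>second_multiplier_iff\<close>), and multiplicities disappear
  from the argument. If the condition fails, an eigenvector of the deflated matrix yields a plane that
  \<open>M\<close> maps into itself without shrinking areas (\<open>expanding_invariant_plane\<close>). If it holds, the powers
  of \<open>M\<close> decay exponentially on an invariant complement of \<open>e 0\<close> (\<open>stable_splitting\<close>).

  Lyapunov functions imply the condition: two solutions of the linearized equation that start in the
  non-shrinking plane have a Gram determinant with respect to \<open>P t\<close> whose logarithmic derivative is at most
  \<open>\<lambda>\<^sub>1 + \<lambda>\<^sub>2 < 0\<close> by Ky Fan's inequality (\<open>orthonormal_pair_le_top_two\<close>), although after one period it
  is multiplied by a squared determinant that is at least 1. Conversely, let \<open>P t\<close> be the square of the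
  \<open>e\<close>-component of a vector plus the integral, over the whole future, of the squared norm of its transversal
  part. Along the linearized flow the first summand is constant and the second one decreases with
  the speed of the squared transversal part. The largest root is thus 0, attained in the direction
  \<open>e t\<close> only, and the second root is negative.

  Contractivity implies the condition: a small disc in the non-shrinking plane loses no area under
  \<open>k\<close> periods up to a factor that does not depend on \<open>k\<close>, since by Brouwer's theorem the projection of
  its image to the plane covers the linear image of the half-sized disc; and areas bound
  the 2-measure from below. Conversely, after many periods the flow squeezes every small ball near
  the orbit into a thin neighborhood of a segment in the direction \<open>e\<close> (\<open>squeeze_estimate\<close>).
  Such a set is covered by few much smaller balls, which gives the contraction (\<open>squeeze_mu2\<close>), and
  it also gives orbital stability, so that the forward orbit of a thin tube stays near \<open>\<Gamma>\<close>; its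
  closure is the required neighborhood.

  For these arguments it is enough to compare differences of nearby solutions with the linearized
  flow (\<open>linear_estimate\<close>); the derivative of the flow occurs only at the base point of the orbit, where
  it defines the monodromy matrix.
\<close>

section \<open>Floquet multipliers after deflation\<close>

lemma poly_pencil_poly:
  "poly (pencil_poly Q P) x = det (\<chi> i j. Q $ i $ j - x * P $ i $ j)"
  by (simp add: pencil_poly_def det_def poly_sum poly_prod)

definition cmat :: "real^'n^'n \<Rightarrow> complex^'n^'n" where
  "cmat M = (\<chi> i j. complex_of_real (M $ i $ j))"

definition cvec :: "real^'n \<Rightarrow> complex^'n" where
  "cvec v = (\<chi> i. complex_of_real (v $ i))"

lemma eigenvalues_mset_eq: "eigenvalues_mset M = proots (pencil_poly (cmat M) (mat 1))"
  by (simp add: eigenvalues_mset_def cmat_def)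

text \<open>Only column \<open>k\<close> of \<open>M\<close> is changed, by the multiple of \<open>e\<close> that normalizes its coordinate \<open>k\<close>. With
  this choice of the rank-one correction, Cramer's rule compares the determinants.\<close>

definition deflate :: "'a::field^'n^'n \<Rightarrow> 'a^'n \<Rightarrow> 'n \<Rightarrow> 'a^'n^'n" where
  "deflate M e k = (\<chi> i j. M $ i $ j - (if j = k then e $ i / e $ k else 0))"

lemma deflate_mult: "deflate M e k *v z = M *v z - (z $ k / e $ k) *s e"
proof -
  have "(\<Sum>j\<in>UNIV. (if j = k then e $ i / e $ k else 0) * z $ j) = z $ k / e $ k * e $ i" for i
    by (subst sum.mono_neutral_right[where S="{k}"]) auto
  then show ?thesis
    by (simp add: vec_eq_iff deflate_def matrix_vector_mult_def left_diff_distrib sum_subtractf)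
qed

text \<open>Both sides are the determinant of the matrix that \<open>M - x\<close> and the deflated \<open>M - x\<close> share, up to the
  column \<open>k\<close>, with one common vector put in that column.\<close>

lemma det_deflate:
  fixes M :: "'a::field^'n^'n"
  assumes "M *v e = e" "e $ k \<noteq> 0"
  shows "(1 - x) * det (\<chi> i j. deflate M e k $ i $ j - x * mat 1 $ i $ j)
          = - x * det (\<chi> i j. M $ i $ j - x * mat 1 $ i $ j)"
proof -
  define N where "N = (\<chi> i j. M $ i $ j - x * mat 1 $ i $ j)"
  define N' where "N' = (\<chi> i j. deflate M e k $ i $ j - x * mat 1 $ i $ j)"
  have Nv: "N *v z = M *v z - x *s z" for z
    by (simp add: vec_eq_iff N_def matrix_vector_mult_def left_diff_distrib sum_subtractf mat_def
        if_distrib[of "\<lambda>a. a * _"] if_distrib[of "\<lambda>a. _ * a"] cong: if_cong)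
  have N'v: "N' *v z = deflate M e k *v z - x *s z" for z
    by (simp add: vec_eq_iff N'_def matrix_vector_mult_def left_diff_distrib sum_subtractf mat_def
        if_distrib[of "\<lambda>a. a * _"] if_distrib[of "\<lambda>a. _ * a"] cong: if_cong)
  define z where "z = (1 - x) *s axis k 1 - (1 / e $ k) *s e"
  define z' where "z' = (1 - x) *s (axis k 1 :: 'a^'n)"
  have zk: "z $ k = - x" "z' $ k = 1 - x"
    using assms(2) by (simp_all add: z_def z'_def)
  have eq: "N *v z = N' *v z'"
    unfolding Nv N'v deflate_mult z_def z'_def
    using assms
    by (simp add: matrix_vector_mult_diff_distrib vector_scalar_commute vec_eq_iff del: vector_smult_assoc)
      (simp add: field_simps)
  have cols: "N $ i $ j = N' $ i $ j" if "j \<noteq> k" for i j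
    using that by (simp add: N_def N'_def deflate_def)
  have "(1 - x) * det N' = det (\<chi> i j. if j = k then (N' *v z') $ i else N' $ i $ j)"
    using cramer_lemma[of k N' z'] zk by simp
  also have "\<dots> = det (\<chi> i j. if j = k then (N *v z) $ i else N $ i $ j)"
    using cols unfolding eq by (intro arg_cong[where f=det]) (simp add: vec_eq_iff)
  also have "\<dots> = - x * det N"
    using cramer_lemma[of k N z] zk by simp
  finally show ?thesis unfolding N_def N'_def .
qed

lemma pencil_poly_deflate:
  fixes M :: "complex^'n^'n"
  assumes "M *v e = e" "e $ k \<noteq> 0"
  shows "[:1, -1:] * pencil_poly (deflate M e k) (mat 1) = [:0, -1:] * pencil_poly M (mat 1)"
proof -
  have "poly ([:1, -1:] * pencil_poly (deflate M e k) (mat 1)) x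
      = poly ([:0, -1:] * pencil_poly M (mat 1)) x" for x
    using det_deflate[OF assms, of x] by (simp add: poly_pencil_poly algebra_simps)
  then show ?thesis by (simp add: poly_eq_poly_eq_iff[symmetric] fun_eq_iff)
qed

lemma pencil_poly_root_iff:
  fixes M :: "complex^'n^'n"
  shows "poly (pencil_poly M (mat 1)) x = 0 \<longleftrightarrow> (\<exists>z. z \<noteq> 0 \<and> M *v z = x *s z)"
proof -
  define N where "N = (\<chi> i j. M $ i $ j - x * mat 1 $ i $ j)"
  have Nv: "N *v z = M *v z - x *s z" for z
    by (simp add: vec_eq_iff N_def matrix_vector_mult_def left_diff_distrib sum_subtractf mat_def
        if_distrib[of "\<lambda>a. a * _"] if_distrib[of "\<lambda>a. _ * a"] cong: if_cong)
  have "det N = 0 \<longleftrightarrow> \<not> (\<exists>B. B ** N = mat 1)"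
    by (metis invertible_det_nz invertible_left_inverse)
  also have "\<dots> \<longleftrightarrow> (\<exists>z. z \<noteq> 0 \<and> N *v z = 0)"
    unfolding matrix_left_invertible_ker by blast
  finally show ?thesis unfolding poly_pencil_poly N_def[symmetric] Nv by simp
qed

text \<open>The reciprocal polynomial of the characteristic polynomial is \<open>det (x M - 1)\<close>, which does not
  vanish at 0. If the degree were at most 1, it would be divisible by \<open>x\<close>.\<close>

lemma pencil_poly_mat1_nonzero:
  fixes M :: "complex^'n^'n"
  assumes "CARD('n) \<ge> 2"
  shows "pencil_poly M (mat 1) \<noteq> 0 \<and> degree (pencil_poly M (mat 1)) \<ge> 2"
proof -
  define p where "p = pencil_poly M (mat 1)"
  define q where "q = pencil_poly (- mat 1) (- M)"
  define n where "n = CARD('n)"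
  have rel: "poly q x = x ^ n * poly p (1 / x)" if "x \<noteq> 0" for x
  proof -
    have "x ^ n * det (\<chi> i j. M $ i $ j - 1 / x * mat 1 $ i $ j)
        = det (\<chi> i. x *s ((\<chi> i j. M $ i $ j - 1 / x * mat 1 $ i $ j) $ i))"
      by (subst det_rows_mul) (simp add: n_def)
    also have "(\<chi> i. x *s ((\<chi> i j. M $ i $ j - 1 / x * mat 1 $ i $ j) $ i))
        = (\<chi> i j. (- mat 1) $ i $ j - x * (- M) $ i $ j)"
      using that by (simp add: vec_eq_iff field_simps)
    finally show ?thesis by (simp add: p_def q_def poly_pencil_poly)
  qed
  have q0: "poly q 0 \<noteq> 0"
  proof -
    have "(\<chi> i j. (- mat 1 :: complex^'n^'n) $ i $ j - 0 * (- M) $ i $ j) = (\<chi> i. (-1) *s ((mat 1 :: complex^'n^'n) $ i))"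
      by (simp add: vec_eq_iff)
    then have "poly q 0 = det (\<chi> i. (-1) *s ((mat 1 :: complex^'n^'n) $ i))"
      unfolding q_def poly_pencil_poly by (rule arg_cong)
    also have "\<dots> = (\<Prod>i\<in>(UNIV::'n set). -1) * det (mat 1 :: complex^'n^'n)"
      using det_rows_mul[of "\<lambda>_. -1" "\<lambda>i. (mat 1 :: complex^'n^'n) $ i"] by simp
    finally have "poly q 0 = (\<Prod>i\<in>(UNIV::'n set). -1) * det (mat 1 :: complex^'n^'n)" .
    then show ?thesis by simp
  qed
  have "degree p \<ge> 2"
  proof (rule ccontr)
    assume "\<not> degree p \<ge> 2"
    then have d: "degree p \<le> 1" by simp
    have p: "p = [:coeff p 0, coeff p 1:]"
    proof (rule poly_eqI)
      fix i show "coeff p i = coeff [:coeff p 0, coeff p 1:] i"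
        using d by (cases i; cases "i - 1") (auto simp: coeff_pCons coeff_eq_0 split: nat.splits)
    qed
    define r where "r = [:0, coeff p 0:] * [:0,1:] ^ (n - 1) + [:0, coeff p 1:] * [:0,1:] ^ (n - 2)"
    have n: "n = Suc (Suc (n - 2))" "n - 1 = Suc (n - 2)" using assms by (auto simp: n_def)
    have "poly q x = poly r x" if "x \<noteq> 0" for x
    proof -
      have "poly q x = x ^ n * (coeff p 0 + (1 / x) * coeff p 1)"
        unfolding rel[OF that] by (subst p) simp
      also have "\<dots> = poly r x"
        using that unfolding r_def by (subst n(1), subst n(2)) (simp add: field_simps)
      finally show ?thesis .
    qed
    then have "poly ([:0,1:] * q) x = poly ([:0,1:] * r) x" for x by (cases "x = 0") auto
    then have "[:0,1:] * q = [:0,1:] * r" by (simp add: poly_eq_poly_eq_iff[symmetric] fun_eq_iff)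
    then have "q = r" by simp
    with q0 show False by (simp add: r_def)
  qed
  then show ?thesis unfolding p_def by auto
qed

lemma proots_lin: "proots [:a, -1:] = {#a :: 'a::idom#}"
proof -
  have "[:a, -1:] = - [:-a, 1:]" by simp
  then show ?thesis by (metis proots_uminus proots_linear_factor minus_minus)
qed

lemma cmat_deflate: "cmat (deflate M e k) = deflate (cmat M) (cvec e) k"
  by (simp add: cmat_def deflate_def cvec_def vec_eq_iff)

lemma cmat_cvec: "cmat M *v cvec v = cvec (M *v v)"
  by (simp add: cmat_def cvec_def matrix_vector_mult_def vec_eq_iff)

text \<open>The multisets of multipliers of \<open>M\<close> and of its deflation arise from a common multiset \<open>R0\<close> by adding 1
  and 0, respectively. A list of the former sorted by modulus has its second entry inside the unit
  disc exactly when all of \<open>R0\<close> lies there, because 1 must then be the head of the list.\<close>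

theorem second_multiplier_iff:
  fixes M :: "real^'n^'n"
  assumes "CARD('n) \<ge> 2" "M *v e = e" "e $ k \<noteq> 0"
  shows "(\<exists>\<rho>. mset \<rho> = eigenvalues_mset M \<and> sorted_wrt (\<lambda>a b. cmod a \<ge> cmod b) \<rho> \<and> cmod (\<rho> ! 1) < 1)
     \<longleftrightarrow> (\<forall>x z. z \<noteq> 0 \<longrightarrow> cmat (deflate M e k) *v z = x *s z \<longrightarrow> cmod x < 1)"
proof -
  define R where "R = proots (pencil_poly (cmat M) (mat 1))"
  define R' where "R' = proots (pencil_poly (cmat (deflate M e k)) (mat 1))"
  have ce: "cmat M *v cvec e = cvec e" "cvec e $ k \<noteq> 0"
    using assms by (simp_all add: cmat_cvec) (simp add: cvec_def)
  note nz = pencil_poly_mat1_nonzero[OF assms(1)]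
  have RR: "add_mset 1 R' = add_mset 0 R"
    using arg_cong[OF pencil_poly_deflate[OF ce], of proots]
    using nz proots_lin[of "1::complex"] proots_lin[of "0::complex"]
    by (simp add: proots_mult R_def R'_def cmat_deflate del: mult_pCons_left)
  have "0 \<in># R'" "1 \<in># R" using RR by (auto simp: add_eq_conv_ex)
  then obtain R0 where R0: "R = add_mset 1 R0" "R' = add_mset 0 R0"
    using RR by (metis add_mset_commute add_mset_remove_trivial insert_DiffM)
  have rhs: "(\<forall>x z. z \<noteq> 0 \<longrightarrow> cmat (deflate M e k) *v z = x *s z \<longrightarrow> cmod x < 1)
      \<longleftrightarrow> (\<forall>x\<in>#R0. cmod x < 1)"
  proof -
    have "x \<in># R' \<longleftrightarrow> (\<exists>z. z \<noteq> 0 \<and> cmat (deflate M e k) *v z = x *s z)" for x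
      unfolding R'_def using nz by (simp add: pencil_poly_root_iff)
    then show ?thesis using R0(2)
      by (metis insert_iff norm_zero set_mset_add_mset_insert zero_less_one)
  qed
  have "size R \<ge> 2" using nz by (simp add: R_def size_proots_complex)
  then have sz: "R0 \<noteq> {#}" using R0 by auto
  show ?thesis unfolding rhs eigenvalues_mset_eq R_def[symmetric]
  proof
    assume "\<exists>\<rho>. mset \<rho> = R \<and> sorted_wrt (\<lambda>a b. cmod b \<le> cmod a) \<rho> \<and> cmod (\<rho> ! 1) < 1"
    then obtain \<rho> where \<rho>: "mset \<rho> = R" "sorted_wrt (\<lambda>a b. cmod b \<le> cmod a) \<rho>" "cmod (\<rho> ! 1) < 1"
      by blast
    have "length \<rho> \<ge> 2" using \<open>size R \<ge> 2\<close> \<rho>(1) by (metis size_mset)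
    then obtain a b l where l: "\<rho> = a # b # l"
      by (metis Suc_le_length_iff numeral_2_eq_2)
    have small: "cmod x < 1" if "x \<in> set (b # l)" for x
      using that \<rho>(2,3) unfolding l by auto
    have "1 \<in> set \<rho>" using \<open>1 \<in># R\<close> \<rho>(1) by (metis set_mset_mset)
    then have "a = 1" using small unfolding l by force
    then have "R0 = mset (b # l)" using \<rho>(1) R0(1) unfolding l by simp
    then show "\<forall>x\<in>#R0. cmod x < 1" using small by auto
  next
    assume R: "\<forall>x\<in>#R0. cmod x < 1"
    define l where "l = rev (sort_key cmod (SOME l. mset l = R0))"
    have ml: "mset l = R0" unfolding l_def by (simp, rule someI_ex, rule ex_mset)
    have sl: "sorted_wrt (\<lambda>a b. cmod b \<le> cmod a) l"
      unfolding l_def sorted_wrt_rev using sorted_sort_key[of cmod] by (simp add: sorted_map)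
    obtain b l' where l': "l = b # l'" using ml sz by (cases l) auto
    have "set l = set_mset R0" using ml by (metis set_mset_mset)
    then have "mset (1 # l) = R \<and> sorted_wrt (\<lambda>a b. cmod b \<le> cmod a) (1 # l) \<and> cmod ((1 # l) ! 1) < 1"
      using ml sl R R0 l' by (auto intro: less_imp_le)
    then show "\<exists>\<rho>. mset \<rho> = R \<and> sorted_wrt (\<lambda>a b. cmod b \<le> cmod a) \<rho> \<and> cmod (\<rho> ! 1) < 1"
      by blast
  qed
qed


section \<open>Expanding planes and stable splittings\<close>

definition cre :: "complex^'n \<Rightarrow> real^'n" where "cre z = (\<chi> i. Re (z $ i))"
definition cim :: "complex^'n \<Rightarrow> real^'n" where "cim z = (\<chi> i. Im (z $ i))"

lemma cre_cmat: "cre (cmat M *v z) = M *v cre z" and cim_cmat: "cim (cmat M *v z) = M *v cim z"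
  by (simp_all add: cre_def cim_def cmat_def matrix_vector_mult_def vec_eq_iff)

lemma cre_smult: "cre (x *s z) = Re x *\<^sub>R cre z - Im x *\<^sub>R cim z"
  and cim_smult: "cim (x *s z) = Re x *\<^sub>R cim z + Im x *\<^sub>R cre z"
  by (simp_all add: cre_def cim_def vec_eq_iff)

lemma cvec_eq_0_iff: "z = 0 \<longleftrightarrow> cre z = 0 \<and> cim z = 0"
  by (auto simp: cre_def cim_def vec_eq_iff complex_eq_iff)

lemma deflate_mult_real:
  fixes M :: "real^'n^'n"
  shows "deflate M e k *v z = M *v z - (z $ k / e $ k) *\<^sub>R e"
  by (simp add: deflate_mult scalar_mult_eq_scaleR)

text \<open>Let \<open>z\<close> be an eigenvector of the deflated matrix for an eigenvalue \<open>x\<close> outside the open unit disc. If \<open>x\<close> is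
  real, the plane is spanned by \<open>e\<close> and \<open>z\<close>. If not, a multiple of \<open>e\<close> turns \<open>z\<close> into an eigenvector of
  \<open>M\<close> itself, and the plane is spanned by its real and imaginary parts. The determinant of \<open>M\<close> on
  the plane is \<open>x\<close> or \<open>\<bar>x\<bar>\<^sup>2\<close>.\<close>

lemma expanding_invariant_plane:
  fixes M :: "real^'n^'n"
  assumes e: "M *v e = e" "e $ k \<noteq> 0"
    and z: "cmat (deflate M e k) *v z = x *s z" "z \<noteq> 0" and x: "cmod x \<ge> 1"
  obtains u w a b c d where
    "\<And>\<alpha> \<beta>. \<alpha> *\<^sub>R u + \<beta> *\<^sub>R w = 0 \<Longrightarrow> \<alpha> = 0 \<and> \<beta> = 0"
    "M *v u = a *\<^sub>R u + b *\<^sub>R w" "M *v w = c *\<^sub>R u + d *\<^sub>R w" "\<bar>a * d - b * c\<bar> \<ge> 1"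
proof (cases "Im x = 0")
  case True
  have re: "deflate M e k *v cre z = Re x *\<^sub>R cre z" and im: "deflate M e k *v cim z = Re x *\<^sub>R cim z"
    using arg_cong[OF z(1), of cre] arg_cong[OF z(1), of cim] True
    by (simp_all add: cre_cmat cim_cmat cre_smult cim_smult)
  obtain v where v: "v \<noteq> 0" "deflate M e k *v v = Re x *\<^sub>R v"
    using re im z(2) cvec_eq_0_iff[of z] by blast
  have r: "\<bar>Re x\<bar> \<ge> 1" using x True by (simp add: cmod_def)
  have de: "deflate M e k *v e = 0" using e by (simp add: deflate_mult_real)
  show ?thesis
  proof (rule that[of e v 1 0 "v $ k / e $ k" "Re x"])
    fix \<alpha> \<beta> assume 0: "\<alpha> *\<^sub>R e + \<beta> *\<^sub>R v = 0"
    have "deflate M e k *v (\<alpha> *\<^sub>R e + \<beta> *\<^sub>R v) = \<beta> *\<^sub>R (Re x *\<^sub>R v)"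
      by (simp add: matrix_vector_right_distrib matrix_vector_mult_scaleR de v)
    with 0 have "\<beta> *\<^sub>R (Re x *\<^sub>R v) = 0" by simp
    with r v have "\<beta> = 0" by auto
    with 0 e show "\<alpha> = 0 \<and> \<beta> = 0" by auto
  qed (use e v r in \<open>auto simp: deflate_mult_real algebra_simps\<close>)
next
  case False
  then have x1: "x \<noteq> 1" by auto
  define \<kappa> where "\<kappa> = (z $ k / cvec e $ k) / (x - 1)"
  define z' where "z' = z + \<kappa> *s cvec e"
  have ek: "cvec e $ k \<noteq> 0" using e by (simp add: cvec_def)
  have Me: "cmat M *v cvec e = cvec e" using e by (simp add: cmat_cvec)
  have Mz: "cmat M *v z = x *s z + (z $ k / cvec e $ k) *s cvec e"
    using z(1) by (simp add: cmat_deflate deflate_mult algebra_simps)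
  have Mz': "cmat M *v z' = x *s z'"
  proof -
    have "z $ k / cvec e $ k + \<kappa> = x * \<kappa>"
    proof -
      have "c + c / (x - 1) = x * (c / (x - 1))" for c
        using x1 by (simp add: divide_simps) (simp add: algebra_simps)
      then show ?thesis unfolding \<kappa>_def .
    qed
    moreover have "cmat M *v z' = x *s z + (z $ k / cvec e $ k + \<kappa>) *s cvec e"
      by (simp add: z'_def matrix_vector_right_distrib vector_scalar_commute Mz Me vector_sadd_rdistrib)
    ultimately show ?thesis by (simp add: z'_def vector_add_ldistrib)
  qed
  have z'0: "z' \<noteq> 0"
  proof
    assume "z' = 0"
    then have "z = (- \<kappa>) *s cvec e" by (simp add: z'_def eq_neg_iff_add_eq_0 vector_smult_lneg)
    then have "cmat (deflate M e k) *v z = (- \<kappa>) *s (deflate (cmat M) (cvec e) k *v cvec e)"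
      by (simp only: vector_scalar_commute cmat_deflate)
    also have "deflate (cmat M) (cvec e) k *v cvec e = 0"
      using ek Me by (simp add: deflate_mult)
    finally have "x *s z = 0" using z by simp
    then show False using z(2) x by (auto simp: vec_eq_iff)
  qed
  define u w where "u = cre z'" and "w = cim z'"
  have Mu: "M *v u = Re x *\<^sub>R u + (- Im x) *\<^sub>R w" and Mw: "M *v w = Im x *\<^sub>R u + Re x *\<^sub>R w"
    using arg_cong[OF Mz', of cre] arg_cong[OF Mz', of cim]
    by (simp_all add: cre_cmat cim_cmat cre_smult cim_smult u_def w_def)
  show ?thesis
  proof (rule that[OF _ Mu Mw])
    fix \<alpha> \<beta> assume 0: "\<alpha> *\<^sub>R u + \<beta> *\<^sub>R w = 0"
    have "M *v (\<alpha> *\<^sub>R u + \<beta> *\<^sub>R w) = Re x *\<^sub>R (\<alpha> *\<^sub>R u + \<beta> *\<^sub>R w) + Im x *\<^sub>R (\<beta> *\<^sub>R u - \<alpha> *\<^sub>R w)"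
      unfolding matrix_vector_right_distrib matrix_vector_mult_scaleR Mu Mw
      by (simp add: algebra_simps)
    then have 1: "\<beta> *\<^sub>R u - \<alpha> *\<^sub>R w = 0" using 0 False by simp
    have "(\<alpha>\<^sup>2 + \<beta>\<^sup>2) *\<^sub>R u = \<alpha> *\<^sub>R (\<alpha> *\<^sub>R u + \<beta> *\<^sub>R w) + \<beta> *\<^sub>R (\<beta> *\<^sub>R u - \<alpha> *\<^sub>R w)"
      "(\<alpha>\<^sup>2 + \<beta>\<^sup>2) *\<^sub>R w = \<beta> *\<^sub>R (\<alpha> *\<^sub>R u + \<beta> *\<^sub>R w) - \<alpha> *\<^sub>R (\<beta> *\<^sub>R u - \<alpha> *\<^sub>R w)"
      by (simp_all add: scaleR_add_left scaleR_add_right scaleR_diff_right power2_eq_square mult.commute)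
    then have "(\<alpha>\<^sup>2 + \<beta>\<^sup>2) *\<^sub>R u = 0" "(\<alpha>\<^sup>2 + \<beta>\<^sup>2) *\<^sub>R w = 0" using 0 1 by simp_all
    moreover have "u \<noteq> 0 \<or> w \<noteq> 0" using z'0 cvec_eq_0_iff u_def w_def by metis
    ultimately have "\<alpha>\<^sup>2 + \<beta>\<^sup>2 = 0" by auto
    then show "\<alpha> = 0 \<and> \<beta> = 0" by (simp add: sum_power2_eq_zero_iff)
  next
    have "Re x * Re x - - Im x * Im x = (cmod x)\<^sup>2" unfolding cmod_power2 by (simp add: power2_eq_square)
    then show "\<bar>Re x * Re x - - Im x * Im x\<bar> \<ge> 1" using x by simp
  qed
qed

subsection \<open>Powers of a matrix with small spectrum\<close>

definition exp_decay :: "(nat \<Rightarrow> 'a::real_normed_vector) \<Rightarrow> bool" where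
  "exp_decay u \<longleftrightarrow> (\<exists>C q. 0 \<le> C \<and> 0 \<le> q \<and> q < 1 \<and> (\<forall>k. norm (u k) \<le> C * q ^ k))"

lemma norm_vec_smult: "norm (c *s (z :: complex^'n)) = cmod c * norm z"
  by (simp add: norm_vec_def norm_mult L2_set_right_distrib[symmetric] L2_set_left_distrib
      flip: L2_set_right_distrib)

lemma scaleR_vec_complex: "r *\<^sub>R (z :: complex^'l) = of_real r *s z"
  by (simp add: vec_eq_iff) (simp add: scaleR_conv_of_real)

lemma exp_decay_recurrence:
  fixes u :: "nat \<Rightarrow> complex^'n"
  assumes rec: "\<And>k. u (Suc k) = r *s u k + y k" and r: "cmod r < 1" and y: "exp_decay y"
  shows "exp_decay u"
proof -
  obtain C q where C: "0 \<le> C" "0 \<le> q" "q < 1" "\<And>k. norm (y k) \<le> C * q ^ k"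
    using y unfolding exp_decay_def by blast
  define s where "s = (max (cmod r) q + 1) / 2"
  have s: "cmod r < s" "q < s" "s < 1" "0 < s" using r C unfolding s_def by (auto simp: max_def)
  define D where "D = norm (u 0) + C / (s - cmod r)"
  have "D * (s - cmod r) = norm (u 0) * (s - cmod r) + C" using s by (simp add: D_def distrib_right)
  moreover have "0 \<le> norm (u 0) * (s - cmod r)" using s by simp
  ultimately have D: "0 \<le> D" "C \<le> D * (s - cmod r)" using s C by (auto simp: D_def)
  have "norm (u k) \<le> D * s ^ k" for k
  proof (induction k)
    case 0 show ?case using s C by (simp add: D_def)
  next
    case (Suc k)
    have "norm (u (Suc k)) \<le> cmod r * norm (u k) + norm (y k)"
      unfolding rec by (metis norm_triangle_ineq norm_vec_smult)
    also have "\<dots> \<le> cmod r * (D * s ^ k) + C * s ^ k"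
    proof (intro add_mono mult_left_mono)
      have "C * q ^ k \<le> C * s ^ k" using s C by (intro mult_left_mono power_mono) auto
      then show "norm (y k) \<le> C * s ^ k" using C(4)[of k] by linarith
    qed (use Suc in auto)
    also have "\<dots> = (cmod r * D + C) * s ^ k" by (simp add: algebra_simps)
    also have "\<dots> \<le> (D * s) * s ^ k"
      using D s by (intro mult_right_mono) (auto simp: algebra_simps)
    finally show ?case by (simp add: algebra_simps)
  qed
  then show ?thesis unfolding exp_decay_def using D s by (intro exI[of _ D] exI[of _ s]) auto
qed

lemma exp_decay_matrix:
  assumes "exp_decay y" shows "exp_decay (\<lambda>k. (B :: complex^'n^'m) *v y k)"
proof -
  obtain C q where C: "0 \<le> C" "0 \<le> q" "q < 1" "\<And>k. norm (y k) \<le> C * q ^ k"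
    using assms unfolding exp_decay_def by blast
  have "bounded_linear ((*v) B)"
    by (intro linear_conv_bounded_linear[THEN iffD1])
      (auto simp: linear_iff matrix_vector_right_distrib vector_scalar_commute scaleR_vec_complex)
  then obtain K where K: "K > 0" "\<And>x. norm (B *v x) \<le> norm x * K"
    using bounded_linear.pos_bounded by blast
  have "norm (B *v y k) \<le> (C * K) * q ^ k" for k
    using order_trans[OF K(2) mult_right_mono[OF C(4)[of k], of K]] K(1) by (simp add: algebra_simps)
  then show ?thesis unfolding exp_decay_def using C K by (intro exI[of _ "C*K"] exI[of _ q]) auto
qed

lemma funpow_matrix_linear:
  fixes N :: "'a::field^'n^'n"
  shows "((*v) N ^^ k) (x + y) = ((*v) N ^^ k) x + ((*v) N ^^ k) y"
    "((*v) N ^^ k) (c *s x) = c *s ((*v) N ^^ k) x"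
    "((*v) N ^^ k) (x - y) = ((*v) N ^^ k) x - ((*v) N ^^ k) y"
  by (induction k) (simp_all add: matrix_vector_right_distrib vector_scalar_commute
      matrix_vector_mult_diff_distrib)

text \<open>If a nonzero polynomial in \<open>N\<close> annihilates \<open>z\<close>, split off a linear factor with root \<open>r\<close> and let
  \<open>y = N z - r z\<close>, whose orbit decays by induction. For \<open>r\<close> inside the unit disc the orbit of \<open>z\<close>
  solves a contracting recurrence driven by that of \<open>y\<close>. Otherwise \<open>r\<close> is no
  eigenvalue, and the orbit of \<open>z\<close> is the image of that of \<open>y\<close> under \<open>(N - r)\<^sup>-\<^sup>1\<close>.\<close>

lemma annihilated_imp_exp_decay:
  fixes N :: "complex^'n^'n"
  assumes spec: "\<And>x z. z \<noteq> 0 \<Longrightarrow> N *v z = x *s z \<Longrightarrow> cmod x < 1"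
  shows "p \<noteq> 0 \<Longrightarrow> degree p \<le> d \<Longrightarrow> (\<Sum>i\<le>d. coeff p i *s ((*v) N ^^ i) z) = 0
    \<Longrightarrow> exp_decay (\<lambda>k. ((*v) N ^^ k) z)"
proof (induction d arbitrary: p z)
  case 0
  then have "coeff p 0 \<noteq> 0" by (metis le_zero_eq leading_coeff_neq_0)
  with 0 have "z = 0" by (auto simp: vec_eq_iff)
  moreover have "((*v) N ^^ k) 0 = 0" for k by (induction k) auto
  ultimately show ?case unfolding exp_decay_def by (auto intro!: exI[of _ 0])
next
  case (Suc d)
  show ?case
  proof (cases "degree p = 0")
    case True
    then have "coeff p i = 0" if "i \<noteq> 0" for i using that by (simp add: coeff_eq_0)
    then have "(\<Sum>i\<le>Suc d. coeff p i *s ((*v) N ^^ i) z) = coeff p 0 *s z"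
      by (subst sum.mono_neutral_right[where S="{0}"]) auto
    moreover have "coeff p 0 \<noteq> 0" using True Suc.prems(1) by (metis leading_coeff_neq_0)
    ultimately have "z = 0" using Suc.prems by (auto simp: vec_eq_iff)
    moreover have "((*v) N ^^ k) 0 = 0" for k by (induction k) auto
    ultimately show ?thesis unfolding exp_decay_def by (auto intro!: exI[of _ 0])
  next
    case False
    then obtain r where "poly p r = 0"
      using fundamental_theorem_of_algebra[of p] by (auto simp: constant_degree)
    then obtain q where pq: "p = [:-r, 1:] * q" by (metis poly_eq_0_iff_dvd dvdE)
    have q0: "q \<noteq> 0" using pq Suc.prems(1) by auto
    have dq: "degree q \<le> d" using Suc.prems(2) q0 unfolding pq
      by (subst (asm) degree_mult_eq) auto
    define y where "y = N *v z - r *s z"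
    have cp: "coeff p i = (case i of 0 \<Rightarrow> 0 | Suc j \<Rightarrow> coeff q j) - r * coeff q i" for i
      unfolding pq by (simp add: coeff_pCons split: nat.splits)
    have "(\<Sum>i\<le>Suc d. coeff p i *s ((*v) N ^^ i) z)
       = (\<Sum>i\<le>Suc d. (case i of 0 \<Rightarrow> 0 | Suc j \<Rightarrow> coeff q j) *s ((*v) N ^^ i) z)
         - (\<Sum>i\<le>Suc d. (r * coeff q i) *s ((*v) N ^^ i) z)"
      unfolding cp by (simp add: vector_sub_rdistrib sum_subtractf)
    also have "(\<Sum>i\<le>Suc d. (case i of 0 \<Rightarrow> 0 | Suc j \<Rightarrow> coeff q j) *s ((*v) N ^^ i) z)
        = (\<Sum>i\<le>d. coeff q i *s ((*v) N ^^ i) (N *v z))"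
      by (subst sum.atMost_Suc_shift) (simp add: funpow_swap1)
    also have "(\<Sum>i\<le>Suc d. (r * coeff q i) *s ((*v) N ^^ i) z)
        = (\<Sum>i\<le>d. (r * coeff q i) *s ((*v) N ^^ i) z)"
      using dq by (simp add: coeff_eq_0)
    also have "(\<Sum>i\<le>d. coeff q i *s ((*v) N ^^ i) (N *v z)) - \<dots>
        = (\<Sum>i\<le>d. coeff q i *s ((*v) N ^^ i) y)"
      unfolding y_def sum_subtractf[symmetric]
      by (intro sum.cong) (auto simp: funpow_matrix_linear vec_eq_iff algebra_simps)
    finally have "(\<Sum>i\<le>d. coeff q i *s ((*v) N ^^ i) y) = 0" using Suc.prems(3) by simp
    then have dy: "exp_decay (\<lambda>k. ((*v) N ^^ k) y)" using Suc.IH[OF q0 dq] by simp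
    have rec: "((*v) N ^^ Suc k) z = r *s ((*v) N ^^ k) z + ((*v) N ^^ k) y" for k
      unfolding y_def funpow_matrix_linear by (simp add: funpow_swap1)
    show ?thesis
    proof (cases "cmod r < 1")
      case True
      show ?thesis by (rule exp_decay_recurrence[OF rec True dy])
    next
      case False
      define B where "B = N - mat r"
      have Bv: "B *v v = N *v v - r *s v" for v
      proof -
        have "mat r *v v = r *s v"
          by (simp add: matrix_vector_mult_def mat_def vec_eq_iff
            if_distrib[of "\<lambda>a. a * _"] cong: if_cong)
        then show ?thesis unfolding B_def matrix_vector_mult_diff_rdistrib by (rule arg_cong)
      qed
      have "\<forall>v. B *v v = 0 \<longrightarrow> v = 0" using spec False unfolding Bv by fastforce
      then obtain B' where B': "B' ** B = mat 1" using matrix_left_invertible_ker by blast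
      have "((*v) N ^^ k) z = B' *v (((*v) N ^^ k) y)" for k
      proof -
        have "((*v) N ^^ k) y = B *v ((*v) N ^^ k) z"
          using rec[of k] by (simp add: Bv algebra_simps)
        then show ?thesis by (simp add: matrix_vector_mul_assoc B')
      qed
      then show ?thesis using exp_decay_matrix[OF dy, of B'] by simp
    qed
  qed
qed

text \<open>The first \<open>n + 1\<close> vectors of the orbit of \<open>z\<close> are linearly dependent, and the coefficients of
  a relation form an annihilating polynomial.\<close>

lemma small_spectrum_exp_decay_complex:
  fixes N :: "complex^'n^'n"
  assumes spec: "\<And>x z. z \<noteq> 0 \<Longrightarrow> N *v z = x *s z \<Longrightarrow> cmod x < 1"
  shows "exp_decay (\<lambda>k. ((*v) N ^^ k) z)"
proof -
  define n where "n = CARD('n)"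
  define \<phi> where "\<phi> = (\<lambda>i. ((*v) N ^^ i) z)"
  have "\<exists>c. (\<exists>i\<le>n. c i \<noteq> 0) \<and> (\<Sum>i\<le>n. c i *s \<phi> i) = 0"
  proof (cases "inj_on \<phi> {..n}")
    case False
    then obtain i j where ij: "i \<le> n" "j \<le> n" "i \<noteq> j" "\<phi> i = \<phi> j" by (auto simp: inj_on_def)
    define c where "c = (\<lambda>l. if l = i then 1 else if l = j then - 1 else (0::complex))"
    have "(\<Sum>l\<le>n. c l *s \<phi> l) = (\<Sum>l\<in>{i,j}. c l *s \<phi> l)"
      using ij by (intro sum.mono_neutral_right) (auto simp: c_def)
    also have "\<dots> = 0" using ij by (simp add: c_def)
    finally show ?thesis using ij by (intro exI[of _ c]) (auto simp: c_def)
  next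
    case True
    have "vec.dependent (\<phi> ` {..n})"
    proof (rule ccontr)
      assume "\<not> vec.dependent (\<phi> ` {..n})"
      then have "card (\<phi> ` {..n}) \<le> vec.dim (UNIV :: (complex^'n) set)"
        by (metis vec.independent_card_le_dim subset_UNIV)
      then show False using True by (simp add: card_image vec_dim_card n_def del: vec.dim_UNIV)
    qed
    then have "\<exists>u. (\<exists>v\<in>\<phi> ` {..n}. u v \<noteq> 0) \<and> (\<Sum>v\<in>\<phi> ` {..n}. u v *s v) = 0"
      by (subst (asm) vec.dependent_finite) simp_all
    then obtain u where u: "\<exists>v\<in>\<phi> ` {..n}. u v \<noteq> 0" "(\<Sum>v\<in>\<phi> ` {..n}. u v *s v) = 0"
      by blast
    have "(\<Sum>i\<le>n. (u \<circ> \<phi>) i *s \<phi> i) = 0"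
      using u(2) unfolding sum.reindex[OF True] by (simp add: o_def)
    moreover have "\<exists>i\<le>n. (u \<circ> \<phi>) i \<noteq> 0" using u(1) by auto
    ultimately show ?thesis by blast
  qed
  then obtain c where c: "\<exists>i\<le>n. c i \<noteq> 0" "(\<Sum>i\<le>n. c i *s \<phi> i) = 0" by blast
  define p where "p = (\<Sum>i\<le>n. monom (c i) i)"
  have cp: "coeff p i = (if i \<le> n then c i else 0)" for i
    by (simp add: p_def coeff_sum sum.delta)
  have "p \<noteq> 0" using c(1) cp by (metis coeff_0)
  moreover have "degree p \<le> n" by (rule degree_le) (simp add: cp)
  moreover have "(\<Sum>i\<le>n. coeff p i *s ((*v) N ^^ i) z) = 0" using c(2) by (simp add: cp \<phi>_def)
  ultimately show ?thesis using annihilated_imp_exp_decay[of N p n z] spec by blast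
qed

lemma small_spectrum_exp_decay:
  fixes N :: "real^'n^'n"
  assumes spec: "\<And>x z. z \<noteq> 0 \<Longrightarrow> cmat N *v z = x *s z \<Longrightarrow> cmod x < 1"
  obtains C q where "0 \<le> C" "0 \<le> q" "q < 1" "\<And>k v. norm (((*v) N ^^ k) v) \<le> C * q ^ k * norm v"
proof -
  have nc: "norm (cvec v) = norm v" for v :: "real^'n" by (simp add: norm_vec_def cvec_def)
  have it: "((*v) (cmat N) ^^ k) (cvec v) = cvec (((*v) N ^^ k) v)" for k v
    by (induction k) (simp_all add: cmat_cvec)
  have "\<forall>i. \<exists>F. 0 \<le> fst F \<and> 0 \<le> snd F \<and> snd F < 1
      \<and> (\<forall>k. norm (((*v) N ^^ k) (axis i 1)) \<le> fst F * snd F ^ k)"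
  proof
    fix i
    show "\<exists>F. 0 \<le> fst F \<and> 0 \<le> snd F \<and> snd F < 1
      \<and> (\<forall>k. norm (((*v) N ^^ k) (axis i 1)) \<le> fst F * snd F ^ k)"
    using small_spectrum_exp_decay_complex[where N = "cmat N" and z = "cvec (axis i 1)", OF spec]
    by (simp add: exp_decay_def it nc)
  qed
  from choice[OF this] obtain F where F: "\<forall>i. 0 \<le> fst (F i) \<and> 0 \<le> snd (F i) \<and> snd (F i) < 1
      \<and> (\<forall>k. norm (((*v) N ^^ k) (axis i 1)) \<le> fst (F i) * snd (F i) ^ k)" ..
  define C q where "C i = fst (F i)" and "q i = snd (F i)" for i
  have C: "\<And>i. 0 \<le> C i" "\<And>i. 0 \<le> q i" "\<And>i. q i < 1"
    "\<And>i k. norm (((*v) N ^^ k) (axis i 1)) \<le> C i * q i ^ k"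
    using F by (auto simp: C_def q_def)
  define Q where "Q = Max (range q)"
  have Q: "\<And>i. q i \<le> Q" "Q < 1" unfolding Q_def using C(3) by auto
  have Q0: "0 \<le> Q" using Q(1) C(2) by (meson order_trans)
  have bound: "norm (((*v) N ^^ k) v) \<le> (\<Sum>i\<in>UNIV. C i) * Q ^ k * norm v" for k v
  proof -
    have lin: "linear ((*v) N ^^ k)"
      by (induction k) (auto simp: linear_iff matrix_vector_right_distrib matrix_vector_mult_scaleR)
    have "((*v) N ^^ k) v = ((*v) N ^^ k) (\<Sum>i\<in>UNIV. v $ i *\<^sub>R axis i 1)"
      using basis_expansion[of v] by (simp add: scalar_mult_eq_scaleR)
    also have "\<dots> = (\<Sum>i\<in>UNIV. v $ i *\<^sub>R ((*v) N ^^ k) (axis i 1))"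
      by (simp add: linear_sum[OF lin] linear_scale[OF lin])
    also have "norm \<dots> \<le> (\<Sum>i\<in>UNIV. norm v * (C i * Q ^ k))"
    proof (rule sum_norm_le)
      fix i :: 'n
      have "norm (((*v) N ^^ k) (axis i 1)) \<le> C i * Q ^ k"
        using C(4)[of k i] mult_left_mono[OF power_mono[OF Q(1)[of i] C(2)] C(1)[of i], of k] by linarith
      then show "norm (v $ i *\<^sub>R ((*v) N ^^ k) (axis i 1)) \<le> norm v * (C i * Q ^ k)"
        by (simp add: component_le_norm_cart mult_mono)
    qed
    also have "\<dots> = (\<Sum>i\<in>UNIV. C i) * Q ^ k * norm v"
      by (simp add: sum_distrib_left sum_distrib_right algebra_simps)
    finally show ?thesis .
  qed
  show ?thesis by (rule that[OF _ Q0 Q(2) bound]) (simp add: sum_nonneg C(1))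
qed

text \<open>Because 1 is an eigenvalue of \<open>M\<close>, there is a left eigenvector \<open>a\<close>. It cannot be
  orthogonal to \<open>e\<close>: otherwise it would be fixed by the deflated matrix \<open>N\<close> from the left, although the powers of \<open>N\<close>
  tend to 0. Normalized by \<open>a \<bullet> e = 1\<close>, it defines the projection along \<open>e\<close> that commutes with
  \<open>M\<close>. Modulo \<open>e\<close> the matrices \<open>M\<close> and \<open>N\<close> agree, so the decay carries over.\<close>

theorem stable_splitting:
  fixes M :: "real^'n^'n"
  assumes e: "M *v e = e" "e $ k \<noteq> 0"
    and spec: "\<And>x z. z \<noteq> 0 \<Longrightarrow> cmat (deflate M e k) *v z = x *s z \<Longrightarrow> cmod x < 1"
  obtains a C q where "\<And>v. a \<bullet> (M *v v) = a \<bullet> v" "a \<bullet> e = 1" "0 \<le> C" "0 \<le> q" "q < 1"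
    "\<And>j v. norm (((*v) M ^^ j) (v - (a \<bullet> v) *\<^sub>R e)) \<le> C * q ^ j * norm v"
proof -
  define N where "N = deflate M e k"
  obtain C q where C: "0 \<le> C" "0 \<le> q" "q < 1"
    "\<And>j v. norm (((*v) N ^^ j) v) \<le> C * q ^ j * norm v"
    using small_spectrum_exp_decay[of N] spec unfolding N_def by blast
  define p where "p v = v - (v $ k / e $ k) *\<^sub>R e" for v
  have pe: "p e = 0" and pp: "p (p v) = p v" and pk: "p v $ k = 0" for v using e by (simp_all add: p_def)
  have N: "N *v v = M *v p v" for v
    by (simp add: N_def deflate_mult_real p_def matrix_vector_mult_diff_distrib matrix_vector_mult_scaleR e)
  have linp: "linear p" by (auto simp: p_def linear_iff algebra_simps add_divide_distrib)
  have pMp: "p (M *v p v) = p (M *v v)" for v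
    using linear_diff[OF linp] linear_scale[OF linp] pe
    by (simp add: p_def[of v] matrix_vector_mult_diff_distrib matrix_vector_mult_scaleR e)
  have pN: "p (((*v) N ^^ j) v) = p (((*v) M ^^ j) v)" for j v
  proof (induction j)
    case (Suc j)
    have "p (((*v) N ^^ Suc j) v) = p (M *v p (((*v) N ^^ j) v))" by (simp add: N)
    also have "\<dots> = p (M *v p (((*v) M ^^ j) v))" by (simp only: Suc)
    also have "\<dots> = p (((*v) M ^^ Suc j) v)" by (simp add: pMp)
    finally show ?case .
  qed simp
  obtain a0 where a0: "a0 \<noteq> 0" "\<And>v. a0 \<bullet> (M *v v) = a0 \<bullet> v"
  proof -
    define B where "B = transpose M - mat 1"
    have "e \<noteq> 0" using e(2) by auto
    moreover have "transpose B *v e = 0"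
      by (simp add: B_def transpose_def vec_eq_iff matrix_vector_mult_def mat_def left_diff_distrib
          sum_subtractf if_distrib[of "\<lambda>a. a * _"] cong: if_cong)
        (use e(1) in \<open>simp add: matrix_vector_mult_def vec_eq_iff\<close>)
    ultimately have "\<not> (\<exists>B'. B' ** transpose B = mat 1)" using matrix_left_invertible_ker by blast
    then have "\<not> (\<exists>B'. B' ** B = mat 1)"
      by (metis left_invertible_transpose matrix_left_right_inverse)
    then obtain a where a: "a \<noteq> 0" "B *v a = 0" using matrix_left_invertible_ker by blast
    have "transpose M *v a = a"
      using a(2) by (simp add: B_def matrix_vector_mult_diff_rdistrib)
    then have "a \<bullet> (M *v v) = a \<bullet> v" for v by (metis dot_lmul_matrix transpose_matrix_vector)
    with a show ?thesis using that by blast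
  qed
  have a0e: "a0 \<bullet> e \<noteq> 0"
  proof
    assume 0: "a0 \<bullet> e = 0"
    have inv: "a0 \<bullet> (((*v) N ^^ j) v) = a0 \<bullet> v" for j v
      by (induction j) (simp_all add: N a0 p_def inner_diff_right 0)
    have "a0 \<bullet> v \<le> 0" for v
    proof (rule LIMSEQ_le_const)
      show "(\<lambda>j. norm a0 * (C * q ^ j * norm v)) \<longlonglongrightarrow> 0"
        using C LIMSEQ_power_zero[of q] by (auto intro!: tendsto_eq_intros)
      have "a0 \<bullet> v \<le> norm a0 * (C * q ^ j * norm v)" for j
        using norm_cauchy_schwarz[of a0 "((*v) N ^^ j) v"] mult_left_mono[OF C(4)[of j v] norm_ge_zero[of a0]]
        unfolding inv by linarith
      then show "\<exists>N. \<forall>n\<ge>N. a0 \<bullet> v \<le> norm a0 * (C * q ^ n * norm v)" by blast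
    qed
    from this[of a0] show False using a0(1) by (metis inner_ge_zero inner_eq_zero_iff order_antisym)
  qed
  define a where "a = (1 / (a0 \<bullet> e)) *\<^sub>R a0"
  have a: "a \<bullet> (M *v v) = a \<bullet> v" "a \<bullet> e = 1" for v using a0 a0e by (simp_all add: a_def)
  define P where "P v = v - (a \<bullet> v) *\<^sub>R e" for v
  have linP: "linear P" by (auto simp: P_def linear_iff inner_add_right algebra_simps)
  have Pp: "P (p v) = P v" for v
    using linear_diff[OF linP] linear_scale[OF linP] by (simp add: p_def) (simp add: P_def a)
  have PM: "P (M *v v) = M *v P v" for v
    by (simp add: P_def a matrix_vector_mult_diff_distrib matrix_vector_mult_scaleR e)
  have PMj: "P (((*v) M ^^ j) v) = ((*v) M ^^ j) (P v)" for j v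
    by (induction j) (simp_all add: PM)
  obtain K where K: "K > 0" "\<And>v. norm (P (p v)) \<le> norm v * K"
    using bounded_linear.pos_bounded[OF linear_conv_bounded_linear[THEN iffD1, OF linear_compose[OF linp linP]]]
    by auto
  have "norm (((*v) M ^^ j) (v - (a \<bullet> v) *\<^sub>R e)) \<le> (C * K) * q ^ j * norm v" for j v
  proof -
    have "((*v) M ^^ j) (v - (a \<bullet> v) *\<^sub>R e) = P (p (((*v) N ^^ j) v))"
      unfolding pN Pp PMj by (simp add: P_def)
    then show ?thesis
      using order_trans[OF K(2) mult_right_mono[OF C(4)]] K(1) by (simp add: algebra_simps)
  qed
  then show ?thesis using that[OF a, of "C * K" q] C K by simp
qed


section \<open>Simultaneous diagonalization\<close>

lemma quadratic_form_perturb: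
  fixes b c :: real
  assumes "\<And>t. 2 * t * b \<le> t\<^sup>2 * c"
  shows "b = 0"
proof (rule ccontr)
  assume "b \<noteq> 0"
  define t where "t = b / (\<bar>c\<bar> + 1)"
  have "2 * t * b \<le> t\<^sup>2 * (\<bar>c\<bar> + 1)"
    using assms[of t] mult_left_mono[OF _ zero_le_power2, of c "\<bar>c\<bar> + 1" t] by linarith
  also have "\<dots> = t * b" by (simp add: t_def power2_eq_square)
  finally have "t * b \<le> 0" by (simp add: mult.commute)
  moreover have "t * b = b\<^sup>2 / (\<bar>c\<bar> + 1)" by (simp add: t_def power2_eq_square)
  moreover have "\<dots> > 0" using \<open>b \<noteq> 0\<close> by simp
  ultimately show False by simp
qed

lemma sym_matrix_dot:
  fixes P :: "real^'n^'n"
  assumes "transpose P = P" shows "v \<bullet> (P *v w) = w \<bullet> (P *v v)"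
  using assms by (metis dot_lmul_matrix inner_commute transpose_matrix_vector)

text \<open>A maximizer \<open>e\<close> of the Rayleigh quotient on \<open>U\<close>: perturbing \<open>e\<close> in a \<open>P\<close>-orthogonal direction \<open>w\<close>
  has no first-order effect, which is the \<open>Q\<close>-orthogonality of \<open>e\<close> and \<open>w\<close>.\<close>

lemma pencil_maximizer:
  fixes P Q :: "real^'n^'n"
  assumes P: "pos_definite P" and Q: "transpose Q = Q" and U: "subspace U" "U \<noteq> {0}"
  obtains e where "e \<in> U" "e \<bullet> (P *v e) = 1"
    "\<And>w. w \<in> U \<Longrightarrow> e \<bullet> (P *v w) = 0 \<Longrightarrow> e \<bullet> (Q *v w) = 0"
proof -
  have Pp: "v \<bullet> (P *v v) > 0" if "v \<noteq> 0" for v using P that by (simp add: pos_definite_def)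
  have Ps: "transpose P = P" using P by (simp add: pos_definite_def)
  define S where "S = U \<inter> sphere 0 1"
  obtain u where u: "u \<in> U" "u \<noteq> 0" using U subspace_0 by blast
  have "(1 / norm u) *\<^sub>R u \<in> S" using u U by (simp add: S_def subspace_scale)
  moreover have "compact S" unfolding S_def
    using closed_subspace[OF U(1)] by (simp add: closed_Int_compact)
  moreover have "continuous_on S (\<lambda>v. (v \<bullet> (Q *v v)) / (v \<bullet> (P *v v)))"
  proof (intro continuous_intros linear_continuous_on matrix_vector_mul_bounded_linear ballI)
    fix v assume "v \<in> S"
    then have "v \<noteq> 0" by (auto simp: S_def)
    then show "v \<bullet> (P *v v) \<noteq> 0" using Pp[of v] by simp
  qed
  ultimately obtain v where v: "v \<in> S"
    "\<And>w. w \<in> S \<Longrightarrow> (w \<bullet> (Q *v w)) / (w \<bullet> (P *v w)) \<le> (v \<bullet> (Q *v v)) / (v \<bullet> (P *v v))"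
    using continuous_attains_sup[of S "\<lambda>v. (v \<bullet> (Q *v v)) / (v \<bullet> (P *v v))"] by blast
  define l where "l = (v \<bullet> (Q *v v)) / (v \<bullet> (P *v v))"
  have v0: "v \<noteq> 0" "v \<in> U" using v(1) by (auto simp: S_def)
  have le: "w \<bullet> (Q *v w) \<le> l * (w \<bullet> (P *v w))" if "w \<in> U" for w
  proof (cases "w = 0")
    case False
    define x where "x = (1 / norm w) *\<^sub>R w"
    have w: "w = norm w *\<^sub>R x" using False by (simp add: x_def)
    have "x \<in> S" using that False U by (simp add: S_def x_def subspace_scale)
    moreover from this have "x \<bullet> (P *v x) > 0" using Pp[of x] by (force simp: S_def)
    ultimately have "x \<bullet> (Q *v x) \<le> l * (x \<bullet> (P *v x))"
      using v(2)[of x] unfolding l_def by (simp add: pos_divide_le_eq)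
    then have "norm w * norm w * (x \<bullet> (Q *v x)) \<le> norm w * norm w * (l * (x \<bullet> (P *v x)))"
      by (intro mult_left_mono) auto
    then show ?thesis by (subst (1 2 3 4) w) (simp add: matrix_vector_mult_scaleR mult_ac)
  qed simp
  define p where "p = v \<bullet> (P *v v)"
  have p: "p > 0" using Pp v0 by (simp add: p_def)
  define e where "e = (1 / sqrt p) *\<^sub>R v"
  have eU: "e \<in> U" using v0 U by (simp add: e_def subspace_scale)
  have eP: "e \<bullet> (P *v e) = 1" using p
    by (simp add: e_def matrix_vector_mult_scaleR flip: p_def)
  have eQ: "e \<bullet> (Q *v e) = l" using p
    by (simp add: e_def matrix_vector_mult_scaleR l_def flip: p_def)
  show ?thesis
  proof (rule that[OF eU eP])
    fix w assume w: "w \<in> U" "e \<bullet> (P *v w) = 0"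
    show "e \<bullet> (Q *v w) = 0"
    proof (rule quadratic_form_perturb)
      fix t :: real
      have "e + t *\<^sub>R w \<in> U" using eU w U by (simp add: subspace_add subspace_scale)
      from le[OF this] have
        "e \<bullet> (Q *v e) + 2 * t * (e \<bullet> (Q *v w)) + t\<^sup>2 * (w \<bullet> (Q *v w))
          \<le> l * (e \<bullet> (P *v e) + 2 * t * (e \<bullet> (P *v w)) + t\<^sup>2 * (w \<bullet> (P *v w)))"
        using sym_matrix_dot[OF Q, of w e] sym_matrix_dot[OF Ps, of w e]
        by (simp add: matrix_vector_right_distrib matrix_vector_mult_scaleR inner_add_left
            inner_add_right power2_eq_square algebra_simps)
      then show "2 * t * (e \<bullet> (Q *v w)) \<le> t\<^sup>2 * (l * (w \<bullet> (P *v w)) - w \<bullet> (Q *v w))"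
        using w(2) eP eQ by (simp add: algebra_simps)
    qed
  qed
qed

lemma simultaneous_diagonal_basis_subspace:
  fixes P Q :: "real^'n^'n"
  assumes P: "pos_definite P" and Q: "transpose Q = Q"
  shows "subspace U \<Longrightarrow> dim U = d \<Longrightarrow> \<exists>e :: nat \<Rightarrow> real^'n. (\<forall>i<d. e i \<in> U) \<and>
     (\<forall>i<d. \<forall>j<d. e i \<bullet> (P *v e j) = (if i = j then 1 else 0)) \<and>
     (\<forall>i<d. \<forall>j<d. i \<noteq> j \<longrightarrow> e i \<bullet> (Q *v e j) = 0)"
proof (induction d arbitrary: U)
  case (Suc d)
  have Ps: "transpose P = P" using P by (simp add: pos_definite_def)
  have "U \<noteq> {0}" using Suc.prems(2) by auto
  from pencil_maximizer[OF P Q Suc.prems(1) this] obtain e0 where e0: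
    "e0 \<in> U" "e0 \<bullet> (P *v e0) = 1" "\<And>w. w \<in> U \<Longrightarrow> e0 \<bullet> (P *v w) = 0 \<Longrightarrow> e0 \<bullet> (Q *v w) = 0"
    by blast
  define U' where "U' = {w \<in> U. e0 \<bullet> (P *v w) = 0}"
  have U': "subspace U'" using Suc.prems(1) unfolding U'_def subspace_def
    by (auto simp: matrix_vector_right_distrib matrix_vector_mult_scaleR inner_add_right)
  have "e0 \<notin> span U'" using e0(2) U' by (auto simp: span_eq_iff[THEN iffD2] U'_def)
  then have "dim (insert e0 U') = Suc (dim U')" by (simp add: dim_insert)
  moreover have "U \<subseteq> span (insert e0 U')"
  proof
    fix w assume w: "w \<in> U"
    define c where "c = e0 \<bullet> (P *v w)"
    have "w - c *\<^sub>R e0 \<in> U'" using w e0 Suc.prems(1)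
      by (simp add: U'_def subspace_diff subspace_scale matrix_vector_mult_diff_distrib
          matrix_vector_mult_scaleR inner_diff_right c_def)
    then show "w \<in> span (insert e0 U')" unfolding span_insert
      using span_base by blast
  qed
  then have "dim (insert e0 U') = dim U"
    using e0(1) Suc.prems(1)
    by (intro antisym dim_subset order_trans[OF dim_subset eq_refl[OF dim_span]]) (auto simp: U'_def)
  ultimately have "dim U' = d" using Suc.prems(2) by simp
  from Suc.IH[OF U' this] obtain e where e: "\<And>i. i < d \<Longrightarrow> e i \<in> U'"
    "\<And>i j. i < d \<Longrightarrow> j < d \<Longrightarrow> e i \<bullet> (P *v e j) = (if i = j then 1 else 0)"
    "\<And>i j. i < d \<Longrightarrow> j < d \<Longrightarrow> i \<noteq> j \<Longrightarrow> e i \<bullet> (Q *v e j) = 0" by metis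
  define e' where "e' i = (case i of 0 \<Rightarrow> e0 | Suc j \<Rightarrow> e j)" for i
  have o: "e0 \<bullet> (P *v e j) = 0" "e j \<bullet> (P *v e0) = 0" "e0 \<bullet> (Q *v e j) = 0" "e j \<bullet> (Q *v e0) = 0"
    if "j < d" for j
  proof -
    show "e0 \<bullet> (P *v e j) = 0" "e0 \<bullet> (Q *v e j) = 0" using e(1)[OF that] e0(3) by (auto simp: U'_def)
    then show "e j \<bullet> (P *v e0) = 0" "e j \<bullet> (Q *v e0) = 0"
      using sym_matrix_dot[OF Ps] sym_matrix_dot[OF Q] by metis+
  qed
  show ?case
  proof (intro exI[of _ e'] conjI allI impI)
    fix i assume "i < Suc d"
    then show "e' i \<in> U" using e0(1) e(1) by (auto simp: e'_def U'_def split: nat.splits)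
  next
    fix i j assume "i < Suc d" "j < Suc d"
    then show "e' i \<bullet> (P *v e' j) = (if i = j then 1 else 0)"
      using e0(2) e(2) o by (cases i; cases j) (auto simp: e'_def)
  next
    fix i j assume "i < Suc d" "j < Suc d" "i \<noteq> j"
    then show "e' i \<bullet> (Q *v e' j) = 0"
      using e(3) o by (cases i; cases j) (auto simp: e'_def)
  qed
qed simp

lemma simultaneous_diagonal_basis:
  fixes P Q :: "real^'n^'n"
  assumes P: "pos_definite P" and Q: "transpose Q = Q"
  obtains e :: "'n \<Rightarrow> real^'n" and l where
    "\<And>i j. e i \<bullet> (P *v e j) = (if i = j then 1 else 0)"
    "\<And>i j. e i \<bullet> (Q *v e j) = (if i = j then l i else 0)"
proof -
  obtain e :: "nat \<Rightarrow> real^'n" where e: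
     "\<forall>i<CARD('n). \<forall>j<CARD('n). e i \<bullet> (P *v e j) = (if i = j then 1 else 0)"
     "\<forall>i<CARD('n). \<forall>j<CARD('n). i \<noteq> j \<longrightarrow> e i \<bullet> (Q *v e j) = 0"
    using simultaneous_diagonal_basis_subspace[OF P Q subspace_UNIV dim_UNIV] by auto
  obtain h :: "'n \<Rightarrow> nat" where h: "bij_betw h UNIV {..<CARD('n)}"
    using ex_bij_betw_finite_nat[of "UNIV::'n set"] by (auto simp: atLeast0LessThan)
  have hl: "h i < CARD('n)" and hi: "h i = h j \<longleftrightarrow> i = j" for i j
    using h by (auto simp: bij_betw_def inj_eq)
  show ?thesis
    by (rule that[of "e \<circ> h" "\<lambda>i. e (h i) \<bullet> (Q *v e (h i))"]) (use e hl hi in auto)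
qed

lemma dot_matrix_columns:
  fixes P :: "real^'n^'n" and e :: "'n \<Rightarrow> real^'n"
  defines "E \<equiv> (\<chi> i j. e j $ i)"
  shows "(transpose E ** P ** E) $ i $ j = e i \<bullet> (P *v e j)"
proof -
  have "(transpose E ** P ** E) $ i $ j = ((transpose E ** P) *v e j) $ i"
    by (simp add: E_def matrix_matrix_mult_def[of "_ ** _"] matrix_vector_mult_def)
  also have "\<dots> = (transpose E *v (P *v e j)) $ i" by (simp add: matrix_vector_mul_assoc)
  also have "\<dots> = e i \<bullet> (P *v e j)"
    by (simp add: E_def matrix_vector_mult_def transpose_def inner_vec_def)
  finally show ?thesis .
qed

lemma proots_pencil_poly:
  fixes P Q :: "real^'n^'n" and e :: "'n \<Rightarrow> real^'n"
  assumes eP: "\<And>i j. e i \<bullet> (P *v e j) = (if i = j then 1 else 0)"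
    and eQ: "\<And>i j. e i \<bullet> (Q *v e j) = (if i = j then l i else 0)"
  shows "proots (pencil_poly Q P) = image_mset l (mset_set UNIV)"
proof -
  define E where "E = (\<chi> i j. e j $ i)"
  have "transpose E ** P ** E = mat 1"
    using dot_matrix_columns[of e P] eP by (simp add: vec_eq_iff E_def mat_def)
  then have "det (transpose E ** P ** E) = 1" by simp
  then have dE: "det E \<noteq> 0" by (auto simp: det_mul)
  have "poly (smult ((det E)\<^sup>2) (pencil_poly Q P)) x = poly (\<Prod>i\<in>UNIV. [:l i, -1:]) x" for x
  proof -
    define N where "N = (\<chi> i j. Q $ i $ j - x * P $ i $ j)"
    have Nv: "N *v v = Q *v v - x *\<^sub>R (P *v v)" for v
      by (simp add: N_def matrix_vector_mult_def vec_eq_iff sum_subtractf sum_distrib_left algebra_simps)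
    have "(transpose E ** N ** E) $ i $ j = (if i = j then l i - x else 0)" for i j
      unfolding E_def dot_matrix_columns Nv by (simp add: inner_diff_right eP eQ)
    then have "det (transpose E ** N ** E) = (\<Prod>i\<in>UNIV. l i - x)"
      by (subst det_diagonal) auto
    then show ?thesis
      by (simp add: det_mul poly_pencil_poly poly_prod N_def power2_eq_square mult_ac)
  qed
  then have "smult ((det E)\<^sup>2) (pencil_poly Q P) = (\<Prod>i\<in>UNIV. [:l i, -1:])"
    by (simp only: poly_eq_poly_eq_iff[symmetric] fun_eq_iff) simp
  then have "proots (pencil_poly Q P) = proots (\<Prod>i\<in>UNIV. [:l i, -1:])"
    using dE by (metis power_eq_0_iff proots_smult)
  also have "\<dots> = (\<Sum>i\<in>UNIV. {#l i#})" by (subst proots_prod) (auto simp: proots_lin)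
  also have "\<dots> = image_mset l (mset_set UNIV)"
    by (induction rule: finite_induct[OF finite_class.finite_UNIV]) auto
  finally show ?thesis .
qed

lemma transpose_add: "transpose (X + Y) = transpose X + transpose (Y :: real^'n^'n)"
  by (simp add: transpose_def vec_eq_iff)

lemma lyapunov_matrix_symmetric:
  fixes A P D :: "real^'n^'n"
  assumes "transpose P = P" "transpose D = D"
  shows "transpose (transpose A ** P + P ** A + D) = transpose A ** P + P ** A + D"
  by (simp add: transpose_add matrix_transpose_mul assms add.commute)

lemma lyapunov_roots_spectrum:
  fixes A P D :: "real^'n^'n"
  defines "Q \<equiv> transpose A ** P + P ** A + D"
  assumes n: "CARD('n) \<ge> 2" and P: "pos_definite P" and D: "transpose D = D"
  obtains e :: "'n \<Rightarrow> real^'n" and l r0 r1 rs where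
    "\<And>i j. e i \<bullet> (P *v e j) = (if i = j then 1 else 0)"
    "\<And>i j. e i \<bullet> (Q *v e j) = (if i = j then l i else 0)"
    "lyapunov_roots A P D = r0 # r1 # rs" "r0 \<ge> r1" "\<And>x. x \<in> set rs \<Longrightarrow> x \<le> r1"
    "mset (r0 # r1 # rs) = image_mset l (mset_set UNIV)"
proof -
  have "transpose Q = Q" using P unfolding Q_def by (intro lyapunov_matrix_symmetric D) (simp add: pos_definite_def)
  from simultaneous_diagonal_basis[OF P this] obtain e :: "'n \<Rightarrow> real^'n" and l where
    eP: "\<And>i j. e i \<bullet> (P *v e j) = (if i = j then 1 else 0)" and
    eQ: "\<And>i j. e i \<bullet> (Q *v e j) = (if i = j then l i else 0)" by metis
  define R where "R = lyapunov_roots A P D"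
  have mR: "mset R = image_mset l (mset_set UNIV)"
    using proots_pencil_poly[OF eP eQ] by (simp add: R_def lyapunov_roots_def Q_def)
  have "length R \<ge> 2" using arg_cong[OF mR, of size] n by simp
  then obtain r0 r1 rs where R: "R = r0 # r1 # rs" by (metis Suc_le_length_iff numeral_2_eq_2)
  have "sorted (rev R)" by (simp add: R_def lyapunov_roots_def)
  then have "sorted_wrt (\<lambda>x y. y \<le> x) R" using sorted_wrt_rev[of "(\<le>)" R] by simp
  then show ?thesis using R mR unfolding R_def by (intro that[OF eP eQ, of r0 r1 rs]) auto
qed

text \<open>Ky Fan's inequality. In a simultaneously diagonalizing basis the left-hand side is \<open>\<Sum>l\<^sub>i g\<^sub>i\<close> with weights
  \<open>g\<^sub>i\<close> that sum to 2 and, by Bessel's inequality, lie between 0 and 1. Shifting by the second root \<open>r1\<close>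
  leaves only the positive part of the roots, which is \<open>r0 - r1\<close>.\<close>

lemma orthonormal_pair_le_top_two:
  fixes A P D :: "real^'n^'n"
  defines "Q \<equiv> transpose A ** P + P ** A + D"
  assumes n: "CARD('n) \<ge> 2" and P: "pos_definite P" and D: "transpose D = D"
    and u: "u \<bullet> (P *v u) = 1" "v \<bullet> (P *v v) = 1" "u \<bullet> (P *v v) = 0"
  shows "u \<bullet> (Q *v u) + v \<bullet> (Q *v v) \<le> lyapunov_roots A P D ! 0 + lyapunov_roots A P D ! 1"
proof -
  obtain e :: "'n \<Rightarrow> real^'n" and l r0 r1 rs where
    eP: "\<And>i j. e i \<bullet> (P *v e j) = (if i = j then 1 else 0)" and
    eQ: "\<And>i j. e i \<bullet> (Q *v e j) = (if i = j then l i else 0)" and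
    R: "lyapunov_roots A P D = r0 # r1 # rs" "r0 \<ge> r1" "\<And>x. x \<in> set rs \<Longrightarrow> x \<le> r1"
    "mset (r0 # r1 # rs) = image_mset l (mset_set UNIV)"
    using lyapunov_roots_spectrum[OF n P D] unfolding Q_def by metis
  define E where "E = (\<chi> i j. e j $ i)"
  define co where "co w = transpose E *v (P *v w)" for w
  have EPE: "transpose E ** P ** E = mat 1"
    using dot_matrix_columns[of e P] eP by (simp add: vec_eq_iff E_def mat_def)
  then have "E ** (transpose E ** P) = mat 1" using matrix_left_right_inverse by blast
  then have Eco: "E *v co w = w" for w
    by (simp add: co_def matrix_vector_mul_assoc matrix_mul_assoc)
  have EQE: "(transpose E ** Q ** E) *v x = (\<chi> i. l i * x $ i)" for x
    using dot_matrix_columns[of e Q] eQ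
    by (simp add: vec_eq_iff E_def matrix_vector_mult_def if_distrib[of "\<lambda>a. a * _"] cong: if_cong)
  have move: "w \<bullet> (X *v w') = co w \<bullet> ((transpose E ** X ** E) *v co w')" for w w' X
    by (metis (no_types, lifting) Eco dot_lmul_matrix matrix_vector_mul_assoc transpose_matrix_vector
        inner_commute)
  have q: "w \<bullet> (Q *v w) = (\<Sum>i\<in>UNIV. l i * (co w $ i)\<^sup>2)" for w
    unfolding move[of w Q] EQE by (simp add: inner_vec_def power2_eq_square mult_ac)
  have p: "w \<bullet> (P *v w') = co w \<bullet> co w'" for w w'
    unfolding move[of w P] EPE by simp
  define g where "g i = (co u $ i)\<^sup>2 + (co v $ i)\<^sup>2" for i
  have orth: "co u \<bullet> co u = 1" "co v \<bullet> co v = 1" "co u \<bullet> co v = 0" using u p by auto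
  have gsum: "(\<Sum>i\<in>UNIV. g i) = 2"
    using orth by (simp add: g_def inner_vec_def power2_eq_square sum.distrib)
  have g1: "g i \<le> 1" for i
  proof -
    define x where "x = (co u $ i) *\<^sub>R co u + (co v $ i) *\<^sub>R co v"
    have "co v \<bullet> co u = 0" using orth(3) by (simp add: inner_commute)
    then have xx: "x \<bullet> x = g i"
      by (simp add: x_def g_def inner_add_left inner_add_right power2_eq_square orth)
    have xi: "x $ i = g i" by (simp add: x_def g_def power2_eq_square)
    have "(x $ i)\<^sup>2 \<le> x \<bullet> x" using component_le_norm_cart[of x i]
      by (metis abs_le_square_iff abs_norm_cancel power2_norm_eq_inner)
    then have "g i * g i \<le> g i" using xx xi by (simp add: power2_eq_square)
    moreover have "g i \<ge> 0" by (simp add: g_def)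
    ultimately show ?thesis
      by (metis mult_le_cancel_left1 mult.right_neutral mult_left_le_imp_le not_less order_less_le zero_le_one)
  qed
  have g0: "g i \<ge> 0" for i by (simp add: g_def)
  have "u \<bullet> (Q *v u) + v \<bullet> (Q *v v) = (\<Sum>i\<in>UNIV. l i * g i)"
    unfolding q g_def by (simp add: sum.distrib distrib_left)
  also have "\<dots> = (\<Sum>i\<in>UNIV. (l i - r1) * g i) + 2 * r1"
    using gsum by (simp add: left_diff_distrib sum_subtractf flip: sum_distrib_left)
  also have "(\<Sum>i\<in>UNIV. (l i - r1) * g i) \<le> (\<Sum>i\<in>UNIV. max 0 (l i - r1))"
  proof (rule sum_mono)
    fix i
    have "(l i - r1) * g i \<le> max 0 (l i - r1) * g i" using g0 by (intro mult_right_mono) auto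
    also have "\<dots> \<le> max 0 (l i - r1) * 1" using g1 by (intro mult_left_mono) auto
    finally show "(l i - r1) * g i \<le> max 0 (l i - r1)" by simp
  qed
  also have "\<dots> = sum_mset (image_mset (\<lambda>x. max 0 (x - r1)) (mset (r0 # r1 # rs)))"
    unfolding R(4) by (simp add: sum_unfold_sum_mset image_mset.compositionality o_def)
  also have "\<dots> = (r0 - r1) + (\<Sum>x\<leftarrow>rs. max 0 (x - r1))"
    using R(2) by (simp add: sum_mset_sum_list flip: mset_map)
  also have "(\<Sum>x\<leftarrow>rs. max 0 (x - r1)) = (\<Sum>x\<leftarrow>rs. 0)"
    using R(3) by (intro arg_cong[where f=sum_list] map_cong) auto
  finally show ?thesis using R(1) by simp
qed

text \<open>All roots are at most 0. Two vanishing roots would belong to independent vectors in the null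
  set, which is contained in a line.\<close>

lemma top_two_sum_neg_if_semidefinite:
  fixes A P D :: "real^'n^'n"
  defines "Q \<equiv> transpose A ** P + P ** A + D"
  assumes n: "CARD('n) \<ge> 2" and P: "pos_definite P" and D: "transpose D = D"
    and neg: "\<And>v. v \<bullet> (Q *v v) \<le> 0"
    and ker: "\<And>v. v \<bullet> (Q *v v) = 0 \<Longrightarrow> \<exists>c. v = c *\<^sub>R w"
  shows "top_two_sum_neg A P D"
proof -
  obtain e :: "'n \<Rightarrow> real^'n" and l r0 r1 rs where
    eP: "\<And>i j. e i \<bullet> (P *v e j) = (if i = j then 1 else 0)" and
    eQ: "\<And>i j. e i \<bullet> (Q *v e j) = (if i = j then l i else 0)" and
    R: "lyapunov_roots A P D = r0 # r1 # rs" "r0 \<ge> r1" "\<And>x. x \<in> set rs \<Longrightarrow> x \<le> r1"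
    "mset (r0 # r1 # rs) = image_mset l (mset_set UNIV)"
    using lyapunov_roots_spectrum[OF n P D] unfolding Q_def by metis
  have l0: "l i \<le> 0" for i using neg[of "e i"] eQ[of i i] by simp
  have one: "i = j" if "l i = 0" "l j = 0" for i j
  proof (rule ccontr)
    assume "i \<noteq> j"
    have "\<exists>c. e i = c *\<^sub>R w" "\<exists>d. e j = d *\<^sub>R w" by (intro ker; simp add: eQ that)+
    then obtain c d where cd: "e i = c *\<^sub>R w" "e j = d *\<^sub>R w" by blast
    define p where "p = w \<bullet> (P *v w)"
    have "c * c * p = 1" "d * d * p = 1" "c * d * p = 0"
      using eP[of i i] eP[of j j] eP[of i j] \<open>i \<noteq> j\<close> cd
      by (simp_all add: matrix_vector_mult_scaleR p_def mult_ac)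
    then show False by auto
  qed
  have "r0 \<in># image_mset l (mset_set UNIV)" "r1 \<in># image_mset l (mset_set UNIV)"
    unfolding R(4)[symmetric] by auto
  then have le: "r0 \<le> 0" "r1 \<le> 0" using l0 by auto
  have "r1 \<noteq> 0"
  proof
    assume "r1 = 0"
    with R(2) le have "r0 = 0" by simp
    have "2 \<le> count (mset (r0 # r1 # rs)) 0" using \<open>r0 = 0\<close> \<open>r1 = 0\<close> by simp
    also have "\<dots> = card {i. l i = 0}"
      unfolding R(4) by (simp add: count_image_mset vimage_def)
    finally have "card {i. l i = 0} \<ge> 2" .
    moreover have "card {i. l i = 0} \<le> Suc 0"
      by (subst card_le_Suc0_iff_eq, simp) (blast intro: one)
    ultimately show False by simp
  qed
  then show ?thesis using le R(1) by (simp add: top_two_sum_neg_def)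
qed


section \<open>Differential equations with Lipschitz right-hand side\<close>

lemma gronwall_square:
  fixes z :: "real \<Rightarrow> 'a::real_inner"
  assumes z: "\<And>t. t \<in> {0..b} \<Longrightarrow> (z has_vector_derivative z' t) (at t within {0..b})"
    and le: "\<And>t. t \<in> {0..b} \<Longrightarrow> 2 * (z t \<bullet> z' t) \<le> c * (norm (z t))\<^sup>2 + k"
    and ck: "c \<ge> 0" "k \<ge> 0" and b: "0 \<le> b"
  shows "(norm (z b))\<^sup>2 \<le> exp (c * b) * ((norm (z 0))\<^sup>2 + k * b)"
proof -
  define h where "h t = (z t \<bullet> z t) * exp (- c * t) - k * t" for t
  have h': "(h has_real_derivative (2 * (z t \<bullet> z' t) - c * (z t \<bullet> z t)) * exp (- c * t) - k)
      (at t within {0..b})" if "t \<in> {0..b}" for t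
  proof -
    have "((\<lambda>t. z t \<bullet> z t) has_derivative (\<lambda>s. z t \<bullet> (s *\<^sub>R z' t) + (s *\<^sub>R z' t) \<bullet> z t)) (at t within {0..b})"
      using z[OF that] unfolding has_vector_derivative_def by (intro has_derivative_inner)
    moreover have "(\<lambda>s. z t \<bullet> (s *\<^sub>R z' t) + (s *\<^sub>R z' t) \<bullet> z t) = (*) (2 * (z t \<bullet> z' t))"
      by (auto simp: inner_commute)
    ultimately have "((\<lambda>t. z t \<bullet> z t) has_real_derivative 2 * (z t \<bullet> z' t)) (at t within {0..b})"
      by (simp add: has_field_derivative_def)
    then show ?thesis unfolding h_def
      by (auto intro!: derivative_eq_intros simp: algebra_simps)
  qed
  have "h 0 \<ge> h b"
  proof (rule DERIV_nonpos_imp_decreasing_open[OF b])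
    fix t assume t: "0 < t" "t < b"
    let ?y = "(2 * (z t \<bullet> z' t) - c * (z t \<bullet> z t)) * exp (- c * t) - k"
    have "(2 * (z t \<bullet> z' t) - c * (z t \<bullet> z t)) * exp (- c * t) \<le> k * exp (- c * t)"
      using le[of t] t by (intro mult_right_mono) (auto simp: power2_norm_eq_inner)
    also have "\<dots> \<le> k * 1" using ck t by (intro mult_left_mono) auto
    finally have "?y \<le> 0" by simp
    moreover have "(h has_real_derivative ?y) (at t)"
      using h'[of t] t at_within_Icc_at[of 0 t b] by simp
    ultimately show "\<exists>y. (h has_real_derivative y) (at t) \<and> y \<le> 0" by blast
  next
    show "continuous_on {0..b} h"
      using h' DERIV_continuous unfolding continuous_on_eq_continuous_within by blast
  qed
  then have "exp (c * b) * ((z b \<bullet> z b) * exp (- c * b)) \<le> exp (c * b) * (z 0 \<bullet> z 0 + k * b)"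
    by (intro mult_left_mono) (auto simp: h_def)
  then show ?thesis by (simp add: power2_norm_eq_inner exp_minus field_simps)
qed

text \<open>Picard iteration on the whole interval at once. It is carried out for \<open>u s = exp (- K s) x s\<close>: with
  the weight, the integral operator is a contraction by the factor 1/2 however long the interval is.\<close>

lemma lipschitz_ode_exists_interval:
  fixes F :: "real \<Rightarrow> 'a::euclidean_space \<Rightarrow> 'a"
  assumes cont: "\<And>u. continuous_on {0..b} u \<Longrightarrow> continuous_on {0..b} (\<lambda>t. F t (u t))"
    and lip: "\<And>t x y. t \<in> {0..b} \<Longrightarrow> norm (F t x - F t y) \<le> L * norm (x - y)"
    and L: "L \<ge> 0" and b: "b \<ge> 0"
  obtains x where "x 0 = x0" "\<And>t. t \<in> {0..b} \<Longrightarrow> (x has_vector_derivative F t (x t)) (at t within {0..b})"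
proof -
  define K where "K = 2 * L + 1"
  have K: "K > 0" using L by (simp add: K_def)
  define w where "w u s = F s (exp (K * s) *\<^sub>R apply_bcontfun u s)" for u :: "real \<Rightarrow>\<^sub>C 'a" and s
  define G where "G u t = exp (- K * t) *\<^sub>R (x0 + integral {0..t} (w u))"
    for u :: "real \<Rightarrow>\<^sub>C 'a" and t
  have cF: "continuous_on {0..b} (w u)" for u
    unfolding w_def by (intro cont continuous_intros) auto
  have cG: "continuous_on (cbox 0 b) (G u)" for u
  proof -
    have "continuous_on {0..b} (\<lambda>t. integral {0..t} (w u))"
      by (intro indefinite_integral_continuous_1 integrable_continuous_real cF)
    then show ?thesis unfolding G_def by (auto intro!: continuous_intros)
  qed
  have "\<exists>v. \<forall>x. apply_bcontfun v x = G u (clamp 0 b x)" for u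
    using continuous_on_cbox_bcontfunE[OF cG[of u]] by metis
  then obtain H where H: "\<And>u x. apply_bcontfun (H u) x = G u (clamp 0 b x)" by metis
  have "\<exists>!u. H u = u"
  proof (rule banach_fix_type)
    show "0 \<le> (1/2::real)" "1/2 < (1::real)" by auto
    show "\<forall>u v. dist (H u) (H v) \<le> 1/2 * dist u v"
    proof (intro allI dist_bound)
      fix u v :: "real \<Rightarrow>\<^sub>C 'a" and x
      define t where "t = clamp 0 b x"
      have t: "0 \<le> t" "t \<le> b" using clamp_in_interval[of 0 b x] b by (auto simp: t_def)
      have fi: "(w u) integrable_on {0..t}" for u
        using t by (intro integrable_continuous_real continuous_on_subset[OF cF]) auto
      have hi: "((\<lambda>s. L * dist u v * exp (K * s)) has_integral
          (L * dist u v * exp (K * t) / K - L * dist u v * exp (K * 0) / K)) {0..t}"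
        using K t by (intro fundamental_theorem_of_calculus)
          (auto intro!: derivative_eq_intros simp flip: has_real_derivative_iff_has_vector_derivative)
      have "norm (integral {0..t} (w u)
            - integral {0..t} (w v))
          = norm (integral {0..t} (\<lambda>s. w u s
              - w v s))"
        by (subst integral_diff[OF fi fi]) simp
      also have "\<dots> \<le> integral {0..t} (\<lambda>s. L * dist u v * exp (K * s))"
      proof (rule integral_norm_bound_integral)
        show "(\<lambda>s. w u s - w v s)
            integrable_on {0..t}" by (intro integrable_diff fi)
        show "(\<lambda>s. L * dist u v * exp (K * s)) integrable_on {0..t}" using hi by blast
        fix s assume s: "s \<in> {0..t}"
        have "norm (w u s - w v s)
          \<le> L * norm (exp (K * s) *\<^sub>R apply_bcontfun u s - exp (K * s) *\<^sub>R apply_bcontfun v s)"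
          unfolding w_def using s t by (intro lip) auto
        also have "norm (exp (K * s) *\<^sub>R apply_bcontfun u s - exp (K * s) *\<^sub>R apply_bcontfun v s)
            = exp (K * s) * dist (apply_bcontfun u s) (apply_bcontfun v s)"
          by (simp add: dist_norm flip: scaleR_diff_right)
        also have "L * \<dots> \<le> L * (exp (K * s) * dist u v)"
          using L by (intro mult_left_mono dist_bounded) auto
        finally show "norm (w u s - w v s)
            \<le> L * dist u v * exp (K * s)" by (simp add: mult_ac)
      qed
      also have "\<dots> = L * dist u v * (exp (K * t) - 1) / K"
        unfolding integral_unique[OF hi] by (simp add: diff_divide_distrib right_diff_distrib)
      also have "\<dots> \<le> L * dist u v * exp (K * t) / K"
        using K L by (intro divide_right_mono mult_left_mono) auto
      finally have I: "norm (integral {0..t} (w u)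
            - integral {0..t} (w v)) \<le> L * dist u v * exp (K * t) / K" .
      have "dist (apply_bcontfun (H u) x) (apply_bcontfun (H v) x)
          = exp (- K * t) * norm (integral {0..t} (w u)
            - integral {0..t} (w v))"
        unfolding H t_def[symmetric] G_def dist_norm by (simp flip: scaleR_diff_right)
      also have "\<dots> \<le> exp (- K * t) * (L * dist u v * exp (K * t) / K)"
        by (intro mult_left_mono I) simp
      also have "\<dots> = (L / K) * dist u v" by (simp add: exp_minus field_simps)
      also have "\<dots> \<le> 1/2 * dist u v"
        using K L by (intro mult_right_mono) (auto simp: K_def divide_simps)
      finally show "dist (apply_bcontfun (H u) x) (apply_bcontfun (H v) x) \<le> 1/2 * dist u v" .
    qed
  qed
  then obtain u where u: "H u = u" by blast
  define x where "x t = x0 + integral {0..t} (w u)" for t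
  have xu: "exp (K * t) *\<^sub>R apply_bcontfun u t = x t" if "t \<in> {0..b}" for t
  proof -
    have "clamp 0 b t = t" using that by (intro clamp_cancel_cbox) auto
    then have "apply_bcontfun u t = G u t" using H[of u t] u by simp
    then show ?thesis by (simp add: G_def x_def flip: exp_add)
  qed
  show ?thesis
  proof (rule that)
    show "x 0 = x0" by (simp add: x_def)
    fix t assume t: "t \<in> {0..b}"
    have "(x has_vector_derivative (0 + w u t)) (at t within {0..b})"
      unfolding x_def
      by (intro has_vector_derivative_add has_vector_derivative_const integral_has_vector_derivative cF t)
    then show "(x has_vector_derivative F t (x t)) (at t within {0..b})" by (simp add: w_def xu[OF t])
  qed
qed

lemma lipschitz_ode_unique:
  fixes F :: "real \<Rightarrow> 'a::real_inner \<Rightarrow> 'a"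
  assumes lip: "\<And>t. t \<in> {0..b} \<Longrightarrow> norm (F t (x t) - F t (y t)) \<le> L * norm (x t - y t)"
    and L: "L \<ge> 0" and b: "b \<ge> 0"
    and x: "\<And>t. t \<in> {0..b} \<Longrightarrow> (x has_vector_derivative F t (x t)) (at t within {0..b})"
    and y: "\<And>t. t \<in> {0..b} \<Longrightarrow> (y has_vector_derivative F t (y t)) (at t within {0..b})"
  shows "norm (x b - y b) \<le> exp (L * b) * norm (x 0 - y 0)"
proof -
  have "(norm (x b - y b))\<^sup>2 \<le> exp (2 * L * b) * ((norm (x 0 - y 0))\<^sup>2 + 0 * b)"
  proof (rule gronwall_square)
    fix t assume t: "t \<in> {0..b}"
    show "((\<lambda>t. x t - y t) has_vector_derivative (F t (x t) - F t (y t))) (at t within {0..b})"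
      using x[OF t] y[OF t] by (rule has_vector_derivative_diff)
    have "(x t - y t) \<bullet> (F t (x t) - F t (y t)) \<le> norm (x t - y t) * norm (F t (x t) - F t (y t))"
      by (rule norm_cauchy_schwarz)
    also have "\<dots> \<le> norm (x t - y t) * (L * norm (x t - y t))"
      by (intro mult_left_mono lip t) simp
    finally show "2 * ((x t - y t) \<bullet> (F t (x t) - F t (y t))) \<le> 2 * L * (norm (x t - y t))\<^sup>2 + 0"
      by (simp add: power2_eq_square algebra_simps)
  qed (use L b in auto)
  also have "\<dots> = (exp (L * b) * norm (x 0 - y 0))\<^sup>2"
    by (simp add: power_mult_distrib flip: exp_double)
  finally show ?thesis by (rule power2_le_imp_le) simp
qed

text \<open>By uniqueness, the solutions on the intervals \<open>{0..b}\<close> extend each other.\<close>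

lemma lipschitz_ode_exists:
  fixes F :: "real \<Rightarrow> 'a::euclidean_space \<Rightarrow> 'a"
  assumes cont: "\<And>b u. continuous_on {0..b} u \<Longrightarrow> continuous_on {0..b} (\<lambda>t. F t (u t))"
    and lip: "\<And>b. b \<ge> 0 \<Longrightarrow> \<exists>L\<ge>0. \<forall>t\<in>{0..b}. \<forall>x y. norm (F t x - F t y) \<le> L * norm (x - y)"
  obtains x where "x 0 = x0" "\<And>t. t \<ge> 0 \<Longrightarrow> (x has_vector_derivative F t (x t)) (at t within {0..})"
proof -
  have "\<exists>x. x 0 = x0 \<and> (\<forall>t\<in>{0..b}. (x has_vector_derivative F t (x t)) (at t within {0..b}))" if b: "b \<ge> 0" for b
  proof -
    obtain L where L: "L \<ge> 0" "\<And>t x y. t\<in>{0..b} \<Longrightarrow> norm (F t x - F t y) \<le> L * norm (x - y)"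
      using lip[OF b] by blast
    show ?thesis using lipschitz_ode_exists_interval[OF cont L(2) L(1) b] by metis
  qed
  then obtain X where X: "\<And>b. b \<ge> 0 \<Longrightarrow> X b 0 = x0"
    "\<And>b t. b \<ge> 0 \<Longrightarrow> t \<in> {0..b} \<Longrightarrow> (X b has_vector_derivative F t (X b t)) (at t within {0..b})"
    by metis
  have agree: "X b s = X s s" if s: "0 \<le> s" "s \<le> b" for b s
  proof -
    obtain L where L: "L \<ge> 0" "\<And>t x y. t\<in>{0..s} \<Longrightarrow> norm (F t x - F t y) \<le> L * norm (x - y)"
      using lip[OF s(1)] by blast
    have "norm (X b s - X s s) \<le> exp (L * s) * norm (X b 0 - X s 0)"
    proof (rule lipschitz_ode_unique[where F=F])
      fix t assume t: "t \<in> {0..s}"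
      show "(X b has_vector_derivative F t (X b t)) (at t within {0..s})"
        by (rule has_vector_derivative_within_subset[OF X(2)]) (use t s in auto)
    qed (use L X s in auto)
    then show ?thesis using X(1)[of b] X(1)[of s] s by simp
  qed
  show ?thesis
  proof (rule that)
    show "X 0 0 = x0" using X by simp
    fix t :: real assume t: "t \<ge> 0"
    have "(X (t + 1) has_vector_derivative F t (X (t + 1) t)) (at t within {0..t+1})"
      using t by (intro X) auto
    moreover have "at t within {0..} = at t within {0..t+1}"
      by (rule at_within_nhd[where S="{..<t+1}"]) (use t in auto)
    ultimately have "(X (t + 1) has_vector_derivative F t (X (t + 1) t)) (at t within {0..})" by simp
    then have "((\<lambda>s. X s s) has_vector_derivative F t (X (t + 1) t)) (at t within {0..})"
      by (rule has_vector_derivative_transform_within[where d=1])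
        (use t agree[of _ "t+1"] in \<open>auto simp: dist_real_def\<close>)
    then show "((\<lambda>s. X s s) has_vector_derivative F t (X t t)) (at t within {0..})"
      using agree[of t "t+1"] t by simp
  qed
qed

lemma has_vector_derivative_shift:
  fixes x :: "real \<Rightarrow> 'a::real_normed_vector"
  assumes "(x has_vector_derivative x') (at (c + t) within S)" "(+) c ` I \<subseteq> S"
  shows "((\<lambda>t. x (c + t)) has_vector_derivative x') (at t within I)"
proof -
  have "(x \<circ> (+) c has_vector_derivative 1 *\<^sub>R x') (at t within I)"
    by (intro vector_diff_chain_within has_vector_derivative_within_subset[OF assms])
      (auto intro!: derivative_eq_intros)
  then show ?thesis by (simp add: o_def)
qed

subsection \<open>The flow of a globally Lipschitz field\<close>

locale global_flow =
  fixes g :: "real^'n \<Rightarrow> real^'n" and L :: real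
  assumes lip: "\<And>x y. norm (g x - g y) \<le> L * norm (x - y)" and L_nonneg: "L \<ge> 0"
begin

lemma cont_g: "continuous_on S g"
proof -
  have "L-lipschitz_on UNIV g" using lip L_nonneg by (auto simp: lipschitz_on_def dist_norm)
  then show ?thesis using lipschitz_on_continuous_on continuous_on_subset by blast
qed

lemma solutions_dist:
  assumes "is_solution g {0..t} x" "is_solution g {0..t} y" "t \<ge> 0"
  shows "norm (x t - y t) \<le> exp (L * t) * norm (x 0 - y 0)"
  by (rule lipschitz_ode_unique[where F="\<lambda>_. g"])
    (use assms lip L_nonneg in \<open>auto simp: is_solution_def\<close>)

lemma is_solution_subset: "is_solution h J x \<Longrightarrow> I \<subseteq> J \<Longrightarrow> is_solution h I x"
  unfolding is_solution_def using has_vector_derivative_within_subset by blast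

lemma flow_unique:
  assumes "is_solution g {0..t} x" "x 0 = a" "t \<ge> 0"
  shows "flow g t a = x t"
  unfolding flow_def
proof (rule the_equality)
  show "\<exists>x'. is_solution g (closed_segment 0 t) x' \<and> x' 0 = a \<and> x' t = x t"
    using assms by (auto simp: closed_segment_eq_real_ivl)
  fix y assume "\<exists>x. is_solution g (closed_segment 0 t) x \<and> x 0 = a \<and> x t = y"
  then obtain x' where x': "is_solution g {0..t} x'" "x' 0 = a" "x' t = y"
    using assms(3) by (auto simp: closed_segment_eq_real_ivl)
  show "y = x t" using solutions_dist[OF x'(1) assms(1,3)] x' assms(2) by simp
qed

lemma flow_solution: "is_solution g {0..} (\<lambda>t. flow g t a)" and flow_0: "flow g 0 a = a"
proof -
  obtain x where x: "x 0 = a" "\<And>t. t \<ge> 0 \<Longrightarrow> (x has_vector_derivative g (x t)) (at t within {0..})"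
  proof (rule lipschitz_ode_exists[where F="\<lambda>_. g" and ?x0.0=a])
    fix b :: real and u :: "real \<Rightarrow> real^'n" assume "continuous_on {0..b} u"
    then show "continuous_on {0..b} (\<lambda>t. g (u t))" by (rule continuous_on_compose2[OF cont_g]) auto
  qed (use lip L_nonneg in blast)+
  have sx: "is_solution g {0..} x" using x by (auto simp: is_solution_def)
  have eq: "flow g t a = x t" if "t \<ge> 0" for t
    using that by (intro flow_unique x is_solution_subset[OF sx]) auto
  show "flow g 0 a = a" using eq[of 0] x by simp
  show "is_solution g {0..} (\<lambda>t. flow g t a)"
    using sx eq unfolding is_solution_def
    by (metis (no_types, lifting) atLeast_iff has_vector_derivative_transform)
qed

lemma flow_solution_interval: "is_solution g {0..b} (\<lambda>t. flow g t a)"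
  by (rule is_solution_subset[OF flow_solution]) auto

lemma flow_lipschitz:
  assumes "t \<ge> 0" shows "norm (flow g t a - flow g t b) \<le> exp (L * t) * norm (a - b)"
  using solutions_dist[OF flow_solution_interval flow_solution_interval assms, of a b] by (simp add: flow_0)

lemma cont_flow: "t \<ge> 0 \<Longrightarrow> continuous_on S (flow g t)"
proof -
  assume t: "t \<ge> 0"
  have "(exp (L * t))-lipschitz_on UNIV (flow g t)"
    using flow_lipschitz[OF t] by (auto simp: lipschitz_on_def dist_norm)
  then show ?thesis using lipschitz_on_continuous_on continuous_on_subset by blast
qed

lemma flow_add:
  assumes "s \<ge> 0" "t \<ge> 0" shows "flow g (s + t) a = flow g t (flow g s a)"
proof -
  have "is_solution g {0..t} (\<lambda>r. flow g (s + r) a)"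
    unfolding is_solution_def
    by (intro ballI has_vector_derivative_shift[where S="{0..}"])
      (use flow_solution[of a] assms in \<open>auto simp: is_solution_def\<close>)
  from flow_unique[OF this _ assms(2), of "flow g s a"] show ?thesis by simp
qed

text \<open>Backward uniqueness: the time-reversed solutions satisfy the same Gronwall estimate.\<close>

lemma flow_inj:
  assumes "t \<ge> 0" "flow g t a = flow g t b" shows "a = b"
proof -
  have rev: "((\<lambda>s. flow g (t - s) a) has_vector_derivative - g (flow g (t - s) a)) (at s within {0..t})"
    if s: "s \<in> {0..t}" for s a
  proof -
    have "((\<lambda>t. flow g t a) has_vector_derivative g (flow g (t - s) a)) (at (t - s) within {0..})"
      using flow_solution[of a] s by (auto simp: is_solution_def)
    then have "((\<lambda>t. flow g t a) has_vector_derivative g (flow g (t - s) a)) (at (t - s) within (\<lambda>s. t - s) ` {0..t})"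
      by (rule has_vector_derivative_within_subset) auto
    then have "((\<lambda>t. flow g t a) \<circ> (\<lambda>s. t - s) has_vector_derivative (-1) *\<^sub>R g (flow g (t - s) a)) (at s within {0..t})"
      by (intro vector_diff_chain_within) (auto intro!: derivative_eq_intros)
    then show ?thesis by (simp add: o_def)
  qed
  have "norm (flow g (t - t) a - flow g (t - t) b) \<le> exp (L * t) * norm (flow g (t - 0) a - flow g (t - 0) b)"
    by (rule lipschitz_ode_unique[where F="\<lambda>_ x. - g x"])
      (use rev lip L_nonneg assms(1) in \<open>auto simp: norm_minus_commute\<close>)
  then show ?thesis using assms by (simp add: flow_0)
qed

end

subsection \<open>Continuously differentiable fields\<close>

lemma C1_map_has_derivative:
  assumes "C1_map f" shows "(f has_derivative (*v) (jacobian f (at x))) (at x within S)"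
  using assms jacobian_works[of f "at x"] unfolding C1_map_def
  by (auto intro: has_derivative_at_withinI)

lemma norm_matrix_vector_le:
  fixes A :: "real^'n^'m"
  shows "norm (A *v x) \<le> real CARD('m) * real CARD('n) * norm A * norm x"
proof -
  have "\<bar>A $ i $ j\<bar> \<le> norm A" for i j
    using component_le_norm_cart[of "A $ i" j] Finite_Cartesian_Product.norm_nth_le[of A i] by linarith
  then have "onorm ((*v) A) \<le> real CARD('m) * real CARD('n) * norm A"
    by (rule onorm_le_matrix_component)
  then show ?thesis
    using onorm[OF matrix_vector_mul_bounded_linear[of A], of x] 
    by (meson mult_right_mono norm_ge_zero order_trans)
qed

lemma C1_map_lipschitz_cball:
  assumes "C1_map f"
  obtains L where "L \<ge> 0" "\<And>x y. x \<in> cball 0 R \<Longrightarrow> y \<in> cball 0 R \<Longrightarrow> norm (f x - f y) \<le> L * norm (x - y)"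
proof -
  have "continuous_on (cball 0 R) (\<lambda>x. jacobian f (at x))"
    using assms continuous_on_subset unfolding C1_map_def by blast
  then have "bounded ((\<lambda>x. jacobian f (at x)) ` cball 0 R)"
    by (intro compact_imp_bounded compact_continuous_image) auto
  then obtain B where B: "B > 0" "\<And>x. x \<in> cball 0 R \<Longrightarrow> norm (jacobian f (at x)) \<le> B"
    by (auto simp: bounded_pos)
  define L where "L = real CARD('a) * real CARD('a) * B"
  have "norm (f x - f y) \<le> L * norm (x - y)" if "x \<in> cball 0 R" "y \<in> cball 0 R" for x y
  proof (rule differentiable_bound[OF convex_cball C1_map_has_derivative[OF assms] _ that])
    fix z :: "real^'a" assume z: "z \<in> cball 0 R"
    show "onorm ((*v) (jacobian f (at z))) \<le> L"
    proof (rule onorm_le)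
      fix v
      show "norm (jacobian f (at z) *v v) \<le> L * norm v"
        using B(2)[OF z] B(1) unfolding L_def
        by (intro order_trans[OF norm_matrix_vector_le] mult_mono) auto
    qed
  qed
  then show ?thesis using that[of L] B by (simp add: L_def)
qed

text \<open>The mean value inequality, with the uniform continuity of the Jacobian on a ball.\<close>

lemma C1_map_uniform_linearization:
  fixes f :: "real^'n \<Rightarrow> real^'n"
  assumes f: "C1_map f" and \<eta>: "\<eta> > 0"
  obtains \<rho> where "\<rho> > 0" "\<And>y x x'. y \<in> cball 0 R \<Longrightarrow> x \<in> cball y \<rho> \<Longrightarrow> x' \<in> cball y \<rho> \<Longrightarrow>
     norm (f x' - f x - jacobian f (at y) *v (x' - x)) \<le> \<eta> * norm (x' - x)"
proof -
  define N where "N = real CARD('n) * real CARD('n)"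
  have N: "N > 0" by (simp add: N_def)
  have "continuous_on (cball 0 (R + 1)) (\<lambda>x. jacobian f (at x))"
    using f continuous_on_subset unfolding C1_map_def by blast
  then have "uniformly_continuous_on (cball 0 (R + 1)) (\<lambda>x. jacobian f (at x))"
    by (intro compact_uniformly_continuous) auto
  then obtain d where d: "d > 0" "\<And>x y. x \<in> cball 0 (R + 1) \<Longrightarrow> y \<in> cball 0 (R + 1) \<Longrightarrow> dist y x < d
      \<Longrightarrow> dist (jacobian f (at y)) (jacobian f (at x)) < \<eta> / N"
    unfolding uniformly_continuous_on_def using \<eta> N by (metis divide_pos_pos)
  define \<rho> where "\<rho> = min (d / 2) 1"
  have \<rho>: "\<rho> > 0" using d by (simp add: \<rho>_def)
  show ?thesis
  proof (rule that[OF \<rho>])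
    fix y x x' :: "real^'n" assume y: "y \<in> cball 0 R" and x: "x \<in> cball y \<rho>" "x' \<in> cball y \<rho>"
    have "norm (f x' - f x - jacobian f (at y) *v (x' - x)) \<le> norm (x' - x) * \<eta>"
    proof (rule differentiable_bound_linearization[where S="cball y \<rho>"
          and f'="\<lambda>z. (*v) (jacobian f (at z))" and ?x0.0=y])
      show "x + t *\<^sub>R (x' - x) \<in> cball y \<rho>" if "t \<in> {0..1}" for t
        using convexD_alt[OF convex_cball x, of t] that by (simp add: algebra_simps)
      show "\<And>z. z \<in> cball y \<rho> \<Longrightarrow> (f has_derivative (*v) (jacobian f (at z))) (at z within cball y \<rho>)"
        by (rule C1_map_has_derivative[OF f])
      show "y \<in> cball y \<rho>" using \<rho> by simp
      fix z assume z: "z \<in> cball y \<rho>"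
      have "norm z \<le> norm y + dist y z" by norm
      then have "dist (jacobian f (at z)) (jacobian f (at y)) < \<eta> / N"
        using y z d by (intro d(2)) (auto simp: \<rho>_def dist_commute)
      then have n: "norm (jacobian f (at z) - jacobian f (at y)) \<le> \<eta> / N" by (simp add: dist_norm)
      show "onorm ((*v) (jacobian f (at z)) - (*v) (jacobian f (at y))) \<le> \<eta>"
      proof (rule onorm_le)
        fix v
        have "norm ((jacobian f (at z) - jacobian f (at y)) *v v) \<le> N * (\<eta> / N) * norm v"
          unfolding N_def by (intro order_trans[OF norm_matrix_vector_le] mult_mono)
            (use n N \<eta> in \<open>auto simp: N_def\<close>)
        then show "norm (((*v) (jacobian f (at z)) - (*v) (jacobian f (at y))) v) \<le> \<eta> * norm v"
          using N by (simp add: matrix_vector_mult_diff_rdistrib)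
      qed
    qed
    then show "norm (f x' - f x - jacobian f (at y) *v (x' - x)) \<le> \<eta> * norm (x' - x)"
      by (simp add: mult.commute)
  qed
qed


section \<open>The flow near a periodic orbit\<close>

lemma has_vector_derivative_imp_continuous_on:
  "(\<And>t. t \<in> S \<Longrightarrow> (x has_vector_derivative x' t) (at t within S)) \<Longrightarrow> continuous_on S x"
  unfolding continuous_on_eq_continuous_within using has_vector_derivative_continuous by blast

lemma zero_derivative_constant:
  assumes "\<And>t. t \<ge> 0 \<Longrightarrow> (y has_vector_derivative 0) (at t within {0..})" "t \<ge> 0"
  shows "y t = y (0::real)"
proof -
  have "\<exists>c. \<forall>x\<in>{0..}. y x = c"
    by (rule has_derivative_zero_constant[OF convex_real_interval(1)])
      (use assms(1) in \<open>auto simp: has_vector_derivative_def\<close>)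
  then show ?thesis using assms(2) by auto
qed

lemma nonneg_reduce:
  fixes t T :: real assumes "T > 0" "t \<ge> 0"
  obtains k :: nat and s where "0 \<le> s" "s < T" "t = s + real k * T"
proof -
  define k where "k = nat \<lfloor>t / T\<rfloor>"
  have "real k = of_int \<lfloor>t / T\<rfloor>" using assms by (simp add: k_def)
  then have "real k \<le> t / T" "t / T < real k + 1" by linarith+
  then show ?thesis using that[of "t - real k * T" k] assms by (auto simp: field_simps)
qed

lemma periodic_multiple:
  fixes x :: "real \<Rightarrow> 'a"
  assumes "\<And>t. x (t + T) = x t"
  shows "x (t + real k * T) = x t"
proof (induction k)
  case (Suc k)
  have "t + real (Suc k) * T = (t + real k * T) + T" by (simp add: algebra_simps)
  then show ?case using assms Suc by metis
qed simp

lemma periodic_reduce: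
  fixes x :: "real \<Rightarrow> 'a"
  assumes T: "T > 0" and x: "\<And>t. x (t + T) = x t"
  shows "\<exists>s. 0 \<le> s \<and> s < T \<and> x t = x s"
proof -
  define k where "k = \<lfloor>t / T\<rfloor>"
  define s where "s = t - real_of_int k * T"
  have "real_of_int k \<le> t / T" "t / T < real_of_int k + 1" unfolding k_def by linarith+
  then have s: "0 \<le> s" "s < T" using T by (auto simp: s_def field_simps)
  have "x t = x s"
  proof (cases "k \<ge> 0")
    case True
    then have "t = s + real (nat k) * T" by (simp add: s_def)
    then show ?thesis using periodic_multiple[of x T s, OF x] by metis
  next
    case False
    then have "s = t + real (nat (-k)) * T" by (simp add: s_def)
    then show ?thesis using periodic_multiple[of x T t, OF x] by metis
  qed
  with s show ?thesis by blast
qed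

lemma C1_solution_unique:
  fixes f :: "real^'n \<Rightarrow> real^'n"
  assumes f: "C1_map f" and x: "is_solution f {0..t} x" and y: "is_solution f {0..t} y"
    and 0: "x 0 = y 0" and t: "t \<ge> 0"
  shows "x t = y t"
proof -
  have c: "continuous_on {0..t} z" if "is_solution f {0..t} z" for z
    using that unfolding is_solution_def by (intro has_vector_derivative_imp_continuous_on) auto
  have "bounded (x ` {0..t} \<union> y ` {0..t})"
    by (intro bounded_Un[THEN iffD2] conjI compact_imp_bounded compact_continuous_image c x y) auto
  then obtain R where R: "\<And>z. z \<in> x ` {0..t} \<union> y ` {0..t} \<Longrightarrow> norm z \<le> R"
    unfolding bounded_iff by blast
  obtain L where L: "L \<ge> 0" "\<And>x y. x \<in> cball 0 R \<Longrightarrow> y \<in> cball 0 R \<Longrightarrow> norm (f x - f y) \<le> L * norm (x - y)"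
    using C1_map_lipschitz_cball[OF f] by blast
  have "norm (x t - y t) \<le> exp (L * t) * norm (x 0 - y 0)"
    by (rule lipschitz_ode_unique[where F="\<lambda>_. f"])
      (use x y R L t in \<open>auto simp: is_solution_def\<close>)
  then show ?thesis using 0 by simp
qed

lemma bounded_bilinear_matrix_mult: "bounded_bilinear ((**) :: real^'n^'n \<Rightarrow> real^'n^'n \<Rightarrow> real^'n^'n)"
  by (rule bilinear_conv_bounded_bilinear[THEN iffD1])
    (simp add: bilinear_def linear_iff vec_eq_iff matrix_matrix_mult_def sum.distrib
      sum_distrib_left distrib_left distrib_right mult_ac)

lemma bounded_bilinear_minus_matrix_mult:
  "bounded_bilinear (\<lambda>(X :: real^'n^'n) (Y :: real^'n^'n). - (X ** Y))"
proof -
  interpret bounded_bilinear "(**) :: real^'n^'n \<Rightarrow> real^'n^'n \<Rightarrow> real^'n^'n"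
    by (rule bounded_bilinear_matrix_mult)
  show ?thesis
    by (rule bilinear_conv_bounded_bilinear[THEN iffD1])
      (simp add: bilinear_def linear_iff add_left add_right scaleR_left scaleR_right)
qed

lemma linear_ode_exists:
  fixes op :: "'a::euclidean_space \<Rightarrow> 'b::euclidean_space \<Rightarrow> 'b"
  assumes op: "bounded_bilinear op" and A: "continuous_on UNIV A"
  shows "\<exists>x. x 0 = x0 \<and> (\<forall>t\<ge>0. (x has_vector_derivative op (A t) (x t)) (at t within {0..}))"
proof -
  interpret bounded_bilinear op by (rule op)
  have cA: "continuous_on S A" for S using A continuous_on_subset by blast
  obtain K where K: "K > 0" "\<And>a x. norm (op a x) \<le> norm a * norm x * K" using pos_bounded by blast
  have lip: "\<exists>L\<ge>0. \<forall>t\<in>{0..b}. \<forall>x y. norm (op (A t) x - op (A t) y) \<le> L * norm (x - y)" for b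
  proof -
    have "bounded (A ` {0..b})" by (intro compact_imp_bounded compact_continuous_image cA) auto
    then obtain B where B: "B > 0" "\<forall>a\<in>A ` {0..b}. norm a \<le> B" unfolding bounded_pos by blast
    have "norm (op (A t) x - op (A t) y) \<le> B * K * norm (x - y)" if "t \<in> {0..b}" for t x y
    proof -
      have "norm (op (A t) (x - y)) \<le> norm (A t) * norm (x - y) * K" by (rule K)
      also have "\<dots> \<le> B * norm (x - y) * K" using B that K by (intro mult_right_mono) auto
      finally show ?thesis by (simp add: diff_right mult_ac)
    qed
    then show ?thesis using B K by (intro exI[of _ "B * K"]) auto
  qed
  have cont: "continuous_on {0..b} (\<lambda>t. op (A t) (u t))" if "continuous_on {0..b} u" for b u
    by (rule continuous_on[OF cA that])
  show ?thesis
  proof (rule lipschitz_ode_exists[where F="\<lambda>t. op (A t)" and ?x0.0=x0, OF cont lip])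
    fix x assume "x 0 = x0" "\<And>t. 0 \<le> t \<Longrightarrow> (x has_vector_derivative op (A t) (x t)) (at t within {0..})"
    then show ?thesis by (intro exI[of _ x]) simp
  qed
qed

lemma bounded_linear_matrix_apply: "bounded_linear (\<lambda>X :: real^'n^'n. X *v v)"
  by (rule linear_conv_bounded_linear[THEN iffD1])
    (auto simp: linear_iff matrix_vector_mult_add_rdistrib scaleR_matrix_vector_assoc)

lemma bounded_bilinear_matrix_vector: "bounded_bilinear ((*v) :: real^'n^'n \<Rightarrow> real^'n \<Rightarrow> real^'n)"
  by (rule bilinear_conv_bounded_bilinear[THEN iffD1])
    (auto simp: bilinear_def linear_iff matrix_vector_mult_add_rdistrib scaleR_matrix_vector_assoc
      matrix_vector_right_distrib matrix_vector_mult_scaleR)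

text \<open>The orbit lies well inside the ball of radius \<open>R\<close>, on which \<open>f\<close> is Lipschitz with constant \<open>L\<close>. Composing
  \<open>f\<close> with the nearest-point projection to that ball gives a globally Lipschitz field \<open>g\<close>, whose solutions exist
  for all \<open>t \<ge> 0\<close> and solve the original equation as long as they stay in the ball.\<close>

locale periodic_orbit =
  fixes f :: "real^'n \<Rightarrow> real^'n" and xs :: "real \<Rightarrow> real^'n" and T R L :: real
  assumes C1: "C1_map f"
    and sol: "is_solution f UNIV xs"
    and per: "has_minimal_period xs T"
    and R: "\<And>t. norm (xs t) + 1 \<le> R"
    and L: "L \<ge> 0" "\<And>x y. x \<in> cball 0 R \<Longrightarrow> y \<in> cball 0 R \<Longrightarrow> norm (f x - f y) \<le> L * norm (x - y)"
begin

definition g :: "real^'n \<Rightarrow> real^'n" where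
  "g x = f (closest_point (cball 0 R) x)"

lemma R_ge_1: "R \<ge> 1" using R[of 0] norm_ge_zero[of "xs 0"] by linarith

lemma g_eq: "x \<in> cball 0 R \<Longrightarrow> g x = f x"
  by (simp add: g_def closest_point_self)

sublocale global_flow g L
proof
  fix x y :: "real^'n"
  have ne: "cball (0::real^'n) R \<noteq> {}" using R_ge_1 by auto
  have "norm (g x - g y) \<le> L * norm (closest_point (cball 0 R) x - closest_point (cball 0 R) y)"
    unfolding g_def using ne by (intro L closest_point_in_set) auto
  also have "\<dots> \<le> L * norm (x - y)"
    using closest_point_lipschitz[OF convex_cball closed_cball ne, of x y] L(1)
    by (intro mult_left_mono) (auto simp: dist_norm)
  finally show "norm (g x - g y) \<le> L * norm (x - y)" .
qed (rule L)

lemma T_pos: "T > 0" and xs_T: "xs (t + T) = xs t"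
  and T_minimal: "0 < s \<Longrightarrow> s < T \<Longrightarrow> \<exists>t. xs (t + s) \<noteq> xs t"
  using per by (auto simp: has_minimal_period_def)

lemma xs_deriv: "(xs has_vector_derivative f (xs t)) (at t within S)"
  using sol by (auto simp: is_solution_def intro: has_vector_derivative_at_within)

lemma cont_xs: "continuous_on S xs"
  using xs_deriv by (intro has_vector_derivative_imp_continuous_on) auto

lemma xs_nT: "xs (t + real k * T) = xs t"
  by (rule periodic_multiple[where x=xs, OF xs_T])

lemma xs_in_ball: "xs t \<in> cball 0 R" using R[of t] by simp

lemma ex_phase: "\<exists>s. 0 \<le> s \<and> s < T \<and> xs t = xs s"
  by (rule periodic_reduce[where x=xs, OF T_pos xs_T])

definition e :: "real \<Rightarrow> real^'n" where "e t = f (xs t)"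
definition A :: "real \<Rightarrow> real^'n^'n" where "A t = jacobian f (at (xs t))"

lemma A_T: "A (t + T) = A t" and e_T: "e (t + T) = e t" by (simp_all add: A_def e_def xs_T)

lemma cont_A: "continuous_on S A"
proof -
  have "continuous_on UNIV (\<lambda>x. jacobian f (at x))" using C1 by (simp add: C1_map_def)
  then show ?thesis unfolding A_def by (rule continuous_on_compose2[OF _ cont_xs]) auto
qed

lemma A_bound: "\<exists>K\<ge>0. \<forall>t v. norm (A t *v v) \<le> K * norm v"
proof -
  have "continuous_on (cball 0 R) (\<lambda>x. jacobian f (at x))"
    using C1 continuous_on_subset unfolding C1_map_def by blast
  then have "bounded ((\<lambda>x. jacobian f (at x)) ` cball 0 R)"
    by (intro compact_imp_bounded compact_continuous_image) auto
  then obtain B where B: "B > 0" "\<And>x. x \<in> cball 0 R \<Longrightarrow> norm (jacobian f (at x)) \<le> B"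
    by (auto simp: bounded_pos)
  show ?thesis
  proof (intro exI[of _ "real CARD('n) * real CARD('n) * B"] conjI allI)
    fix t v
    show "norm (A t *v v) \<le> real CARD('n) * real CARD('n) * B * norm v"
      using B(2)[OF xs_in_ball[of t]] B(1) unfolding A_def
      by (intro order_trans[OF norm_matrix_vector_le] mult_mono) auto
  qed (use B in auto)
qed

subsection \<open>Fundamental matrix\<close>

lemma Phi_exists: "\<exists>\<Phi>. \<Phi> 0 = mat 1 \<and> (\<forall>t\<ge>0. (\<Phi> has_vector_derivative A t ** \<Phi> t) (at t within {0..}))"
  and Psi_exists: "\<exists>\<Psi>. \<Psi> 0 = mat 1 \<and> (\<forall>t\<ge>0. (\<Psi> has_vector_derivative - (\<Psi> t ** A t)) (at t within {0..}))"
proof -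
  have "bounded_bilinear (\<lambda>(Y :: real^'n^'n) (X :: real^'n^'n). - (X ** Y))"
    by (rule bounded_bilinear.flip[OF bounded_bilinear_minus_matrix_mult])
  from linear_ode_exists[OF this cont_A, of "mat 1"]
  show "\<exists>\<Psi>. \<Psi> 0 = mat 1 \<and> (\<forall>t\<ge>0. (\<Psi> has_vector_derivative - (\<Psi> t ** A t)) (at t within {0..}))" .
qed (rule linear_ode_exists[OF bounded_bilinear_matrix_mult cont_A])

definition Phi :: "real \<Rightarrow> real^'n^'n" where
  "Phi = (SOME \<Phi>. \<Phi> 0 = mat 1 \<and> (\<forall>t\<ge>0. (\<Phi> has_vector_derivative A t ** \<Phi> t) (at t within {0..})))"

definition Psi :: "real \<Rightarrow> real^'n^'n" where
  "Psi = (SOME \<Psi>. \<Psi> 0 = mat 1 \<and> (\<forall>t\<ge>0. (\<Psi> has_vector_derivative - (\<Psi> t ** A t)) (at t within {0..})))"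

lemma Phi_0: "Phi 0 = mat 1"
  and Phi_deriv: "t \<ge> 0 \<Longrightarrow> (Phi has_vector_derivative A t ** Phi t) (at t within {0..})"
  using someI_ex[OF Phi_exists] unfolding Phi_def by blast+

lemma Psi_0: "Psi 0 = mat 1"
  and Psi_deriv: "t \<ge> 0 \<Longrightarrow> (Psi has_vector_derivative - (Psi t ** A t)) (at t within {0..})"
  using someI_ex[OF Psi_exists] unfolding Psi_def by blast+

lemma Psi_Phi: assumes "t \<ge> 0" shows "Psi t ** Phi t = mat 1" and "Phi t ** Psi t = mat 1"
proof -
  interpret mm: bounded_bilinear "(**) :: real^'n^'n \<Rightarrow> real^'n^'n \<Rightarrow> real^'n^'n"
    by (rule bounded_bilinear_matrix_mult)
  have "((\<lambda>t. Psi t ** Phi t) has_vector_derivative 0) (at t within {0..})" if "t \<ge> 0" for t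
    using mm.has_vector_derivative[OF Psi_deriv[OF that] Phi_deriv[OF that]]
    by (simp add: mm.minus_left matrix_mul_assoc)
  from zero_derivative_constant[OF this assms]
  show "Psi t ** Phi t = mat 1" by (simp add: Phi_0 Psi_0)
  then show "Phi t ** Psi t = mat 1" by (simp add: matrix_left_right_inverse)
qed

lemma Psi_Phi_vec: "t \<ge> 0 \<Longrightarrow> Psi t *v (Phi t *v v) = v" "t \<ge> 0 \<Longrightarrow> Phi t *v (Psi t *v v) = v"
  by (simp_all add: matrix_vector_mul_assoc Psi_Phi)

lemma Phi_vec_deriv: "t \<ge> 0 \<Longrightarrow> ((\<lambda>t. Phi t *v v) has_vector_derivative A t *v (Phi t *v v)) (at t within {0..})"
  using bounded_linear.has_vector_derivative[OF bounded_linear_matrix_apply Phi_deriv, of t v]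
  by (simp add: matrix_vector_mul_assoc)

lemma linear_solution:
  assumes y: "\<And>t. t \<ge> 0 \<Longrightarrow> (y has_vector_derivative A t *v y t) (at t within {0..})" and t: "t \<ge> 0"
  shows "y t = Phi t *v y 0"
proof -
  interpret mv: bounded_bilinear "(*v) :: real^'n^'n \<Rightarrow> real^'n \<Rightarrow> real^'n"
    by (rule bounded_bilinear_matrix_vector)
  have "((\<lambda>t. Psi t *v y t) has_vector_derivative 0) (at t within {0..})" if "t \<ge> 0" for t
    using mv.has_vector_derivative[OF Psi_deriv[OF that] y[OF that]]
    by (simp add: mv.minus_left matrix_vector_mul_assoc)
  from zero_derivative_constant[OF this t] have "Psi t *v y t = y 0" by (simp add: Psi_0)
  then have "Phi t *v (Psi t *v y t) = Phi t *v y 0" by simp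
  then show ?thesis by (simp add: Psi_Phi_vec t)
qed

definition M :: "real^'n^'n" where "M = Phi T"

lemma Phi_T: assumes "t \<ge> 0" shows "Phi (t + T) = Phi t ** M"
proof -
  have "Phi (T + t) *v v = Phi t *v (M *v v)" for v
  proof -
    have "((\<lambda>t. Phi (T + t) *v v) has_vector_derivative A t *v (Phi (T + t) *v v)) (at t within {0..})"
      if "t \<ge> 0" for t
    proof (rule has_vector_derivative_shift[where S="{0..}"])
      show "((\<lambda>t. Phi t *v v) has_vector_derivative A t *v (Phi (T + t) *v v)) (at (T + t) within {0..})"
        using Phi_vec_deriv[of "T + t" v] A_T[of t] that T_pos by (simp add: add.commute)
    qed (use T_pos in auto)
    from linear_solution[OF this assms] show ?thesis by (simp add: M_def)
  qed
  then show ?thesis by (simp add: matrix_eq matrix_vector_mul_assoc add.commute)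
qed

lemma Phi_nT: assumes "t \<ge> 0" shows "Phi (t + real k * T) *v v = Phi t *v (((*v) M ^^ k) v)"
proof (induction k arbitrary: v)
  case (Suc k)
  have "Phi (t + real (Suc k) * T) = Phi ((t + real k * T) + T)" by (simp add: algebra_simps)
  also have "\<dots> = Phi (t + real k * T) ** M" using assms T_pos by (intro Phi_T) simp
  finally show ?case using Suc[of "M *v v"] by (simp add: funpow_swap1 flip: matrix_vector_mul_assoc)
qed simp

lemma Psi_T: assumes "t \<ge> 0" shows "M ** Psi (t + T) = Psi t"
proof -
  have "Psi t ** (Phi t ** M) ** Psi (t + T) = Psi t ** (Phi (t + T) ** Psi (t + T))"
    using assms by (simp add: Phi_T matrix_mul_assoc)
  then show ?thesis using assms T_pos Psi_Phi[of t] Psi_Phi[of "t + T"] by (simp add: matrix_mul_assoc)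
qed

lemma e_deriv: "(e has_vector_derivative A t *v e t) (at t within S)"
proof -
  have "(f \<circ> xs has_derivative (*v) (A t) \<circ> (\<lambda>h. h *\<^sub>R f (xs t))) (at t within S)"
    using xs_deriv[of t S] C1_map_has_derivative[OF C1] unfolding has_vector_derivative_def A_def
    by (intro diff_chain_within) auto
  then show ?thesis unfolding has_vector_derivative_def
    by (simp add: o_def e_def[abs_def] matrix_vector_mult_scaleR)
qed

lemma Phi_e: "t \<ge> 0 \<Longrightarrow> Phi t *v e 0 = e t"
  using linear_solution[of e t] e_deriv by auto

lemma M_e: "M *v e 0 = e 0"
  using Phi_e[of T] T_pos e_T[of 0] by (simp add: M_def)

lemma flow_xs: assumes "s \<ge> 0" shows "flow g s (xs r) = xs (r + s)"
proof -
  have "is_solution g {0..s} (\<lambda>s. xs (r + s))"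
    unfolding is_solution_def g_eq[OF xs_in_ball]
    by (intro ballI has_vector_derivative_shift[where S=UNIV] xs_deriv subset_UNIV)
  from flow_unique[OF this _ assms] show ?thesis by simp
qed

text \<open>At a zero of \<open>f\<close> the solution would be constant, contrary to the minimality of the period.\<close>

lemma e_nonzero: "e t \<noteq> 0"
proof
  assume e0: "e t = 0"
  have "is_solution g {0..s} (\<lambda>_. xs t)" for s
    using e0 by (auto simp: is_solution_def g_eq[OF xs_in_ball] e_def)
  then have const: "xs (t + s) = xs t" if "s \<ge> 0" for s
    using flow_unique[of s "\<lambda>_. xs t" "xs t"] flow_xs[of s t] that by simp
  have "xs r = xs t" for r
  proof -
    obtain k :: nat where "(t - r) / T < real k" using reals_Archimedean2 by blast
    then have "r + real k * T \<ge> t" using T_pos by (simp add: field_simps)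
    then have "xs (t + (r + real k * T - t)) = xs t" by (intro const) simp
    then show ?thesis using xs_nT[of r k] by simp
  qed
  moreover obtain r where "xs (r + T / 2) \<noteq> xs r" using T_minimal[of "T / 2"] T_pos by auto
  ultimately show False by metis
qed

text \<open>On a line, Rolle's theorem gives a time at which the velocity of a periodic solution vanishes.\<close>

lemma card_ge_2: "CARD('n) \<ge> 2"
proof (rule ccontr)
  assume "\<not> CARD('n) \<ge> 2"
  moreover have "CARD('n) > 0" by simp
  ultimately have "CARD('n) = 1" by linarith
  then obtain i :: 'n where i: "UNIV = {i}" by (metis card_1_singletonE)
  have d: "((\<lambda>t. xs t $ i) has_real_derivative f (xs t) $ i) (at t)" for t
    using bounded_linear.has_vector_derivative[OF bounded_linear_vec_nth xs_deriv, of i t UNIV]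
    by (simp add: has_real_derivative_iff_has_vector_derivative)
  have "\<exists>z. 0 < z \<and> z < T \<and> ((\<lambda>t. xs t $ i) has_real_derivative 0) (at z)"
  proof (rule Rolle[OF T_pos])
    show "xs 0 $ i = xs T $ i" using xs_T[of 0] by simp
    show "continuous_on {0..T} (\<lambda>t. xs t $ i)" by (intro continuous_intros cont_xs)
    show "\<And>x. 0 < x \<Longrightarrow> x < T \<Longrightarrow> (\<lambda>t. xs t $ i) differentiable (at x)"
      using d by (metis real_differentiable_def)
  qed
  then obtain z where "f (xs z) $ i = 0" using d DERIV_unique by blast
  then have "e z = 0" using i unfolding e_def vec_eq_iff by auto
  then show False using e_nonzero by blast
qed

subsection \<open>Comparison with the original field\<close>

lemma flow_f_eq:
  assumes "t \<ge> 0" and b: "\<And>s. 0 \<le> s \<Longrightarrow> s \<le> t \<Longrightarrow> flow g s a \<in> cball 0 R"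
  shows "flow_defined f t a" "flow f t a = flow g t a"
proof -
  have s: "is_solution f {0..t} (\<lambda>s. flow g s a)"
    using flow_solution_interval[of t a] b by (auto simp: is_solution_def g_eq)
  then show "flow_defined f t a" using assms(1)
    unfolding flow_defined_def by (auto simp: closed_segment_eq_real_ivl flow_0)
  show "flow f t a = flow g t a" unfolding flow_def[of f]
  proof (rule the_equality)
    show "\<exists>x. is_solution f (closed_segment 0 t) x \<and> x 0 = a \<and> x t = flow g t a"
      using s assms(1) by (auto simp: closed_segment_eq_real_ivl flow_0)
    fix y assume "\<exists>x. is_solution f (closed_segment 0 t) x \<and> x 0 = a \<and> x t = y"
    then obtain x where x: "is_solution f {0..t} x" "x 0 = a" "x t = y"
      using assms(1) by (auto simp: closed_segment_eq_real_ivl)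
    show "y = flow g t a"
      using C1_solution_unique[OF C1 x(1) s _ assms(1)] x by (simp add: flow_0)
  qed
qed

lemma flow_near_orbit:
  assumes "t \<ge> 0" shows "norm (flow g t a - xs (s + t)) \<le> exp (L * t) * norm (a - xs s)"
  using flow_lipschitz[OF assms, of a "xs s"] flow_xs[OF assms, of s] by simp

lemma in_ball_near: "norm (x - xs s) \<le> 1 \<Longrightarrow> x \<in> cball 0 R"
  using R[of s] norm_triangle_ineq2[of x "xs s"] by simp

lemma flow_f_near:
  assumes "t \<ge> 0" "exp (L * t) * norm (a - xs s) \<le> 1"
  shows "flow f t a = flow g t a"
proof -
  have "flow g r a \<in> cball 0 R" if r: "0 \<le> r" "r \<le> t" for r
  proof -
    have "exp (L * r) * norm (a - xs s) \<le> exp (L * t) * norm (a - xs s)"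
      using r L(1) by (intro mult_right_mono) (auto simp: mult_left_mono)
    then have "norm (flow g r a - xs (s + r)) \<le> 1" using flow_near_orbit[OF r(1), of a s] assms by linarith
    then show ?thesis by (rule in_ball_near)
  qed
  from flow_f_eq(2)[OF assms(1) this] show ?thesis .
qed

text \<open>The difference of two solutions close to the orbit satisfies the linearized equation up to a small
  multiple of its own norm; Gronwall's inequality bounds the accumulated error.\<close>

lemma linear_estimate:
  assumes t: "0 \<le> t" and \<eta>: "\<eta> > 0"
  obtains \<rho> where "\<rho> > 0" "\<And>s a a'. 0 \<le> s \<Longrightarrow> a \<in> cball (xs s) \<rho> \<Longrightarrow> a' \<in> cball (xs s) \<rho> \<Longrightarrow>
    norm (flow g t a' - flow g t a - Phi (s + t) *v (Psi s *v (a' - a))) \<le> \<eta> * norm (a' - a)"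
proof -
  obtain K where K: "K \<ge> 0" "\<And>t v. norm (A t *v v) \<le> K * norm v" using A_bound by blast
  define c where "c = 2 * K + 1"
  define E where "E = exp (L * t)"
  \<comment> \<open>\<open>\<eta>'\<close> is the error rate for which the Gronwall bound at time \<open>t\<close> becomes exactly \<open>\<eta>\<close>.\<close>
  define D where "D = exp (c * t) * (t + 1) * E\<^sup>2"
  have D: "D > 0" using t by (simp add: D_def E_def)
  have E: "E \<ge> 1" "E > 0" using t L by (simp_all add: E_def)
  define \<eta>' where "\<eta>' = \<eta> / sqrt D"
  have \<eta>': "\<eta>' > 0" "\<eta>'\<^sup>2 * D = \<eta>\<^sup>2" using D \<eta> by (simp_all add: \<eta>'_def power_divide)
  obtain \<rho>1 where \<rho>1: "\<rho>1 > 0" "\<And>y x x'. y \<in> cball 0 R \<Longrightarrow> x \<in> cball y \<rho>1 \<Longrightarrow> x' \<in> cball y \<rho>1 \<Longrightarrow>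
     norm (f x' - f x - jacobian f (at y) *v (x' - x)) \<le> \<eta>' * norm (x' - x)"
    using C1_map_uniform_linearization[OF C1 \<eta>'(1)] by blast
  define \<rho> where "\<rho> = min \<rho>1 1 / E"
  have \<rho>: "\<rho> > 0" "E * \<rho> = min \<rho>1 1" using \<rho>1 E by (auto simp: \<rho>_def)
  show ?thesis
  proof (rule that[OF \<rho>(1)])
    fix s :: real and a a' :: "real^'n"
    assume s: "0 \<le> s" and a: "a \<in> cball (xs s) \<rho>" "a' \<in> cball (xs s) \<rho>"
    define d where "d = norm (a' - a)"
    define z where "z r = flow g r a' - flow g r a - Phi (s + r) *v (Psi s *v (a' - a))" for r
    define z' where "z' r = g (flow g r a') - g (flow g r a) - A (s + r) *v (Phi (s + r) *v (Psi s *v (a' - a)))" for r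
    define k where "k = (\<eta>' * E * d)\<^sup>2"
    have Er: "exp (L * r) \<le> E" if "0 \<le> r" "r \<le> t" for r
      using that t L(1) by (simp add: E_def mult_left_mono)
    have near: "norm (flow g r x - xs (s + r)) \<le> min \<rho>1 1" if "0 \<le> r" "r \<le> t" "x \<in> cball (xs s) \<rho>" for r x
    proof -
      have "norm (flow g r x - xs (s + r)) \<le> exp (L * r) * norm (x - xs s)" by (rule flow_near_orbit) fact
      also have "\<dots> \<le> E * \<rho>"
        using Er[OF that(1,2)] that(3) E by (intro mult_mono) (auto simp: dist_norm norm_minus_commute)
      finally show ?thesis using \<rho> by simp
    qed
    have "(norm (z t))\<^sup>2 \<le> exp (c * t) * ((norm (z 0))\<^sup>2 + k * t)"
    proof (rule gronwall_square)
      fix r assume r: "r \<in> {0..t}"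
      have P: "((\<lambda>r. Phi (s + r) *v (Psi s *v (a' - a))) has_vector_derivative
          A (s + r) *v (Phi (s + r) *v (Psi s *v (a' - a)))) (at r within {0..t})"
        by (rule has_vector_derivative_shift[OF Phi_vec_deriv]) (use r s in auto)
      have F: "((\<lambda>r. flow g r x) has_vector_derivative g (flow g r x)) (at r within {0..t})" for x
        using flow_solution_interval[of t x] r by (auto simp: is_solution_def)
      show "(z has_vector_derivative z' r) (at r within {0..t})"
        unfolding z_def z'_def by (intro has_vector_derivative_diff F P)
      have n: "norm (flow g r x - xs (s + r)) \<le> min \<rho>1 1" if "x \<in> {a, a'}" for x
        using near[of r x] r a that by auto
      have gb: "g (flow g r x) = f (flow g r x)" if "x \<in> {a, a'}" for x
        using n[OF that] by (intro g_eq in_ball_near[of _ "s + r"]) simp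
      define h where "h = f (flow g r a') - f (flow g r a) - A (s + r) *v (flow g r a' - flow g r a)"
      have "norm h \<le> \<eta>' * norm (flow g r a' - flow g r a)"
        unfolding h_def A_def
        by (rule \<rho>1(2)[OF xs_in_ball]) (use n[of a] n[of a'] in \<open>auto simp: dist_norm norm_minus_commute\<close>)
      also have "\<dots> \<le> \<eta>' * (E * d)"
      proof (intro mult_left_mono)
        have "norm (flow g r a' - flow g r a) \<le> exp (L * r) * norm (a' - a)"
          using r by (intro flow_lipschitz) simp
        also have "\<dots> \<le> E * d" using Er[of r] r by (auto simp: d_def intro!: mult_right_mono)
        finally show "norm (flow g r a' - flow g r a) \<le> E * d" .
      qed (use \<eta>' in simp)
      finally have h: "(norm h)\<^sup>2 \<le> k" unfolding k_def by (intro power_mono) (auto simp: mult_ac)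
      have "z' r = A (s + r) *v z r + h"
        by (simp add: z'_def z_def h_def gb matrix_vector_mult_diff_distrib)
      then have "2 * (z r \<bullet> z' r) = 2 * (z r \<bullet> (A (s + r) *v z r)) + 2 * (z r \<bullet> h)"
        by (simp add: inner_add_right)
      also have "z r \<bullet> (A (s + r) *v z r) \<le> norm (z r) * (K * norm (z r))"
        by (rule order_trans[OF norm_cauchy_schwarz]) (intro mult_left_mono K norm_ge_zero)
      also have "2 * (z r \<bullet> h) \<le> 2 * (norm (z r) * norm h)"
        using norm_cauchy_schwarz by simp
      also have "\<dots> \<le> (norm (z r))\<^sup>2 + (norm h)\<^sup>2"
        using sum_squares_bound[of "norm (z r)" "norm h"] by simp
      finally show "2 * (z r \<bullet> z' r) \<le> c * (norm (z r))\<^sup>2 + k"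
        using h by (simp add: c_def power2_eq_square algebra_simps)
    qed (use K t in \<open>auto simp: c_def k_def\<close>)
    also have "z 0 = 0" using s by (simp add: z_def flow_0 Psi_Phi_vec)
    also have "exp (c * t) * ((norm (0 :: real^'n))\<^sup>2 + k * t) \<le> exp (c * t) * (k * (t + 1))"
      using t K by (auto simp: c_def k_def intro!: mult_mono mult_left_mono)
    also have "\<dots> = (\<eta>'\<^sup>2 * D) * d\<^sup>2" by (simp add: k_def D_def power_mult_distrib mult_ac)
    also have "\<dots> = (\<eta> * d)\<^sup>2" by (simp add: \<eta>' power_mult_distrib)
    finally have "norm (z t) \<le> \<eta> * d" by (rule power2_le_imp_le) (use \<eta> in \<open>simp add: d_def\<close>)
    then show "norm (flow g t a' - flow g t a - Phi (s + t) *v (Psi s *v (a' - a))) \<le> \<eta> * norm (a' - a)"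
      by (simp add: z_def d_def)
  qed
qed

lemma flow_f_has_derivative:
  assumes t: "t \<ge> 0" shows "(flow f t has_derivative (*v) (Phi t)) (at (xs 0))"
proof -
  have "(flow g t has_derivative (*v) (Phi t)) (at (xs 0))"
    unfolding has_derivative_at_alt
  proof (intro conjI allI impI)
    show "bounded_linear ((*v) (Phi t))" by (rule matrix_vector_mul_bounded_linear)
    fix \<eta> :: real assume "\<eta> > 0"
    from linear_estimate[OF t this] obtain \<rho> where \<rho>: "\<rho> > 0" "\<And>s a a'. 0 \<le> s \<Longrightarrow> a \<in> cball (xs s) \<rho> \<Longrightarrow> a' \<in> cball (xs s) \<rho> \<Longrightarrow>
      norm (flow g t a' - flow g t a - Phi (s + t) *v (Psi s *v (a' - a))) \<le> \<eta> * norm (a' - a)"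
      by blast
    have "norm (flow g t y - flow g t (xs 0) - Phi t *v (y - xs 0)) \<le> \<eta> * norm (y - xs 0)"
      if "norm (y - xs 0) < \<rho>" for y
      using \<rho>(2)[of 0 "xs 0" y] \<rho>(1) that by (simp add: Psi_0 dist_norm norm_minus_commute)
    then show "\<exists>d>0. \<forall>y. norm (y - xs 0) < d \<longrightarrow>
      norm (flow g t y - flow g t (xs 0) - Phi t *v (y - xs 0)) \<le> \<eta> * norm (y - xs 0)"
      using \<rho>(1) by blast
  qed
  then show ?thesis
  proof (rule has_derivative_transform_within_open)
    show "open (ball (xs 0) (exp (- (L * t))))" "xs 0 \<in> ball (xs 0) (exp (- (L * t)))" by auto
    fix y assume "y \<in> ball (xs 0) (exp (- (L * t)))"
    then have "exp (L * t) * norm (y - xs 0) \<le> exp (L * t) * exp (- (L * t))"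
      by (intro mult_left_mono) (auto simp: dist_norm norm_minus_commute)
    then show "flow g t y = flow f t y" using flow_f_near[OF t, of y 0] by (simp flip: exp_add)
  qed
qed

lemma monodromy_eq: "monodromy f T (xs 0) = M"
  unfolding monodromy_def jacobian_def M_def
  using frechet_derivative_at[OF flow_f_has_derivative[of T]] T_pos
  by (metis less_imp_le matrix_of_matrix_vector_mul)

definition pivot :: 'n where "pivot = (SOME k. e 0 $ k \<noteq> 0)"

lemma pivot: "e 0 $ pivot \<noteq> 0"
proof -
  have "\<exists>k. e 0 $ k \<noteq> 0" using e_nonzero[of 0] by (simp add: vec_eq_iff)
  then show ?thesis unfolding pivot_def by (rule someI_ex)
qed

lemma andronov_witt_iff:
  "andronov_witt f T (xs 0) \<longleftrightarrow>
    (\<forall>x z. z \<noteq> 0 \<longrightarrow> cmat (deflate M (e 0) pivot) *v z = x *s z \<longrightarrow> cmod x < 1)"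
  unfolding andronov_witt_def floquet_multipliers_def monodromy_eq conj_assoc
  by (rule second_multiplier_iff[OF card_ge_2 M_e pivot])

lemma andronov_witt_splitting:
  assumes "andronov_witt f T (xs 0)"
  obtains a C q where "\<And>v. a \<bullet> (M *v v) = a \<bullet> v" "a \<bullet> e 0 = 1" "0 \<le> C" "0 \<le> q" "q < 1"
    "\<And>j v. norm (((*v) M ^^ j) (v - (a \<bullet> v) *\<^sub>R e 0)) \<le> C * q ^ j * norm v"
proof -
  have "cmod x < 1" if "z \<noteq> 0" "cmat (deflate M (e 0) pivot) *v z = x *s z" for x z
    by (rule assms[unfolded andronov_witt_iff, rule_format, OF that])
  from stable_splitting[OF M_e pivot this that] show thesis .
qed

lemma not_andronov_witt_plane:
  assumes "\<not> andronov_witt f T (xs 0)"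
  obtains u w a b c d where
    "\<And>\<alpha> \<beta>. \<alpha> *\<^sub>R u + \<beta> *\<^sub>R w = 0 \<Longrightarrow> \<alpha> = 0 \<and> \<beta> = 0"
    "M *v u = a *\<^sub>R u + b *\<^sub>R w" "M *v w = c *\<^sub>R u + d *\<^sub>R w" "\<bar>a * d - b * c\<bar> \<ge> 1"
proof -
  obtain x z where z: "z \<noteq> 0" "cmat (deflate M (e 0) pivot) *v z = x *s z" "\<not> cmod x < 1"
    using assms[unfolded andronov_witt_iff not_all not_imp] by (elim exE conjE)
  then have "cmod x \<ge> 1" by simp
  from expanding_invariant_plane[OF M_e pivot z(2,1) this that] show thesis .
qed

end


section \<open>Lyapunov functions imply the Andronov--Witt condition\<close>

lemma bounded_linear_transpose: "bounded_linear (transpose :: real^'n^'n \<Rightarrow> real^'n^'n)"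
  by (rule linear_conv_bounded_linear[THEN iffD1]) (simp add: linear_iff transpose_def vec_eq_iff)

lemma gram_positive:
  fixes P :: "real^'n^'n" and u w :: "real^'n"
  assumes P: "pos_definite P"
    and ind: "\<And>\<alpha> \<beta>. \<alpha> *\<^sub>R u + \<beta> *\<^sub>R w = 0 \<Longrightarrow> \<alpha> = 0 \<and> \<beta> = 0"
  shows "(u \<bullet> (P *v u)) * (w \<bullet> (P *v w)) - (u \<bullet> (P *v w))\<^sup>2 > 0"
proof -
  have Pp: "v \<bullet> (P *v v) > 0" if "v \<noteq> 0" for v using P that by (simp add: pos_definite_def)
  have uw: "w \<bullet> (P *v u) = u \<bullet> (P *v w)" using P sym_matrix_dot[of P w u]
    by (simp add: pos_definite_def)
  define p q m where "p = u \<bullet> (P *v u)" and "q = w \<bullet> (P *v w)" and "m = u \<bullet> (P *v w)"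
  have "u \<noteq> 0" using ind[of 1 0] by auto
  then have p0: "p > 0" using Pp by (simp add: p_def)
  define y where "y = w - (m / p) *\<^sub>R u"
  have "y \<noteq> 0" using ind[of "- (m / p)" 1] by (auto simp: y_def)
  then have "0 < y \<bullet> (P *v y)" by (rule Pp)
  also have "y \<bullet> (P *v y) = q - m\<^sup>2 / p"
    using p0 by (simp add: y_def matrix_vector_mult_diff_distrib matrix_vector_mult_scaleR
      inner_diff_left inner_diff_right power2_eq_square uw flip: p_def q_def m_def)
  finally show ?thesis using p0 by (simp add: field_simps flip: p_def q_def m_def)
qed

text \<open>The left-hand side is the derivative of the Gram determinant of \<open>u\<close> and \<open>w\<close> along the linearized
  flow. Divided by that determinant, it is the sum of the values of \<open>Q\<close> on a \<open>P\<close>-orthonormal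
  basis of the plane, to which Ky Fan's inequality applies.\<close>

lemma gram_derivative_neg:
  fixes A P D :: "real^'n^'n" and u w :: "real^'n"
  defines "Q \<equiv> transpose A ** P + P ** A + D"
  assumes n: "CARD('n) \<ge> 2" and P: "pos_definite P" and D: "transpose D = D"
    and neg: "top_two_sum_neg A P D"
    and ind: "\<And>\<alpha> \<beta>. \<alpha> *\<^sub>R u + \<beta> *\<^sub>R w = 0 \<Longrightarrow> \<alpha> = 0 \<and> \<beta> = 0"
  shows "(u \<bullet> (Q *v u)) * (w \<bullet> (P *v w)) + (u \<bullet> (P *v u)) * (w \<bullet> (Q *v w))
     - 2 * (u \<bullet> (P *v w)) * (u \<bullet> (Q *v w)) < 0" (is ?A)
proof -
  have Ps: "transpose P = P" using P by (simp add: pos_definite_def)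
  have Qs: "transpose Q = Q" unfolding Q_def by (rule lyapunov_matrix_symmetric[OF Ps D])
  have Pp: "v \<bullet> (P *v v) > 0" if "v \<noteq> 0" for v using P that by (simp add: pos_definite_def)
  define p q m where "p = u \<bullet> (P *v u)" and "q = w \<bullet> (P *v w)" and "m = u \<bullet> (P *v w)"
  define p' q' m' where "p' = u \<bullet> (Q *v u)" and "q' = w \<bullet> (Q *v w)" and "m' = u \<bullet> (Q *v w)"
  have "u \<noteq> 0" using ind[of 1 0] by auto
  then have p: "p > 0" using Pp by (simp add: p_def)
  define y where "y = w - (m / p) *\<^sub>R u"
  have "y \<noteq> 0" using ind[of "- (m / p)" 1] by (auto simp: y_def)
  define r where "r = y \<bullet> (P *v y)"
  have r: "r > 0" using Pp \<open>y \<noteq> 0\<close> by (simp add: r_def)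
  have rq: "r = q - m\<^sup>2 / p" using p sym_matrix_dot[OF Ps, of w u]
    by (simp add: r_def y_def matrix_vector_mult_diff_distrib matrix_vector_mult_scaleR
        inner_diff_left inner_diff_right power2_eq_square flip: p_def q_def m_def)
  have yQ: "y \<bullet> (Q *v y) = q' - 2 * (m / p) * m' + (m / p)\<^sup>2 * p'"
    using sym_matrix_dot[OF Qs, of w u]
    by (simp add: y_def matrix_vector_mult_diff_distrib matrix_vector_mult_scaleR
        inner_diff_left inner_diff_right power2_eq_square algebra_simps flip: p'_def q'_def m'_def)
  have uy: "u \<bullet> (P *v y) = 0"
    using p by (simp add: y_def matrix_vector_mult_diff_distrib matrix_vector_mult_scaleR
        inner_diff_right flip: p_def m_def)
  define u1 v1 where "u1 = (1 / sqrt p) *\<^sub>R u" and "v1 = (1 / sqrt r) *\<^sub>R y"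
  have "u1 \<bullet> (Q *v u1) + v1 \<bullet> (Q *v v1) \<le> lyapunov_roots A P D ! 0 + lyapunov_roots A P D ! 1"
    unfolding Q_def
    by (rule orthonormal_pair_le_top_two[OF n P D])
      (use p r uy in \<open>simp_all add: u1_def v1_def matrix_vector_mult_scaleR flip: p_def r_def\<close>)
  also have "\<dots> < 0" using neg by (simp add: top_two_sum_neg_def)
  also have "u1 \<bullet> (Q *v u1) + v1 \<bullet> (Q *v v1) = p' / p + y \<bullet> (Q *v y) / r"
    using p r by (simp add: u1_def v1_def matrix_vector_mult_scaleR p'_def)
  finally have "(p' / p + y \<bullet> (Q *v y) / r) * (p * r) < 0" using p r by (intro mult_neg_pos) auto
  also have "(p' / p + y \<bullet> (Q *v y) / r) * (p * r) = r * p' + p * (y \<bullet> (Q *v y))"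
    using p r by (simp add: field_simps)
  also have "\<dots> = p' * q + p * q' - 2 * m * m'"
    unfolding rq yQ using p by (simp add: field_simps power2_eq_square)
  finally show ?A unfolding p_def q_def m_def p'_def q'_def m'_def .
qed

lemma inner_transpose_mult: "v \<bullet> ((transpose B ** X ** B) *v w) = (B *v v) \<bullet> (X *v (B *v w))"
  for B X :: "real^'n^'n"
proof -
  have "v \<bullet> ((transpose B ** X ** B) *v w) = v \<bullet> (transpose B *v (X *v (B *v w)))"
    by (simp only: matrix_vector_mul_assoc matrix_mul_assoc)
  also have "\<dots> = (B *v v) \<bullet> (X *v (B *v w))"
    by (metis dot_lmul_matrix transpose_matrix_vector transpose_transpose)
  finally show ?thesis .
qed

lemma inner_transpose_left: "v \<bullet> (transpose B *v w) = (B *v v) \<bullet> w"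
  for B :: "real^'n^'n"
  by (metis dot_lmul_matrix transpose_matrix_vector transpose_transpose)

lemma matrix_eq_inner: "(\<And>v w. v \<bullet> (X *v w) = v \<bullet> (Y *v w)) \<Longrightarrow> X = Y"
  for X Y :: "real^'n^'n"
  by (metis matrix_eq vector_eq_ldot)

lemma symmetric_inner: "(\<And>v w. v \<bullet> (X *v w) = w \<bullet> (X *v v)) \<Longrightarrow> transpose X = X"
  for X :: "real^'n^'n"
  by (rule matrix_eq_inner) (metis inner_transpose_left inner_commute)

context periodic_orbit
begin

lemma at_within_Ici: "t > 0 \<Longrightarrow> at t within {0..} = at (t::real)"
  by (rule at_within_interior) simp

lemma form_deriv:
  assumes P: "(P has_vector_derivative D) (at t)" and t: "t > 0"
  shows "((\<lambda>t. (Phi t *v u) \<bullet> (P t *v (Phi t *v w))) has_real_derivative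
     (Phi t *v u) \<bullet> ((transpose (A t) ** P t + P t ** A t + D) *v (Phi t *v w))) (at t)"
proof -
  have d: "((\<lambda>t. Phi t *v v) has_vector_derivative A t *v (Phi t *v v)) (at t)" for v
    using Phi_vec_deriv[of t v] t by (simp add: at_within_Ici)
  have "((\<lambda>t. (Phi t *v u) \<bullet> (P t *v (Phi t *v w))) has_vector_derivative
     (Phi t *v u) \<bullet> (P t *v (A t *v (Phi t *v w)) + D *v (Phi t *v w))
      + (A t *v (Phi t *v u)) \<bullet> (P t *v (Phi t *v w))) (at t)"
    by (intro bounded_bilinear.has_vector_derivative[OF bounded_bilinear_inner]
        bounded_bilinear.has_vector_derivative[OF bounded_bilinear_matrix_vector] d P)
  also have "(A t *v (Phi t *v u)) \<bullet> (P t *v (Phi t *v w))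
      = (Phi t *v u) \<bullet> ((transpose (A t) ** P t) *v (Phi t *v w))"
    by (simp add: inner_transpose_left del: transpose_matrix_vector flip: matrix_vector_mul_assoc)
  finally show ?thesis
    by (simp add: has_real_derivative_iff_has_vector_derivative matrix_vector_mult_add_rdistrib
        inner_add_right add_ac flip: matrix_vector_mul_assoc)
qed

lemma Phi_indep:
  assumes ind: "\<And>\<alpha> \<beta>. \<alpha> *\<^sub>R u + \<beta> *\<^sub>R w = 0 \<Longrightarrow> \<alpha> = 0 \<and> \<beta> = 0"
    and t: "t \<ge> 0" and 0: "\<alpha> *\<^sub>R (Phi t *v u) + \<beta> *\<^sub>R (Phi t *v w) = 0"
  shows "\<alpha> = 0 \<and> \<beta> = 0"
proof -
  have "Phi t *v (\<alpha> *\<^sub>R u + \<beta> *\<^sub>R w) = 0"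
    using 0 by (simp add: matrix_vector_right_distrib matrix_vector_mult_scaleR)
  then have "\<alpha> *\<^sub>R u + \<beta> *\<^sub>R w = 0" using Psi_Phi_vec(1)[OF t] by (metis matrix_vector_mult_0_right)
  then show ?thesis by (rule ind)
qed

lemma cont_Phi: "continuous_on {0..b} Phi"
proof (rule continuous_on_subset)
  show "continuous_on {0..} Phi" by (rule has_vector_derivative_imp_continuous_on[OF Phi_deriv]) simp
qed auto

text \<open>Here \<open>h\<close> is the Gram determinant of the two solutions. It decreases strictly on each piece of \<open>P\<close>,
  hence over a period, although \<open>h T = det\<^sup>2 h 0 \<ge> h 0\<close>. At interior points of a piece the
  one-sided derivative of \<open>P\<close> is the derivative.\<close>

theorem lyapunov_imp_andronov_witt:
  assumes PT: "\<And>t. P (t + T) = P t" and cont: "continuous_on UNIV P"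
    and pd: "\<And>t. pos_definite (P t)" and pc: "piecewise_C1_on 0 T P"
    and neg: "\<And>t. t \<ge> 0 \<Longrightarrow> top_two_sum_neg (A t) (P t) (vector_derivative P (at_right t))"
  shows "andronov_witt f T (xs 0)"
proof (rule ccontr)
  assume "\<not> andronov_witt f T (xs 0)"
  from not_andronov_witt_plane[OF this] obtain u w a b c d where
    ind: "\<And>\<alpha> \<beta>. \<alpha> *\<^sub>R u + \<beta> *\<^sub>R w = 0 \<Longrightarrow> \<alpha> = 0 \<and> \<beta> = 0" and
    M: "M *v u = a *\<^sub>R u + b *\<^sub>R w" "M *v w = c *\<^sub>R u + d *\<^sub>R w" and det: "\<bar>a * d - b * c\<bar> \<ge> 1"
    by metis
  define p q m where "p t = (Phi t *v u) \<bullet> (P t *v (Phi t *v u))"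
    and "q t = (Phi t *v w) \<bullet> (P t *v (Phi t *v w))"
    and "m t = (Phi t *v u) \<bullet> (P t *v (Phi t *v w))" for t
  define h where "h t = p t * q t - (m t)\<^sup>2" for t
  obtain k :: nat and \<tau> where tau: "\<tau> 0 = 0" "\<tau> k = T" and
    piece: "\<And>i. i < k \<Longrightarrow> \<tau> i < \<tau> (Suc i) \<and> (\<exists>P'. continuous_on {\<tau> i..\<tau> (Suc i)} P' \<and>
              (\<forall>t\<in>{\<tau> i..\<tau> (Suc i)}. (P has_vector_derivative P' t) (at t within {\<tau> i..\<tau> (Suc i)})))"
    using pc unfolding piecewise_C1_on_def by blast
  have mono: "i \<le> k \<Longrightarrow> 0 \<le> \<tau> i" for i
  proof (induction i)
    case (Suc i) then show ?case using piece[of i] by auto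
  qed (simp add: tau)
  have conth: "continuous_on {0..s} h" for s
  proof -
    have cv: "continuous_on {0..s} (\<lambda>t. Phi t *v v)" for v
      by (rule bounded_linear.continuous_on[OF bounded_linear_matrix_apply cont_Phi])
    have cP: "continuous_on {0..s} P" using cont continuous_on_subset by blast
    show ?thesis unfolding h_def p_def q_def m_def
      by (intro continuous_intros cv bounded_bilinear.continuous_on[OF bounded_bilinear_matrix_vector] cP)
  qed
  have dec: "h (\<tau> (Suc i)) < h (\<tau> i)" if i: "i < k" for i
  proof (rule DERIV_neg_imp_decreasing_open[where a="\<tau> i" and b="\<tau> (Suc i)" and f=h])
    show "\<tau> i < \<tau> (Suc i)" using piece[OF i] by blast
    have "0 \<le> \<tau> i" using mono i by simp
    then show "continuous_on {\<tau> i..\<tau> (Suc i)} h" by (intro continuous_on_subset[OF conth]) auto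
    obtain P' where P': "\<forall>t\<in>{\<tau> i..\<tau> (Suc i)}. (P has_vector_derivative P' t) (at t within {\<tau> i..\<tau> (Suc i)})"
      using piece[OF i] by blast
    fix t assume t: "\<tau> i < t" "t < \<tau> (Suc i)"
    then have t0: "t > 0" using \<open>0 \<le> \<tau> i\<close> by simp
    have D: "(P has_vector_derivative P' t) (at t)"
      using P'[rule_format, of t] t at_within_Icc_at[of "\<tau> i" t "\<tau> (Suc i)"] by simp
    have "vector_derivative P (at_right t) = P' t"
      by (rule vector_derivative_within[OF _ has_vector_derivative_at_within[OF D]]) simp
    then have neg': "top_two_sum_neg (A t) (P t) (P' t)" using neg[of t] t0 by simp
    have sym: "transpose (P' t) = P' t"
    proof -
      have "((\<lambda>t. transpose (P t)) has_vector_derivative transpose (P' t)) (at t)"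
        by (rule bounded_linear.has_vector_derivative[OF bounded_linear_transpose D])
      moreover have "(\<lambda>t. transpose (P t)) = P" using pd by (auto simp: pos_definite_def)
      ultimately have "(P has_vector_derivative transpose (P' t)) (at t)" by (simp only:)
      from vector_derivative_unique_at[OF this D] show ?thesis .
    qed
    note pq = form_deriv[OF D t0, of u u, folded p_def] form_deriv[OF D t0, of w w, folded q_def]
      form_deriv[OF D t0, of u w, folded m_def]
    let ?Q = "transpose (A t) ** P t + P t ** A t + P' t"
    have "(h has_real_derivative ((Phi t *v u) \<bullet> (?Q *v (Phi t *v u))) * q t + p t * ((Phi t *v w) \<bullet> (?Q *v (Phi t *v w)))
       - 2 * m t * ((Phi t *v u) \<bullet> (?Q *v (Phi t *v w)))) (at t)"
      unfolding h_def power2_eq_square by (rule derivative_eq_intros pq refl)+ (simp add: algebra_simps)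
    moreover have "((Phi t *v u) \<bullet> (?Q *v (Phi t *v u))) * q t + p t * ((Phi t *v w) \<bullet> (?Q *v (Phi t *v w)))
       - 2 * m t * ((Phi t *v u) \<bullet> (?Q *v (Phi t *v w))) < 0"
      unfolding p_def q_def m_def
      by (rule gram_derivative_neg[OF card_ge_2 pd sym neg'])
        (rule Phi_indep[OF ind less_imp_le[OF t0]])
    ultimately show "\<exists>y. (h has_real_derivative y) (at t) \<and> y < 0" by blast
  qed
  have "i \<le> k \<Longrightarrow> i > 0 \<Longrightarrow> h (\<tau> i) < h 0" for i
  proof (induction i)
    case (Suc i)
    then show ?case using dec[of i] tau(1) by (cases "i = 0") auto
  qed simp
  moreover have "k > 0" using tau T_pos by (cases k) auto
  ultimately have "h T < h 0" using tau(2) by auto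
  moreover have "h T = (a * d - b * c)\<^sup>2 * h 0"
  proof -
    have P0: "P T = P 0" using PT[of 0] by simp
    have wu: "w \<bullet> (P 0 *v u) = m 0" using pd[of 0] sym_matrix_dot[of "P 0" w u]
      by (simp add: m_def Phi_0 pos_definite_def)
    have "p T = a * a * p 0 + 2 * a * b * m 0 + b * b * q 0"
      "q T = c * c * p 0 + 2 * c * d * m 0 + d * d * q 0"
      "m T = a * c * p 0 + (a * d + b * c) * m 0 + b * d * q 0"
      unfolding p_def[of T] q_def[of T] m_def[of T] M_def[symmetric] M P0
      by (simp_all add: matrix_vector_right_distrib matrix_vector_mult_scaleR inner_add_left inner_add_right wu)
        (simp_all add: p_def q_def m_def Phi_0 algebra_simps)
    then show ?thesis unfolding h_def by algebra
  qed
  moreover have "h 0 > 0"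
  proof -
    show ?thesis using gram_positive[OF pd[of 0] ind] by (simp add: h_def p_def q_def m_def Phi_0)
  qed
  moreover have "(a * d - b * c)\<^sup>2 \<ge> 1" using det by (simp add: abs_le_square_iff[of 1, simplified])
  ultimately show False by (simp add: mult_le_cancel_right1)
qed

end


section \<open>Lyapunov functions from the Andronov--Witt condition\<close>

lemma norm_matrix_le_entries:
  fixes X :: "real^'n^'n"
  assumes "\<And>i j. \<bar>X $ i $ j\<bar> \<le> B"
  shows "norm X \<le> real CARD('n) * (real CARD('n) * B)"
proof -
  have "norm X \<le> (\<Sum>i\<in>UNIV. norm (X $ i))" unfolding norm_vec_def by (rule L2_set_le_sum) simp
  also have "\<dots> \<le> (\<Sum>i\<in>(UNIV::'n set). real CARD('n) * B)"
  proof (rule sum_mono)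
    fix i
    have "norm (X $ i) \<le> (\<Sum>j\<in>UNIV. \<bar>X $ i $ j\<bar>)" by (rule norm_le_l1_cart)
    also have "\<dots> \<le> (\<Sum>j\<in>(UNIV::'n set). B)" by (intro sum_mono assms)
    finally show "norm (X $ i) \<le> real CARD('n) * B" by simp
  qed
  finally show ?thesis by simp
qed

lemma matrix_entry_inner: "(X :: real^'n^'n) $ i $ j = axis i 1 \<bullet> (X *v axis j 1)"
  by (simp add: inner_axis' matrix_vector_mult_basis column_def)

lemma transpose_uminus: "transpose (- X) = - transpose (X :: real^'n^'n)"
  by (simp add: transpose_def vec_eq_iff)

lemma bounded_linear_form: "bounded_linear (\<lambda>X :: real^'n^'n. v \<bullet> (X *v w))"
  by (rule bounded_linear_compose[OF bounded_linear_inner_right bounded_linear_matrix_apply])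

text \<open>The solution is \<open>W = \<Sum>k. (M\<^sup>k)\<^sup>T K M\<^sup>k\<close>. The series converges although \<open>M\<close> fixes \<open>e\<close>, because the form \<open>K\<close>
  does not see the direction \<open>e\<close>.\<close>

lemma stein_equation:
  fixes M K :: "real^'n^'n"
  assumes inv: "\<And>v. a \<bullet> (M *v v) = a \<bullet> v" and e: "M *v e = e" "a \<bullet> e = 1"
    and decay: "0 \<le> C" "0 \<le> q" "q < 1"
    "\<And>j v. norm (((*v) M ^^ j) (v - (a \<bullet> v) *\<^sub>R e)) \<le> C * q ^ j * norm v"
    and Ks: "\<And>v w. v \<bullet> (K *v w) = w \<bullet> (K *v v)" and K0: "\<And>v. v \<bullet> (K *v v) \<ge> 0"
    and Ke: "\<And>v. K *v (v - (a \<bullet> v) *\<^sub>R e) = K *v v"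
  obtains W where "\<And>v w. v \<bullet> (W *v w) = w \<bullet> (W *v v)" "\<And>v. v \<bullet> (W *v v) \<ge> v \<bullet> (K *v v)"
    "\<And>v w. v \<bullet> (W *v w) = v \<bullet> (K *v w) + (M *v v) \<bullet> (W *v (M *v w))"
proof -
  define p where "p v = v - (a \<bullet> v) *\<^sub>R e" for v
  have pM: "p (M *v v) = M *v p v" for v
    by (simp add: p_def inv matrix_vector_mult_diff_distrib matrix_vector_mult_scaleR e)
  define Mk where "Mk k = matrix ((*v) M ^^ k \<circ> p)" for k
  have linp: "linear p" by (auto simp: p_def linear_iff inner_add_right algebra_simps)
  have linM: "linear ((*v) M ^^ k)" for k
    by (induction k) (auto simp: linear_iff matrix_vector_right_distrib matrix_vector_mult_scaleR)
  have Mk: "Mk k *v v = ((*v) M ^^ k) (p v)" for k v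
    unfolding Mk_def using linear_compose[OF linp linM] by (simp add: matrix_works)
  have MkM: "Mk k *v (M *v v) = Mk (Suc k) *v v" for k v
    by (simp add: Mk pM funpow_swap1)
  define X where "X k = transpose (Mk k) ** K ** Mk k" for k
  have Xi: "v \<bullet> (X k *v w) = (Mk k *v v) \<bullet> (K *v (Mk k *v w))" for v w k
    by (simp add: X_def inner_transpose_mult)
  obtain B where B: "B > 0" "\<And>x. norm (K *v x) \<le> norm x * B"
    using bounded_linear.pos_bounded[OF matrix_vector_mul_bounded_linear[of K]] by blast
  have Xb: "norm (X k) \<le> real CARD('n) * (real CARD('n) * (C * C * B)) * (q\<^sup>2) ^ k" for k
  proof -
    have "\<bar>X k $ i $ j\<bar> \<le> C * C * B * (q\<^sup>2) ^ k" for i j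
    proof -
      have n: "norm (Mk k *v axis l 1) \<le> C * q ^ k" for l
        unfolding Mk p_def using decay(4)[of k "axis l 1"] by simp
      have "\<bar>X k $ i $ j\<bar> \<le> norm (Mk k *v axis i 1) * norm (K *v (Mk k *v axis j 1))"
        unfolding matrix_entry_inner Xi by (rule Cauchy_Schwarz_ineq2)
      also have "\<dots> \<le> (C * q ^ k) * ((C * q ^ k) * B)"
        using n[of i] order_trans[OF B(2) mult_right_mono[OF n[of j]]] B(1) decay by (intro mult_mono) auto
      also have "\<dots> = C * C * B * (q\<^sup>2) ^ k"
        by (simp add: power_mult[symmetric] power_add[symmetric] mult_2 power2_eq_square power_mult_distrib)
      finally show ?thesis .
    qed
    from norm_matrix_le_entries[OF this] show ?thesis by (simp add: mult_ac)
  qed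
  have "q\<^sup>2 < 1" using decay by (simp add: power_less_one_iff)
  then have summ: "summable X"
    by (intro summable_comparison_test'[OF summable_mult[OF summable_geometric], of "q\<^sup>2" 0 X]) (use Xb in auto)
  define W where "W = (\<Sum>k. X k)"
  have Wi: "(\<lambda>k. v \<bullet> (X k *v w)) sums (v \<bullet> (W *v w))" for v w
    unfolding W_def by (rule bounded_linear.sums[OF bounded_linear_form summable_sums[OF summ]])
  have X0: "v \<bullet> (X 0 *v w) = v \<bullet> (K *v w)" for v w
  proof -
    have "v \<bullet> (X 0 *v w) = p v \<bullet> (K *v w)" unfolding Xi Mk by (simp add: p_def Ke)
    also have "\<dots> = w \<bullet> (K *v p v)" by (rule Ks)
    also have "\<dots> = v \<bullet> (K *v w)" unfolding p_def Ke by (rule Ks)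
    finally show ?thesis .
  qed
  show ?thesis
  proof (rule that)
    fix v w
    have "(\<lambda>k. v \<bullet> (X k *v w)) = (\<lambda>k. w \<bullet> (X k *v v))" unfolding Xi using Ks by auto
    then show "v \<bullet> (W *v w) = w \<bullet> (W *v v)" using sums_unique2 Wi by metis
  next
    fix v
    have "(\<Sum>k\<in>{0}. v \<bullet> (X k *v v)) \<le> (\<Sum>k. v \<bullet> (X k *v v))"
      using Wi[of v v] K0 by (intro sum_le_suminf) (auto simp: sums_iff Xi)
    then show "v \<bullet> (K *v v) \<le> v \<bullet> (W *v v)" using Wi[of v v] X0 by (simp add: sums_iff)
  next
    fix v w
    have "(\<lambda>k. v \<bullet> (X (Suc k) *v w)) = (\<lambda>k. (M *v v) \<bullet> (X k *v (M *v w)))"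
      unfolding Xi MkM ..
    then have "(\<lambda>k. v \<bullet> (X (Suc k) *v w)) sums ((M *v v) \<bullet> (W *v (M *v w)))"
      using Wi[of "M *v v" "M *v w"] by simp
    from sums_Suc[OF this] have "(\<lambda>k. v \<bullet> (X k *v w)) sums ((M *v v) \<bullet> (W *v (M *v w)) + v \<bullet> (K *v w))"
      by (simp add: X0)
    from sums_unique2[OF Wi this]
    show "v \<bullet> (W *v w) = v \<bullet> (K *v w) + (M *v v) \<bullet> (W *v (M *v w))" by simp
  qed
qed

context periodic_orbit
begin

lemma A_nT: "A (t + real k * T) = A t"
  by (simp add: A_def xs_nT)

lemma Phi_deriv_at: "t > 0 \<Longrightarrow> (Phi has_vector_derivative A t ** Phi t) (at t)"
  and Psi_deriv_at: "t > 0 \<Longrightarrow> (Psi has_vector_derivative - (Psi t ** A t)) (at t)"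
  using Phi_deriv[of t] Psi_deriv[of t] by (simp_all add: at_within_Ici)

text \<open>For a vector \<open>v\<close> at time \<open>t\<close> let \<open>u = Psi t *v v\<close> be its initial value under the linearized flow and \<open>p u\<close>
  the stable part of \<open>u\<close>. The form is \<open>P t v = (a \<bullet> u)\<^sup>2 + (\<integral>s\<in>{t..}. \<bar>Phi s *v p u\<bar>\<^sup>2)\<close>. The integral
  is written as \<open>W - J t\<close>, where \<open>J t\<close> is the integral from 0 to \<open>t\<close> and \<open>W\<close>, the total integral, is the
  series over all periods; this form is easy to differentiate, and the equation for \<open>W\<close> gives the periodicity of \<open>P\<close>.\<close>

theorem andronov_witt_imp_lyapunov_half_line:
  assumes "andronov_witt f T (xs 0)"
  obtains P P' where "\<And>t. t \<ge> 0 \<Longrightarrow> P (t + T) = P t"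
    "\<And>t. t > 0 \<Longrightarrow> (P has_vector_derivative P' t) (at t)" "continuous_on {0<..} P'"
    "\<And>t. t \<ge> 0 \<Longrightarrow> pos_definite (P t)"
    "\<And>t. t > 0 \<Longrightarrow> top_two_sum_neg (A t) (P t) (P' t)"
proof -
  obtain a C q where a: "\<And>v. a \<bullet> (M *v v) = a \<bullet> v" "a \<bullet> e 0 = 1"
    and decay: "0 \<le> C" "0 \<le> q" "q < 1"
    "\<And>j v. norm (((*v) M ^^ j) (v - (a \<bullet> v) *\<^sub>R e 0)) \<le> C * q ^ j * norm v"
    using andronov_witt_splitting[OF assms] by metis
  define p where "p v = v - (a \<bullet> v) *\<^sub>R e 0" for v
  have linp: "linear p" by (auto simp: p_def linear_iff inner_add_right algebra_simps)
  have pM: "p (M *v v) = M *v p v" for v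
    by (simp add: p_def a matrix_vector_mult_diff_distrib matrix_vector_mult_scaleR M_e)
  have pp: "p (p v) = p v" for v by (simp add: p_def inner_diff_right a)
  define Pr where "Pr = matrix p"
  have Pi: "Pr *v v = p v" for v unfolding Pr_def using linp by (simp add: matrix_works)
  define N where "N t = Phi t ** Pr" for t
  have Nv: "N t *v v = Phi t *v p v" for t v by (simp add: N_def Pi flip: matrix_vector_mul_assoc)
  define S where "S t = transpose (N t) ** N t" for t
  have Si: "v \<bullet> (S t *v w) = (N t *v v) \<bullet> (N t *v w)" for v w t
    using inner_transpose_mult[of v "N t" "mat 1" w] by (simp add: S_def)
  have contN: "continuous_on {0..b} N" for b
    unfolding N_def
    by (intro bounded_bilinear.continuous_on[OF bounded_bilinear_matrix_mult] cont_Phi continuous_on_const)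
  have contS: "continuous_on {0..b} S" for b
    unfolding S_def
    by (intro bounded_bilinear.continuous_on[OF bounded_bilinear_matrix_mult]
        bounded_linear.continuous_on[OF bounded_linear_transpose] contN)
  define J where "J t = integral {0..t} S" for t
  have J_deriv: "(J has_vector_derivative S t) (at t within {0..})" if "t \<ge> 0" for t
  proof -
    have "(J has_vector_derivative S t) (at t within {0..t+1})"
      unfolding J_def using that by (intro integral_has_vector_derivative contS) simp
    moreover have "at t within {0..} = at t within {0..t+1}"
      by (rule at_within_nhd[where S="{..<t+1}"]) (use that in auto)
    ultimately show ?thesis by simp
  qed
  have J0: "J 0 = 0" by (simp add: J_def)
  have Ji: "((\<lambda>t. v \<bullet> (J t *v w)) has_vector_derivative (N t *v v) \<bullet> (N t *v w)) (at t within {0..})"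
    if "t \<ge> 0" for v w t
    using bounded_linear.has_vector_derivative[OF bounded_linear_form J_deriv[OF that], of v w] by (simp add: Si)
  have Js: "v \<bullet> (J t *v w) = w \<bullet> (J t *v v)" if "t \<ge> 0" for v w t
  proof -
    have "((\<lambda>t. v \<bullet> (J t *v w) - w \<bullet> (J t *v v)) has_vector_derivative 0) (at t within {0..})" if "t \<ge> 0" for t
      using has_vector_derivative_diff[OF Ji[OF that, of v w] Ji[OF that, of w v]] by (simp add: inner_commute)
    from zero_derivative_constant[OF this that] show ?thesis by (simp add: J0)
  qed
  define K where "K = J T"
  have Np: "N t *v p v = N t *v v" for t v by (simp add: Nv pp)
  have JT: "v \<bullet> (J (T + t) *v w) = v \<bullet> (K *v w) + (M *v v) \<bullet> (J t *v (M *v w))" if t: "t \<ge> 0" for v w t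
  proof -
    have "((\<lambda>t. v \<bullet> (J (T + t) *v w) - (M *v v) \<bullet> (J t *v (M *v w))) has_vector_derivative 0) (at t within {0..})"
      if t: "t \<ge> 0" for t
    proof -
      have "N (T + t) *v x = N t *v (M *v x)" for x
        using Phi_T[OF t] by (simp add: Nv pM add.commute flip: matrix_vector_mul_assoc)
      then have "((\<lambda>t. v \<bullet> (J t *v w)) has_vector_derivative (N t *v (M *v v)) \<bullet> (N t *v (M *v w)))
          (at (T + t) within {0..})"
        using Ji[of "T + t" v w] t T_pos by simp
      then have "((\<lambda>t. v \<bullet> (J (T + t) *v w)) has_vector_derivative
          (N t *v (M *v v)) \<bullet> (N t *v (M *v w))) (at t within {0..})"
        by (rule has_vector_derivative_shift) (use T_pos in auto)
      from has_vector_derivative_diff[OF this Ji[OF t, of "M *v v" "M *v w"]] show ?thesis by simp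
    qed
    from zero_derivative_constant[OF this t] show ?thesis by (simp add: J0 K_def)
  qed
  have Jmono: "v \<bullet> (J s *v v) \<le> v \<bullet> (J t *v v)" if "0 \<le> s" "s \<le> t" for s t v
  proof (rule DERIV_nonneg_imp_increasing_open[OF that(2)])
    fix x assume x: "s < x" "x < t"
    then have "((\<lambda>t. v \<bullet> (J t *v v)) has_real_derivative (N x *v v) \<bullet> (N x *v v)) (at x)"
      using Ji[of x v v] that by (simp add: at_within_Ici has_real_derivative_iff_has_vector_derivative)
    then show "\<exists>y. ((\<lambda>t. v \<bullet> (J t *v v)) has_real_derivative y) (at x) \<and> 0 \<le> y" by (intro exI conjI) auto
  next
    show "continuous_on {s..t} (\<lambda>t. v \<bullet> (J t *v v))"
    proof (rule continuous_on_subset)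
      show "continuous_on {0..} (\<lambda>t. v \<bullet> (J t *v v))"
        by (rule has_vector_derivative_imp_continuous_on[OF Ji]) simp
    qed (use that in auto)
  qed
  have Kpos: "v \<bullet> (K *v v) > 0" if "p v \<noteq> 0" for v
  proof -
    have "v \<bullet> (J 0 *v v) < v \<bullet> (J T *v v)"
    proof (rule DERIV_pos_imp_increasing_open[OF T_pos])
      fix x assume x: "0 < x" "x < T"
      then have "((\<lambda>t. v \<bullet> (J t *v v)) has_real_derivative (N x *v v) \<bullet> (N x *v v)) (at x)"
        using Ji[of x v v] by (simp add: at_within_Ici has_real_derivative_iff_has_vector_derivative)
      moreover have "N x *v v \<noteq> 0"
      proof
        assume "N x *v v = 0"
        then have "Psi x *v (Phi x *v p v) = 0" by (simp add: Nv)
        then show False using that x by (simp add: Psi_Phi_vec)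
      qed
      ultimately show "\<exists>y. ((\<lambda>t. v \<bullet> (J t *v v)) has_real_derivative y) (at x) \<and> 0 < y"
        by (intro exI conjI) auto
    next
      show "continuous_on {0..T} (\<lambda>t. v \<bullet> (J t *v v))"
      proof (rule continuous_on_subset)
        show "continuous_on {0..} (\<lambda>t. v \<bullet> (J t *v v))"
          by (rule has_vector_derivative_imp_continuous_on[OF Ji]) simp
      qed auto
    qed
    then show ?thesis by (simp add: J0 K_def)
  qed
  have K0: "v \<bullet> (K *v v) \<ge> 0" for v using Jmono[of 0 T v] T_pos by (simp add: J0 K_def)
  have Ks: "v \<bullet> (K *v w) = w \<bullet> (K *v v)" for v w unfolding K_def using T_pos by (intro Js) simp
  have Ke: "K *v p v = K *v v" for v
  proof -
    have "w \<bullet> (K *v p v) = w \<bullet> (K *v v)" for w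
    proof -
      have "((\<lambda>t. w \<bullet> (J t *v p v) - w \<bullet> (J t *v v)) has_vector_derivative 0) (at t within {0..})" if "t \<ge> 0" for t
        using has_vector_derivative_diff[OF Ji[OF that, of w "p v"] Ji[OF that, of w v]] by (simp add: Np)
      from zero_derivative_constant[OF this, of T] show ?thesis using T_pos by (simp add: J0 K_def)
    qed
    then show ?thesis by (metis vector_eq_ldot)
  qed
  obtain W where W: "\<And>v w. v \<bullet> (W *v w) = w \<bullet> (W *v v)" "\<And>v. v \<bullet> (W *v v) \<ge> v \<bullet> (K *v v)"
    "\<And>v w. v \<bullet> (W *v w) = v \<bullet> (K *v w) + (M *v v) \<bullet> (W *v (M *v w))"
    using stein_equation[OF a(1) M_e a(2) decay Ks K0 Ke[unfolded p_def]] by metis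
  define a2 where "a2 = (\<chi> i j. a $ i * a $ j)"
  have a2: "v \<bullet> (a2 *v w) = (a \<bullet> v) * (a \<bullet> w)" for v w
  proof -
    have "a2 *v w = (a \<bullet> w) *\<^sub>R a"
      by (simp add: vec_eq_iff a2_def inner_vec_def matrix_vector_mult_def sum_distrib_left mult_ac)
    then show ?thesis by (simp add: inner_commute)
  qed
  define G where "G t = a2 + W - J t" for t
  have Gi: "v \<bullet> (G t *v w) = (a \<bullet> v) * (a \<bullet> w) + v \<bullet> (W *v w) - v \<bullet> (J t *v w)" for v w t
    by (simp add: G_def matrix_vector_mult_add_rdistrib matrix_vector_mult_diff_rdistrib
        inner_add_right inner_diff_right a2)
  have G_deriv: "(G has_vector_derivative - S t) (at t)" if "t > 0" for t
  proof -
    have "((\<lambda>t. (a2 + W) - J t) has_vector_derivative 0 - S t) (at t within {0..})"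
      by (intro has_vector_derivative_diff has_vector_derivative_const J_deriv) (use that in simp)
    then show ?thesis using that by (simp add: G_def[abs_def] at_within_Ici)
  qed
  have Gpos: "v \<bullet> (G t *v v) > 0" if t: "0 \<le> t" "t \<le> T" and v: "v \<noteq> 0" for v t
  proof -
    have 1: "v \<bullet> (J t *v v) \<le> v \<bullet> (K *v v)" unfolding K_def by (rule Jmono) fact+
    have 2: "v \<bullet> (W *v v) = v \<bullet> (K *v v) + (M *v v) \<bullet> (W *v (M *v v))" by (rule W(3))
    have 3: "(M *v v) \<bullet> (W *v (M *v v)) \<ge> (M *v v) \<bullet> (K *v (M *v v))" by (rule W(2))
    show ?thesis
    proof (cases "p v = 0")
      case True
      then have "v = (a \<bullet> v) *\<^sub>R e 0" by (simp add: p_def)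
      with v have "a \<bullet> v \<noteq> 0" by auto
      then have "(a \<bullet> v) * (a \<bullet> v) > 0" by (metis not_real_square_gt_zero)
      then show ?thesis unfolding Gi using 1 2 3 K0[of "M *v v"] by linarith
    next
      case False
      have "p (M *v v) \<noteq> 0"
      proof
        assume "p (M *v v) = 0"
        then have "M *v p v = 0" by (simp add: pM)
        then have "Psi T *v (Phi T *v p v) = 0" by (simp add: M_def)
        then show False using False T_pos by (simp add: Psi_Phi_vec)
      qed
      then have "(M *v v) \<bullet> (K *v (M *v v)) > 0" by (rule Kpos)
      moreover have "(a \<bullet> v) * (a \<bullet> v) \<ge> 0" by simp
      ultimately show ?thesis unfolding Gi using 1 2 3 by linarith
    qed
  qed
  define P where "P t = transpose (Psi t) ** G t ** Psi t" for t
  have Pi': "v \<bullet> (P t *v w) = (Psi t *v v) \<bullet> (G t *v (Psi t *v w))" for v w t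
    by (simp add: P_def inner_transpose_mult)
  define P' where "P' t = - (transpose (A t) ** P t + P t ** A t) - transpose (Psi t) ** S t ** Psi t" for t
  have PT: "P (t + T) = P t" if t: "t \<ge> 0" for t
  proof (rule matrix_eq_inner)
    fix v w
    define x y where "x = Psi (t + T) *v v" and "y = Psi (t + T) *v w"
    have xy: "M *v x = Psi t *v v" "M *v y = Psi t *v w"
      using Psi_T[OF t] by (simp_all add: x_def y_def matrix_vector_mul_assoc)
    have "v \<bullet> (P (t + T) *v w) = x \<bullet> (G (t + T) *v y)" by (simp add: Pi' x_def y_def)
    also have "\<dots> = (M *v x) \<bullet> (G t *v (M *v y))"
      unfolding Gi using JT[OF t, of x y] a W(3)[of x y] by (simp add: add.commute)
    also have "\<dots> = v \<bullet> (P t *v w)" by (simp add: xy Pi')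
    finally show "v \<bullet> (P (t + T) *v w) = v \<bullet> (P t *v w)" .
  qed
  have PkT: "P (t + real k * T) = P t" if t: "t \<ge> 0" for t k
  proof (induction k)
    case (Suc k)
    have "P (t + real (Suc k) * T) = P ((t + real k * T) + T)" by (simp add: algebra_simps)
    also have "\<dots> = P (t + real k * T)" using t T_pos by (intro PT) simp
    finally show ?case using Suc by simp
  qed simp
  have P_deriv: "(P has_vector_derivative P' t) (at t)" if t: "t > 0" for t
  proof -
    have "(P has_vector_derivative (transpose (Psi t) ** G t) ** (- (Psi t ** A t))
        + (transpose (Psi t) ** (- S t) + transpose (- (Psi t ** A t)) ** G t) ** Psi t) (at t)"
      unfolding P_def
      by (intro bounded_bilinear.has_vector_derivative[OF bounded_bilinear_matrix_mult]
        bounded_linear.has_vector_derivative[OF bounded_linear_transpose] Psi_deriv_at G_deriv t)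
    also have "(transpose (Psi t) ** G t) ** (- (Psi t ** A t))
        + (transpose (Psi t) ** (- S t) + transpose (- (Psi t ** A t)) ** G t) ** Psi t = P' t"
      unfolding P'_def P_def transpose_uminus
        bounded_bilinear.minus_right[OF bounded_bilinear_matrix_mult]
        bounded_bilinear.minus_left[OF bounded_bilinear_matrix_mult]
        bounded_bilinear.add_left[OF bounded_bilinear_matrix_mult] matrix_transpose_mul matrix_mul_assoc
      by simp
    finally show ?thesis .
  qed
  have pd: "pos_definite (P t)" if t: "t \<ge> 0" for t
    unfolding pos_definite_def
  proof (intro conjI allI impI)
    show "transpose (P t) = P t"
      by (rule symmetric_inner) (simp add: Pi' Gi W(1) Js[OF t] mult.commute)
    fix v :: "real^'n" assume v: "v \<noteq> 0"
    obtain k :: nat and s where s: "0 \<le> s" "s < T" "t = s + real k * T"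
      using nonneg_reduce[OF T_pos t] by metis
    have "Psi s *v v \<noteq> 0"
    proof
      assume "Psi s *v v = 0"
      then have "Phi s *v (Psi s *v v) = 0" by simp
      then show False using v s by (simp add: Psi_Phi_vec)
    qed
    then have "v \<bullet> (P s *v v) > 0" unfolding Pi' using s by (intro Gpos) auto
    then show "v \<bullet> (P t *v v) > 0" using PkT[OF s(1)] s(3) by simp
  qed
  have Qeq: "transpose (A t) ** P t + P t ** A t + P' t = - (transpose (Psi t) ** S t ** Psi t)" for t
    by (simp add: P'_def)
  have Qi: "v \<bullet> ((transpose (A t) ** P t + P t ** A t + P' t) *v w)
      = - ((N t *v (Psi t *v v)) \<bullet> (N t *v (Psi t *v w)))" for v w t
    unfolding Qeq by (simp add: bounded_bilinear.minus_left[OF bounded_bilinear_matrix_vector]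
        inner_transpose_mult Si)
  have neg: "top_two_sum_neg (A t) (P t) (P' t)" if t: "t > 0" for t
  proof (rule top_two_sum_neg_if_semidefinite[OF card_ge_2 pd])
    have "((\<lambda>t. transpose (P t)) has_vector_derivative transpose (P' t)) (at t)"
      by (rule bounded_linear.has_vector_derivative[OF bounded_linear_transpose P_deriv[OF t]])
    then have "(P has_vector_derivative transpose (P' t)) (at t)"
      by (rule has_vector_derivative_transform_within_open[where S="{0<..}"])
        (use t pd in \<open>auto simp: pos_definite_def\<close>)
    from vector_derivative_unique_at[OF this P_deriv[OF t]] show "transpose (P' t) = P' t" .
    show "v \<bullet> ((transpose (A t) ** P t + P t ** A t + P' t) *v v) \<le> 0" for v unfolding Qi by simp
    show "\<exists>c. v = c *\<^sub>R e t" if "v \<bullet> ((transpose (A t) ** P t + P t ** A t + P' t) *v v) = 0" for v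
    proof -
      have "N t *v (Psi t *v v) = 0" using that unfolding Qi by simp
      then have "Psi t *v (Phi t *v p (Psi t *v v)) = 0" by (simp add: Nv)
      then have "p (Psi t *v v) = 0" using t by (simp add: Psi_Phi_vec)
      then have "Psi t *v v = (a \<bullet> (Psi t *v v)) *\<^sub>R e 0" by (simp add: p_def)
      then have "Phi t *v (Psi t *v v) = (a \<bullet> (Psi t *v v)) *\<^sub>R (Phi t *v e 0)"
        by (metis matrix_vector_mult_scaleR)
      then show ?thesis using t by (auto simp: Psi_Phi_vec Phi_e)
    qed
  qed (use t in simp)
  have contP': "continuous_on {0<..} P'"
  proof -
    have cPsi: "continuous_on {0<..} Psi"
      by (rule has_vector_derivative_imp_continuous_on[OF has_vector_derivative_at_within[OF Psi_deriv_at]]) simp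
    have cP: "continuous_on {0<..} P"
      by (rule has_vector_derivative_imp_continuous_on[OF has_vector_derivative_at_within[OF P_deriv]]) simp
    have cPhi: "continuous_on {0<..} Phi"
      by (rule has_vector_derivative_imp_continuous_on[OF has_vector_derivative_at_within[OF Phi_deriv_at]]) simp
    show ?thesis unfolding P'_def S_def N_def
      by (intro continuous_intros bounded_bilinear.continuous_on[OF bounded_bilinear_matrix_mult]
        bounded_linear.continuous_on[OF bounded_linear_transpose] cPsi cP cPhi cont_A)
  qed
  show ?thesis by (rule that[OF PT P_deriv contP' pd neg])
qed

text \<open>The function found on the half line is shifted by multiples of the period to all times. The shift by one
  period makes it differentiable at every \<open>t \<ge> 0\<close>, so a single piece suffices.\<close>

theorem andronov_witt_imp_lyapunov:
  assumes "andronov_witt f T (xs 0)"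
  shows "\<exists>P :: real \<Rightarrow> real^'n^'n.
     (\<forall>t. P (t + T) = P t) \<and> continuous_on UNIV P \<and> (\<forall>t. pos_definite (P t)) \<and>
     piecewise_C1_on 0 T P \<and>
     (\<forall>t\<ge>0. top_two_sum_neg (A t) (P t) (vector_derivative P (at_right t)) \<and>
            top_two_sum_neg (A t) (P t) (vector_derivative P (at_left t)))"
proof -
  obtain P0 P' where P0: "\<And>t. t \<ge> 0 \<Longrightarrow> P0 (t + T) = P0 t"
    "\<And>t. t > 0 \<Longrightarrow> (P0 has_vector_derivative P' t) (at t)" "continuous_on {0<..} P'"
    "\<And>t. t \<ge> 0 \<Longrightarrow> pos_definite (P0 t)"
    "\<And>t. t > 0 \<Longrightarrow> top_two_sum_neg (A t) (P0 t) (P' t)"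
    using andronov_witt_imp_lyapunov_half_line[OF assms] by metis
  have P0k: "P0 (t + real k * T) = P0 t" if t: "t \<ge> 0" for t k
  proof (induction k)
    case (Suc k)
    have "P0 (t + real (Suc k) * T) = P0 ((t + real k * T) + T)" by (simp add: algebra_simps)
    also have "\<dots> = P0 (t + real k * T)" using t T_pos by (intro P0) simp
    finally show ?case using Suc by simp
  qed simp
  define k where "k t = nat \<lceil>\<bar>t\<bar> / T\<rceil>" for t :: real
  have k: "t + real (k t) * T \<ge> 0" for t
  proof -
    have "\<bar>t\<bar> / T \<le> real (k t)" unfolding k_def by linarith
    then have "\<bar>t\<bar> \<le> real (k t) * T" using T_pos by (simp add: field_simps)
    then show ?thesis by linarith
  qed
  define P where "P t = P0 (t + real (k t) * T)" for t
  have P: "P t = P0 (t + real m * T)" if m: "t + real m * T \<ge> 0" for t m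
  proof -
    have "P0 ((t + real m * T) + real (k t) * T) = P0 (t + real m * T)" by (rule P0k[OF m])
    moreover have "P0 ((t + real (k t) * T) + real m * T) = P0 (t + real (k t) * T)" by (rule P0k[OF k])
    moreover have "(t + real m * T) + real (k t) * T = (t + real (k t) * T) + real m * T" by simp
    ultimately show ?thesis unfolding P_def by metis
  qed
  have D: "(P has_vector_derivative P' (t + real m * T)) (at t)" if m: "t + real m * T > 0" for t m
  proof -
    have "(P0 \<circ> (\<lambda>t. t + real m * T) has_vector_derivative 1 *\<^sub>R P' (t + real m * T)) (at t)"
      by (intro vector_diff_chain_at P0(2) m) (auto intro!: derivative_eq_intros)
    then have "((\<lambda>t. P0 (t + real m * T)) has_vector_derivative P' (t + real m * T)) (at t)"
      by (simp add: o_def)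
    then show ?thesis
      by (rule has_vector_derivative_transform_within_open[where S="{- (real m * T)<..}"])
        (use m in \<open>auto intro!: P[symmetric]\<close>)
  qed
  have period: "P (t + T) = P t" for t
  proof -
    have "P t = P0 (t + real (Suc (k t)) * T)" using k[of t] T_pos by (intro P) (simp add: algebra_simps)
    moreover have "P (t + T) = P0 ((t + T) + real (k t) * T)" using k[of t] T_pos by (intro P) simp
    ultimately show ?thesis by (simp add: algebra_simps)
  qed
  have D1: "(P has_vector_derivative P' (t + T)) (at t)" if "t \<ge> 0" for t
    using D[of t 1] that T_pos by simp
  show ?thesis
  proof (intro exI[of _ P] conjI allI impI)
    show "P (t + T) = P t" for t by (rule period)
    show "continuous_on UNIV P"
      unfolding continuous_on_eq_continuous_within
    proof
      fix t :: real
      have "t + real (Suc (k t)) * T > 0" using k[of t] T_pos by (simp add: algebra_simps)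
      from has_vector_derivative_continuous[OF D[OF this]] show "continuous (at t) P" .
    qed
    show "pos_definite (P t)" for t unfolding P_def by (intro P0(4) k)
    show "piecewise_C1_on 0 T P" unfolding piecewise_C1_on_def
    proof (rule exI[of _ "1::nat"], rule exI[of _ "\<lambda>i. real i * T"], intro conjI allI impI)
      fix i :: nat assume "i < 1"
      then have i: "i = 0" by simp
      show "real i * T < real (Suc i) * T" using T_pos i by simp
      have "continuous_on {0..T} (\<lambda>t. P' (t + T))"
        by (rule continuous_on_compose2[OF P0(3)]) (use T_pos in \<open>auto intro!: continuous_intros\<close>)
      moreover have "(P has_vector_derivative P' (t + T)) (at t within {0..T})" if "t \<in> {0..T}" for t
        using that by (intro has_vector_derivative_at_within[OF D1]) simp
      ultimately show "\<exists>P'. continuous_on {real i * T..real (Suc i) * T} P' \<and>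
          (\<forall>t\<in>{real i * T..real (Suc i) * T}.
             (P has_vector_derivative P' t) (at t within {real i * T..real (Suc i) * T}))"
        using i by (intro exI[of _ "\<lambda>t. P' (t + T)"]) simp
    qed auto
    fix t :: real assume t: "t \<ge> 0"
    have "vector_derivative P (at_right t) = P' (t + T)" "vector_derivative P (at_left t) = P' (t + T)"
      by (rule vector_derivative_within[OF _ has_vector_derivative_at_within[OF D1[OF t]]]; simp)+
    moreover have "top_two_sum_neg (A t) (P t) (P' (t + T))"
      using P0(5)[of "t + T"] t T_pos P[of t 1] A_nT[of t 1] by simp
    ultimately show "top_two_sum_neg (A t) (P t) (vector_derivative P (at_right t))"
      "top_two_sum_neg (A t) (P t) (vector_derivative P (at_left t))" by simp_all
  qed
qed

end


section \<open>The Hausdorff 2-measure\<close>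

lemma mu2_eps_antimono: "\<epsilon> \<le> \<epsilon>' \<Longrightarrow> mu2_eps \<epsilon>' K \<le> mu2_eps \<epsilon> K"
  unfolding mu2_eps_def by (rule INF_superset_mono) fastforce+

lemma mu2_eq_SUP: "mu2 K = (SUP \<epsilon>\<in>{0<..}. mu2_eps \<epsilon> K)"
  unfolding mu2_def
proof (rule tendsto_Lim)
  show "((\<lambda>\<epsilon>. mu2_eps \<epsilon> K) \<longlongrightarrow> (SUP \<epsilon>\<in>{0<..}. mu2_eps \<epsilon> K)) (at_right 0)"
  proof (rule order_tendstoI)
    fix a assume "a < (SUP \<epsilon>\<in>{0<..}. mu2_eps \<epsilon> K)"
    then obtain d where d: "d > 0" "a < mu2_eps d K" unfolding less_SUP_iff by auto
    have "eventually (\<lambda>\<epsilon>. \<epsilon> \<in> {0<..<d}) (at_right 0)" by (rule eventually_at_right_real) fact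
    then show "eventually (\<lambda>\<epsilon>. a < mu2_eps \<epsilon> K) (at_right 0)"
      by eventually_elim (use d mu2_eps_antimono[of _ d K] in \<open>auto intro: less_le_trans\<close>)
  next
    fix a assume a: "(SUP \<epsilon>\<in>{0<..}. mu2_eps \<epsilon> K) < a"
    have "eventually (\<lambda>\<epsilon>. \<epsilon> \<in> {0<..<1}) (at_right (0::real))" by (rule eventually_at_right_real) simp
    then show "eventually (\<lambda>\<epsilon>. mu2_eps \<epsilon> K < a) (at_right 0)"
    proof eventually_elim
      case (elim \<epsilon>)
      then have "mu2_eps \<epsilon> K \<le> (SUP \<epsilon>\<in>{0<..}. mu2_eps \<epsilon> K)" by (intro SUP_upper) simp
      with a show ?case by (rule le_less_trans[rotated])
    qed
  qed
qed simp

lemma mu2_eps_le_mu2: "\<epsilon> > 0 \<Longrightarrow> mu2_eps \<epsilon> K \<le> mu2 K"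
  unfolding mu2_eq_SUP by (rule SUP_upper) simp

lemma mu2_leI: "(\<And>\<epsilon>. \<epsilon> > 0 \<Longrightarrow> mu2_eps \<epsilon> K \<le> B) \<Longrightarrow> mu2 K \<le> B"
  unfolding mu2_eq_SUP by (rule SUP_least) simp

lemma mu2_eps_le_cover:
  assumes "finite C" "\<And>c r. (c, r) \<in> C \<Longrightarrow> 0 < r \<and> r \<le> \<epsilon>" "K \<subseteq> (\<Union>(c, r)\<in>C. ball c r)"
  shows "mu2_eps \<epsilon> K \<le> ennreal (\<Sum>(c, r)\<in>C. r\<^sup>2)"
  unfolding mu2_eps_def by (rule INF_lower) (use assms in auto)

lemma le_mult_mu2_epsI:
  assumes q: "q > 0"
    and le: "\<And>C. finite C \<Longrightarrow> (\<And>c r. (c, r) \<in> C \<Longrightarrow> 0 < r \<and> r \<le> \<epsilon>) \<Longrightarrow> K \<subseteq> (\<Union>(c, r)\<in>C. ball c r) \<Longrightarrow>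
       x \<le> ennreal (q * (\<Sum>(c, r)\<in>C. r\<^sup>2))"
  shows "x \<le> ennreal q * mu2_eps \<epsilon> K"
proof -
  have q': "ennreal q > 0" "ennreal q \<noteq> top" using q by auto
  have "x / ennreal q \<le> mu2_eps \<epsilon> K" unfolding mu2_eps_def
  proof (rule INF_greatest)
    fix C :: "((real^'a) \<times> real) set"
    assume "C \<in> {C. finite C \<and> (\<forall>(c, r)\<in>C. 0 < r \<and> r \<le> \<epsilon>) \<and> K \<subseteq> (\<Union>(c, r)\<in>C. ball c r)}"
    then have "x \<le> ennreal (q * (\<Sum>(c, r)\<in>C. r\<^sup>2))" by (intro le) auto
    also have "\<dots> = ennreal q * ennreal (\<Sum>(c, r)\<in>C. r\<^sup>2)"
      using q by (intro ennreal_mult sum_nonneg) auto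
    finally show "x / ennreal q \<le> ennreal (\<Sum>(c, r)\<in>C. r\<^sup>2)"
      using q' by (intro divide_le_posI_ennreal) (auto simp: mult.commute)
  qed
  then have "ennreal q * (x / ennreal q) \<le> ennreal q * mu2_eps \<epsilon> K" by (rule mult_left_mono) simp
  moreover have "ennreal q * (x / ennreal q) = x"
    using q' by (simp add: ennreal_times_divide mult.commute ennreal_mult_divide_eq)
  ultimately show ?thesis by simp
qed

lemma sum_UNION_le:
  fixes g :: "'a \<Rightarrow> real"
  assumes "finite I" "\<And>i. i \<in> I \<Longrightarrow> finite (F i)" "\<And>x. g x \<ge> 0"
  shows "sum g (\<Union>i\<in>I. F i) \<le> (\<Sum>i\<in>I. sum g (F i))"
  using assms(1,2)
proof (induction I rule: finite_induct)
  case (insert i I)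
  have "sum g (F i \<union> (\<Union>i\<in>I. F i)) + sum g (F i \<inter> (\<Union>i\<in>I. F i)) = sum g (F i) + sum g (\<Union>i\<in>I. F i)"
    using insert by (intro sum.union_inter) auto
  moreover have "sum g (F i \<inter> (\<Union>i\<in>I. F i)) \<ge> 0" using assms(3) by (intro sum_nonneg)
  ultimately have "sum g (\<Union>i\<in>insert i I. F i) \<le> sum g (F i) + sum g (\<Union>i\<in>I. F i)" by simp
  also have "\<dots> \<le> sum g (F i) + (\<Sum>i\<in>I. sum g (F i))" using insert by simp
  finally show ?case using insert by simp
qed simp

text \<open>Replacing each ball of a fine cover of \<open>K\<close> by a cover of the image of its intersection with \<open>K\<close> gives a
  fine cover of \<open>h ` K\<close>.\<close>

lemma mu2_image_le:
  fixes h :: "real^'n \<Rightarrow> real^'n"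
  assumes q: "q > 0" and r0: "r0 > 0" and D: "D > 0"
    and cover: "\<And>c r. 0 < r \<Longrightarrow> r \<le> r0 \<Longrightarrow> \<exists>C. finite C \<and> (\<forall>(c', r')\<in>C. 0 < r' \<and> r' \<le> D * r) \<and>
       h ` (K \<inter> ball c r) \<subseteq> (\<Union>(c', r')\<in>C. ball c' r') \<and> (\<Sum>(c', r')\<in>C. r'\<^sup>2) \<le> q * r\<^sup>2"
  shows "mu2 (h ` K) \<le> ennreal q * mu2 K"
proof (rule mu2_leI)
  fix \<epsilon> :: real assume \<epsilon>: "\<epsilon> > 0"
  define \<epsilon>' where "\<epsilon>' = min r0 (\<epsilon> / D)"
  have \<epsilon>': "\<epsilon>' > 0" "\<epsilon>' \<le> r0" "D * \<epsilon>' \<le> \<epsilon>"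
    using \<epsilon> D r0 by (auto simp: \<epsilon>'_def min_def field_simps)
  have "mu2_eps \<epsilon> (h ` K) \<le> ennreal q * mu2_eps \<epsilon>' K"
  proof (rule le_mult_mu2_epsI[OF q])
    fix C assume C: "finite C" "\<And>c r. (c, r) \<in> C \<Longrightarrow> 0 < r \<and> r \<le> \<epsilon>'" "K \<subseteq> (\<Union>(c, r)\<in>C. ball c r)"
    have "\<forall>x\<in>C. \<exists>C'. finite C' \<and> (\<forall>(c', r')\<in>C'. 0 < r' \<and> r' \<le> D * snd x) \<and>
       h ` (K \<inter> ball (fst x) (snd x)) \<subseteq> (\<Union>(c', r')\<in>C'. ball c' r') \<and> (\<Sum>(c', r')\<in>C'. r'\<^sup>2) \<le> q * (snd x)\<^sup>2"
    proof
      fix x assume "x \<in> C"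
      then have "0 < snd x" "snd x \<le> r0" using C(2)[of "fst x" "snd x"] \<epsilon>' by auto
      then show "\<exists>C'. finite C' \<and> (\<forall>(c', r')\<in>C'. 0 < r' \<and> r' \<le> D * snd x) \<and>
       h ` (K \<inter> ball (fst x) (snd x)) \<subseteq> (\<Union>(c', r')\<in>C'. ball c' r') \<and> (\<Sum>(c', r')\<in>C'. r'\<^sup>2) \<le> q * (snd x)\<^sup>2"
        by (rule cover)
    qed
    from bchoice[OF this] obtain F where F: "\<And>x. x \<in> C \<Longrightarrow> finite (F x)"
      "\<And>x c' r'. x \<in> C \<Longrightarrow> (c', r') \<in> F x \<Longrightarrow> 0 < r' \<and> r' \<le> D * snd x"
      "\<And>x. x \<in> C \<Longrightarrow> h ` (K \<inter> ball (fst x) (snd x)) \<subseteq> (\<Union>(c', r')\<in>F x. ball c' r')"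
      "\<And>x. x \<in> C \<Longrightarrow> (\<Sum>(c', r')\<in>F x. r'\<^sup>2) \<le> q * (snd x)\<^sup>2"
      by fastforce
    have "mu2_eps \<epsilon> (h ` K) \<le> ennreal (\<Sum>(c, r)\<in>(\<Union>x\<in>C. F x). r\<^sup>2)"
    proof (rule mu2_eps_le_cover)
      show "finite (\<Union>x\<in>C. F x)" using C F by auto
      fix c' r' assume "(c', r') \<in> (\<Union>x\<in>C. F x)"
      then obtain x where x: "x \<in> C" "(c', r') \<in> F x" by blast
      have "D * snd x \<le> D * \<epsilon>'" using C(2)[of "fst x" "snd x"] x D by simp
      then show "0 < r' \<and> r' \<le> \<epsilon>" using F(2)[OF x] \<epsilon>' by linarith
    next
      show "h ` K \<subseteq> (\<Union>(c, r)\<in>(\<Union>x\<in>C. F x). ball c r)"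
      proof
        fix y assume "y \<in> h ` K"
        then obtain k where k: "k \<in> K" "y = h k" by blast
        then obtain x where x: "x \<in> C" "k \<in> ball (fst x) (snd x)" using C(3) by fastforce
        then have "y \<in> (\<Union>(c', r')\<in>F x. ball c' r')" using F(3)[of x] k by blast
        then show "y \<in> (\<Union>(c, r)\<in>(\<Union>x\<in>C. F x). ball c r)" using x by blast
      qed
    qed
    also have "\<dots> \<le> ennreal (\<Sum>x\<in>C. \<Sum>(c, r)\<in>F x. r\<^sup>2)"
      by (intro ennreal_leI sum_UNION_le C F) auto
    also have "\<dots> \<le> ennreal (\<Sum>x\<in>C. q * (snd x)\<^sup>2)"
      by (intro ennreal_leI sum_mono F)
    also have "(\<Sum>x\<in>C. q * (snd x)\<^sup>2) = q * (\<Sum>(c, r)\<in>C. r\<^sup>2)"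
      by (simp add: sum_distrib_left case_prod_unfold)
    finally show "mu2_eps \<epsilon> (h ` K) \<le> ennreal (q * (\<Sum>(c, r)\<in>C. r\<^sup>2))" .
  qed
  also have "\<dots> \<le> ennreal q * mu2 K" by (intro mult_left_mono mu2_eps_le_mu2 \<epsilon>') simp
  finally show "mu2_eps \<epsilon> (h ` K) \<le> ennreal q * mu2 K" .
qed

lemma mu2_lipschitz_image_le:
  fixes h :: "real^'n \<Rightarrow> real^'n"
  assumes D: "D > 0" and lip: "\<And>x y. x \<in> K \<Longrightarrow> y \<in> K \<Longrightarrow> norm (h x - h y) \<le> D * norm (x - y)"
  shows "mu2 (h ` K) \<le> ennreal (4 * D\<^sup>2) * mu2 K"
proof (rule mu2_image_le[where ?r0.0=1 and D="2 * D"])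
  fix c r assume r: "(0::real) < r" "r \<le> 1"
  show "\<exists>C. finite C \<and> (\<forall>(c', r')\<in>C. 0 < r' \<and> r' \<le> 2 * D * r) \<and>
       h ` (K \<inter> ball c r) \<subseteq> (\<Union>(c', r')\<in>C. ball c' r') \<and> (\<Sum>(c', r')\<in>C. r'\<^sup>2) \<le> 4 * D\<^sup>2 * r\<^sup>2"
  proof (cases "K \<inter> ball c r = {}")
    case True then show ?thesis by (intro exI[of _ "{}"]) auto
  next
    case False
    then obtain x where x: "x \<in> K" "x \<in> ball c r" by blast
    have "norm (h x - h y) < 2 * D * r" if "y \<in> K" "y \<in> ball c r" for y
    proof -
      have "norm (x - y) < 2 * r" using x that by (simp add: dist_norm) norm
      then have "D * norm (x - y) < D * (2 * r)" using D by simp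
      then show ?thesis using lip[OF x(1) that(1)] by simp
    qed
    then show ?thesis using r D
      by (intro exI[of _ "{(h x, 2 * D * r)}"]) (auto simp: dist_norm power_mult_distrib)
  qed
qed (use D in auto)

lemma content_disc:
  fixes c :: "real^2" assumes "r \<ge> 0"
  shows "measure lebesgue (cball c r) = unit_ball_vol 2 * r\<^sup>2"
  using content_cball[OF assms, of c] by simp

text \<open>A cover of \<open>K\<close> by balls projects to a cover of \<open>V\<close> by discs, whose areas add up to at least that
  of \<open>V\<close>.\<close>

lemma mu2_projection_lower_bound:
  fixes p :: "real^'n \<Rightarrow> real^2"
  assumes p: "linear p" "\<And>x. norm (p x) \<le> B * norm x" and B: "B > 0"
    and V: "V \<in> lmeasurable" "V \<subseteq> (\<lambda>x. p (x - x0)) ` K"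
  shows "ennreal (measure lebesgue V) \<le> ennreal (unit_ball_vol 2 * B\<^sup>2) * mu2 K"
proof -
  have "ennreal (measure lebesgue V) \<le> ennreal (unit_ball_vol 2 * B\<^sup>2) * mu2_eps 1 K"
  proof (rule le_mult_mu2_epsI)
    show "0 < unit_ball_vol 2 * B\<^sup>2" using B by simp
    fix C :: "((real^'n) \<times> real) set"
    assume C: "finite C" "\<And>c r. (c, r) \<in> C \<Longrightarrow> 0 < r \<and> r \<le> 1" "K \<subseteq> (\<Union>(c, r)\<in>C. ball c r)"
    have sub: "V \<subseteq> (\<Union>x\<in>C. cball (p (fst x - x0)) (B * snd x))"
    proof
      fix v assume "v \<in> V"
      then obtain k where k: "k \<in> K" "v = p (k - x0)" using V by blast
      then obtain c r where c: "(c, r) \<in> C" "k \<in> ball c r" using C by blast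
      have "p (c - x0) - v = p (c - k)" unfolding k by (simp add: linear_diff[OF p(1), symmetric])
      then have "norm (p (c - x0) - v) \<le> B * norm (c - k)" using p(2)[of "c - k"] by simp
      also have "\<dots> \<le> B * r" using c B by (auto simp: dist_norm)
      finally show "v \<in> (\<Union>x\<in>C. cball (p (fst x - x0)) (B * snd x))"
        using c by (auto simp: dist_norm intro!: bexI[of _ "(c, r)"])
    qed
    have "measure lebesgue V \<le> measure lebesgue (\<Union>x\<in>C. cball (p (fst x - x0)) (B * snd x))"
      by (rule measure_mono_fmeasurable[OF sub]) (use V C in \<open>auto intro!: fmeasurable.finite_UN\<close>)
    also have "\<dots> \<le> (\<Sum>x\<in>C. measure lebesgue (cball (p (fst x - x0)) (B * snd x)))"
      by (intro measure_UNION_le C) auto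
    also have "\<dots> = (\<Sum>x\<in>C. unit_ball_vol 2 * B\<^sup>2 * (snd x)\<^sup>2)"
    proof (rule sum.cong)
      fix x assume "x \<in> C"
      then have "B * snd x \<ge> 0" using C(2)[of "fst x" "snd x"] B by auto
      then show "measure lebesgue (cball (p (fst x - x0)) (B * snd x)) = unit_ball_vol 2 * B\<^sup>2 * (snd x)\<^sup>2"
        by (subst content_disc) (auto simp: power_mult_distrib)
    qed simp
    also have "\<dots> = unit_ball_vol 2 * B\<^sup>2 * (\<Sum>(c, r)\<in>C. r\<^sup>2)"
      by (simp add: sum_distrib_left case_prod_unfold)
    finally show "ennreal (measure lebesgue V) \<le> ennreal (unit_ball_vol 2 * B\<^sup>2 * (\<Sum>(c, r)\<in>C. r\<^sup>2))"
      by (rule ennreal_leI)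
  qed
  also have "\<dots> \<le> ennreal (unit_ball_vol 2 * B\<^sup>2) * mu2 K"
    by (intro mult_left_mono mu2_eps_le_mu2) simp_all
  finally show ?thesis .
qed

lemma sum_squares_equal_radii:
  assumes "finite I"
  shows "(\<Sum>(c, r)\<in>(\<lambda>i. (h i, \<rho>)) ` I. r\<^sup>2) \<le> real (card I) * \<rho>\<^sup>2"
proof -
  have "(\<Sum>(c, r)\<in>(\<lambda>i. (h i, \<rho>)) ` I. r\<^sup>2) = (\<Sum>x\<in>(\<lambda>i. (h i, \<rho>)) ` I. \<rho>\<^sup>2)"
    by (rule sum.cong) auto
  also have "\<dots> = real (card ((\<lambda>i. (h i, \<rho>)) ` I)) * \<rho>\<^sup>2" by simp
  also have "\<dots> \<le> real (card I) * \<rho>\<^sup>2" using card_image_le[OF assms] by (intro mult_right_mono) auto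
  finally show ?thesis .
qed

lemma grid_point:
  fixes x h :: real assumes "h > 0" "\<bar>x\<bar> \<le> real m * h"
  shows "\<exists>j::int. j \<in> {- int m..int m} \<and> \<bar>x - of_int j * h\<bar> \<le> h"
proof -
  define j where "j = \<lfloor>x / h\<rfloor>"
  have j: "of_int j \<le> x / h" "x / h < of_int j + 1" unfolding j_def by linarith+
  have "\<bar>x / h\<bar> \<le> real m" using assms by (simp add: field_simps)
  then have "- real m \<le> x / h" "x / h \<le> real m" by linarith+
  then have "- int m \<le> j" "j \<le> int m" using j by linarith+
  moreover have "\<bar>x - of_int j * h\<bar> \<le> h" using j assms(1) by (simp add: field_simps abs_le_iff)
  ultimately show ?thesis by (intro exI[of _ j]) simp
qed

text \<open>A grid of mesh \<open>r / m\<close> has about \<open>4 m\<^sup>2\<close> points, and balls of radius proportional to \<open>r / m\<close> around them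
  cover the disc; the sum of the squared radii does not depend on \<open>m\<close>.\<close>

lemma mu2_plane_disc_le:
  fixes u w x0 :: "real^'n"
  assumes r: "r > 0"
  shows "mu2 ((\<lambda>z :: real^2. x0 + (z $ 1) *\<^sub>R u + (z $ 2) *\<^sub>R w) ` cball 0 r)
     \<le> ennreal (9 * (norm u + norm w + 1)\<^sup>2 * r\<^sup>2)" (is "mu2 ?K \<le> _")
proof (rule mu2_leI)
  fix \<epsilon> :: real assume \<epsilon>: "\<epsilon> > 0"
  define D where "D = norm u + norm w + 1"
  have D: "D > 0" by (simp add: D_def add_nonneg_pos)
  obtain m0 :: nat where m0: "D * r / \<epsilon> < real m0" using reals_Archimedean2 by blast
  define m where "m = Suc m0"
  define h where "h = r / real m"
  have h: "h > 0" "real m * h = r" using r by (simp_all add: h_def m_def)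
  have "D * r < real m0 * \<epsilon>" using m0 \<epsilon> by (simp add: field_simps)
  also have "\<dots> \<le> real m * \<epsilon>" using \<epsilon> by (simp add: m_def)
  finally have De: "D * h \<le> \<epsilon>" by (simp add: h_def field_simps m_def)
  define I where "I = {- int m..int m} \<times> {- int m..int m}"
  define cc where "cc ij = x0 + (of_int (fst ij) * h) *\<^sub>R u + (of_int (snd ij) * h) *\<^sub>R w" for ij :: "int \<times> int"
  have "mu2_eps \<epsilon> ?K \<le> ennreal (\<Sum>(c, r)\<in>(\<lambda>ij. (cc ij, D * h)) ` I. r\<^sup>2)"
  proof (rule mu2_eps_le_cover)
    show "finite ((\<lambda>ij. (cc ij, D * h)) ` I)" by (simp add: I_def)
    show "0 < r' \<and> r' \<le> \<epsilon>" if "(c', r') \<in> (\<lambda>ij. (cc ij, D * h)) ` I" for c' r' using that D h De by auto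
    show "?K \<subseteq> (\<Union>(c, r)\<in>(\<lambda>ij. (cc ij, D * h)) ` I. ball c r)"
    proof
      fix y assume "y \<in> ?K"
      then obtain z :: "real^2" where z: "norm z \<le> r" "y = x0 + (z $ 1) *\<^sub>R u + (z $ 2) *\<^sub>R w" by auto
      have zb: "\<bar>z $ i\<bar> \<le> real m * h" for i using component_le_norm_cart[of z i] z h by simp
      obtain i where i: "i \<in> {- int m..int m}" "\<bar>z $ 1 - of_int i * h\<bar> \<le> h" using grid_point[OF h(1) zb] by blast
      obtain j where j: "j \<in> {- int m..int m}" "\<bar>z $ 2 - of_int j * h\<bar> \<le> h" using grid_point[OF h(1) zb] by blast
      have "y - cc (i, j) = (z $ 1 - of_int i * h) *\<^sub>R u + (z $ 2 - of_int j * h) *\<^sub>R w"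
        by (simp add: z cc_def algebra_simps)
      also have "norm \<dots> \<le> \<bar>z $ 1 - of_int i * h\<bar> * norm u + \<bar>z $ 2 - of_int j * h\<bar> * norm w"
        by (metis norm_scaleR norm_triangle_ineq)
      also have "\<dots> \<le> h * norm u + h * norm w" using i j by (intro add_mono mult_right_mono) auto
      also have "\<dots> < D * h" using h by (simp add: D_def algebra_simps)
      finally have "y \<in> ball (cc (i, j)) (D * h)" by (simp add: dist_norm norm_minus_commute)
      moreover have "(i, j) \<in> I" using i j by (simp add: I_def)
      ultimately show "y \<in> (\<Union>(c, r)\<in>(\<lambda>ij. (cc ij, D * h)) ` I. ball c r)" by blast
    qed
  qed
  also have "\<dots> \<le> ennreal (real (card I) * (D * h)\<^sup>2)"
    by (intro ennreal_leI sum_squares_equal_radii) (simp add: I_def)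
  also have "real (card I) * (D * h)\<^sup>2 \<le> (3 * real m)\<^sup>2 * (D * h)\<^sup>2"
  proof (rule mult_right_mono)
    have "real (card I) = (2 * real m + 1)\<^sup>2"
      by (simp add: I_def card_cartesian_product power2_eq_square)
    also have "\<dots> \<le> (3 * real m)\<^sup>2" by (rule power_mono) (simp_all add: m_def)
    finally show "real (card I) \<le> (3 * real m)\<^sup>2" .
  qed simp
  also have "(3 * real m)\<^sup>2 * (D * h)\<^sup>2 = 9 * D\<^sup>2 * r\<^sup>2"
    by (simp add: power_mult_distrib h(2)[symmetric])
  finally show "mu2_eps \<epsilon> ?K \<le> ennreal (9 * (norm u + norm w + 1)\<^sup>2 * r\<^sup>2)"
    by (simp add: D_def ennreal_leI)
qed


section \<open>Uniform 2-contractivity implies the Andronov--Witt condition\<close>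

lemma funpow_linear:
  fixes f :: "'a::real_vector \<Rightarrow> 'a"
  shows "linear f \<Longrightarrow> linear (f ^^ k)"
proof (induction k)
  case (Suc k)
  then show ?case using linear_compose[of "f ^^ k" f] by (simp add: o_def)
qed (simp add: linear_iff)

lemma det_funpow:
  fixes A :: "real^'n^'n"
  shows "det (matrix ((*v) A ^^ k)) = det A ^ k"
proof (induction k)
  case 0
  have "matrix (\<lambda>x :: real^'n. x) = mat 1" by (rule matrix_id_mat_1[unfolded id_def])
  then show ?case by (simp add: id_def)
next
  case (Suc k)
  have "matrix ((*v) A \<circ> ((*v) A ^^ k)) = A ** matrix ((*v) A ^^ k)"
    by (subst matrix_compose) (auto intro: funpow_linear)
  then show ?case by (simp only: funpow.simps(2) det_mul Suc power_Suc)
qed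

text \<open>Brouwer's fixed point theorem serves as an inverse function theorem for maps that are merely
  continuous and close to a linear bijection.\<close>

lemma image_contains_linear_image:
  fixes G Lk :: "real^2 \<Rightarrow> real^2"
  assumes G: "continuous_on (cball 0 r) G" and r: "r > 0"
    and lin: "linear Lk" "linear N" "\<And>z. N (Lk z) = z" "\<And>z. Lk (N z) = z"
    and N: "\<And>z. norm (N z) \<le> B * norm z" and B: "B > 0"
    and close: "\<And>z. z \<in> cball 0 r \<Longrightarrow> norm (G z - Lk z) \<le> norm z / (2 * B)"
  shows "Lk ` cball 0 (r / 2) \<subseteq> G ` cball 0 r"
proof
  fix y assume "y \<in> Lk ` cball 0 (r / 2)"
  then obtain y' where y': "norm y' \<le> r / 2" "y = Lk y'" by auto
  have "\<exists>z\<in>cball 0 r. N (G z) = y'"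
  proof (rule brouwer_surjective_cball[where S="{y'}"])
    have "continuous_on UNIV N" using lin(2) by (simp add: linear_continuous_on linear_conv_bounded_linear)
    then show "continuous_on (cball 0 r) (\<lambda>z. N (G z))"
      by (rule continuous_on_compose2[OF _ G]) auto
    fix x z :: "real^2" assume x: "x \<in> {y'}" and z: "z \<in> cball 0 r"
    have "z - N (G z) = - N (G z - Lk z)" using lin(3)[of z] by (simp add: linear_diff[OF lin(2)])
    then have "norm (z - N (G z)) \<le> B * norm (G z - Lk z)" using N by simp
    also have "\<dots> \<le> B * (norm z / (2 * B))" using B close[OF z] by (intro mult_left_mono) auto
    also have "\<dots> \<le> r / 2" using B z by simp
    finally have "norm (y' + (z - N (G z))) \<le> r / 2 + r / 2"
      using y'(1) norm_triangle_ineq[of y' "z - N (G z)"] by linarith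
    then show "x + (z - N (G z)) \<in> cball 0 r" using x by simp
  qed (use r in auto)
  then obtain z where "z \<in> cball 0 r" "N (G z) = y'" by blast
  moreover from this have "G z = y" using lin(4) y'(2) by metis
  ultimately show "y \<in> G ` cball 0 r" by blast
qed

context periodic_orbit
begin

text \<open>The constants \<open>B\<close> of the projection \<open>p\<close> and \<open>D\<close> of the embedding \<open>\<iota>\<close> of the plane are fixed before the contraction rate
  \<open>\<epsilon>\<close>. The number \<open>k\<close> of periods depends on \<open>\<epsilon>\<close>, and the radius \<open>r\<close> of the disc on \<open>k\<close>.\<close>

theorem contractive_imp_andronov_witt:
  assumes X: "xs 0 \<in> interior X" and con: "uniformly_2_contractive f X"
  shows "andronov_witt f T (xs 0)"
proof (rule ccontr)
  assume "\<not> andronov_witt f T (xs 0)"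
  from not_andronov_witt_plane[OF this] obtain u w a b c d where
    ind: "\<And>\<alpha> \<beta>. \<alpha> *\<^sub>R u + \<beta> *\<^sub>R w = 0 \<Longrightarrow> \<alpha> = 0 \<and> \<beta> = 0" and
    M: "M *v u = a *\<^sub>R u + b *\<^sub>R w" "M *v w = c *\<^sub>R u + d *\<^sub>R w" and det: "\<bar>a * d - b * c\<bar> \<ge> 1"
    by metis
  define \<iota> where "\<iota> z = (z $ 1) *\<^sub>R u + (z $ 2) *\<^sub>R w" for z :: "real^2"
  have lin\<iota>: "linear \<iota>" by (auto simp: \<iota>_def linear_iff algebra_simps)
  have "z = 0" if "\<iota> z = 0" for z
    using ind[OF that[unfolded \<iota>_def]] by (simp add: vec_eq_iff forall_2)
  then have "inj \<iota>" using linear_injective_0[OF lin\<iota>] by blast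
  then obtain p where p: "linear p" "p \<circ> \<iota> = id" using linear_injective_left_inverse[OF lin\<iota>] by blast
  have p\<iota>: "p (\<iota> z) = z" for z using p(2) by (metis comp_apply id_apply)
  obtain B where B: "B > 0" "\<And>x. norm (p x) \<le> B * norm x"
    using linear_bounded_pos[OF p(1)] by blast
  define D where "D = norm u + norm w + 1"
  have D: "D > 0" by (simp add: D_def add_nonneg_pos)
  have \<iota>D: "norm (\<iota> z) \<le> D * norm z" for z
  proof -
    have "norm (\<iota> z) \<le> \<bar>z $ 1\<bar> * norm u + \<bar>z $ 2\<bar> * norm w"
      unfolding \<iota>_def by (metis norm_scaleR norm_triangle_ineq)
    also have "\<dots> \<le> norm z * norm u + norm z * norm w"
      by (intro add_mono mult_right_mono component_le_norm_cart) auto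
    also have "\<dots> \<le> D * norm z" by (simp add: D_def algebra_simps)
    finally show ?thesis .
  qed
  define LL :: "real^2^2" where "LL = vector [vector [a, c], vector [b, d]]"
  have detLL: "\<bar>det LL\<bar> \<ge> 1" using det by (simp add: LL_def det_2 algebra_simps)
  have M\<iota>: "M *v \<iota> z = \<iota> (LL *v z)" for z
  proof -
    have "(LL *v z) $ 1 = a * z $ 1 + c * z $ 2" "(LL *v z) $ 2 = b * z $ 1 + d * z $ 2"
      by (simp_all add: LL_def matrix_vector_mult_def sum_2)
    then show ?thesis
      by (simp add: \<iota>_def matrix_vector_right_distrib matrix_vector_mult_scaleR M algebra_simps)
  qed
  have Mk\<iota>: "((*v) M ^^ k) (\<iota> z) = \<iota> (((*v) LL ^^ k) z)" for k z
    by (induction k) (simp_all add: M\<iota>)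
  \<comment> \<open>The disc has 2-measure at most \<open>9 D\<^sup>2 r\<^sup>2\<close>, its image at least \<open>r\<^sup>2 / (4 B\<^sup>2)\<close>; the choice of \<open>\<epsilon>\<close> separates the two.\<close>
  define \<epsilon> where "\<epsilon> = min (1/2) (1 / (72 * B\<^sup>2 * D\<^sup>2))"
  have \<epsilon>: "0 < \<epsilon>" "\<epsilon> < 1" using B D by (auto simp: \<epsilon>_def)
  have \<epsilon>BD: "B\<^sup>2 * (\<epsilon> * (9 * D\<^sup>2)) \<le> 1 / 8"
  proof -
    have "\<epsilon> * (72 * B\<^sup>2 * D\<^sup>2) \<le> 1 / (72 * B\<^sup>2 * D\<^sup>2) * (72 * B\<^sup>2 * D\<^sup>2)"
      by (intro mult_right_mono) (auto simp: \<epsilon>_def)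
    also have "\<dots> = 1" using B D by simp
    finally show ?thesis by (simp add: mult_ac)
  qed
  have "\<exists>\<T>>0. \<forall>K. compact K \<and> K \<subseteq> X \<and> mu2 K < \<infinity> \<longrightarrow> (\<forall>t\<ge>\<T>. mu2 (flow f t ` K) \<le> ennreal \<epsilon> * mu2 K)"
    using con[unfolded uniformly_2_contractive_def, rule_format, OF conjI[OF \<epsilon>]] .
  then obtain \<T> where \<T>: "\<forall>K. compact K \<and> K \<subseteq> X \<and> mu2 K < \<infinity> \<longrightarrow> (\<forall>t\<ge>\<T>. mu2 (flow f t ` K) \<le> ennreal \<epsilon> * mu2 K)"
    by (elim exE conjE)
  obtain k :: nat where "\<T> / T < real k" using reals_Archimedean2 by blast
  define \<tau> where "\<tau> = real k * T"
  have \<tau>: "\<tau> \<ge> \<T>" "\<tau> \<ge> 0" using \<open>\<T> / T < real k\<close> T_pos by (simp_all add: \<tau>_def field_simps)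
  define Lk where "Lk = (*v) LL ^^ k"
  have linLk: "linear Lk" unfolding Lk_def by (intro funpow_linear) simp
  have "\<bar>det (matrix Lk)\<bar> = \<bar>det LL\<bar> ^ k" by (simp add: Lk_def det_funpow power_abs)
  then have detLk: "\<bar>det (matrix Lk)\<bar> \<ge> 1" using detLL by simp
  then have "invertible (matrix Lk)" unfolding invertible_det_nz by auto
  then obtain N' where N': "matrix Lk ** N' = mat 1" "N' ** matrix Lk = mat 1" unfolding invertible_def by blast
  define N where "N = (*v) N'"
  have NL: "N (Lk z) = z" "Lk (N z) = z" for z
  proof -
    have mL: "matrix Lk *v z = Lk z" for z using linLk by (simp add: matrix_works)
    have "N' *v (matrix Lk *v z) = z" "matrix Lk *v (N' *v z) = z"
      by (simp_all only: matrix_vector_mul_assoc N' matrix_vector_mul_lid)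
    then show "N (Lk z) = z" "Lk (N z) = z" by (simp_all only: N_def mL)
  qed
  have linN: "linear N" by (simp add: N_def)
  obtain Bn where Bn: "Bn > 0" "\<And>z. norm (N z) \<le> Bn * norm z"
    using linear_bounded_pos[OF linN] by blast
  define \<eta> where "\<eta> = 1 / (2 * Bn * B * D)"
  have \<eta>: "\<eta> > 0" using Bn B D by (simp add: \<eta>_def)
  obtain \<rho> where \<rho>: "\<rho> > 0" "\<And>s a a'. 0 \<le> s \<Longrightarrow> a \<in> cball (xs s) \<rho> \<Longrightarrow> a' \<in> cball (xs s) \<rho> \<Longrightarrow>
    norm (flow g \<tau> a' - flow g \<tau> a - Phi (s + \<tau>) *v (Psi s *v (a' - a))) \<le> \<eta> * norm (a' - a)"
    using linear_estimate[OF \<tau>(2) \<eta>] by blast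
  obtain \<epsilon>0 where \<epsilon>0: "\<epsilon>0 > 0" "cball (xs 0) \<epsilon>0 \<subseteq> X"
    using X by (metis mem_interior_cball)
  define r where "r = min (min \<rho> \<epsilon>0) (exp (- (L * \<tau>))) / D"
  have r: "r > 0" "D * r \<le> \<rho>" "D * r \<le> \<epsilon>0" "D * r \<le> exp (- (L * \<tau>))"
    using \<rho>(1) \<epsilon>0 D by (auto simp: r_def)
  have \<iota>r: "norm (\<iota> z) \<le> D * r" if "z \<in> cball 0 r" for z
    using \<iota>D[of z] that D by (auto intro: order_trans mult_left_mono)
  define K where "K = (\<lambda>z. xs 0 + \<iota> z) ` cball 0 r"
  have cont\<iota>: "continuous_on S \<iota>" for S using lin\<iota> by (simp add: linear_continuous_on linear_conv_bounded_linear)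
  have contp: "continuous_on S p" for S using p(1) by (simp add: linear_continuous_on linear_conv_bounded_linear)
  have "compact K" unfolding K_def by (intro compact_continuous_image continuous_intros cont\<iota> compact_cball)
  moreover have "K \<subseteq> X"
  proof
    fix x assume "x \<in> K"
    then obtain z where "z \<in> cball 0 r" "x = xs 0 + \<iota> z" unfolding K_def by blast
    then have "x \<in> cball (xs 0) \<epsilon>0" using \<iota>r[of z] r by (simp add: dist_norm)
    then show "x \<in> X" using \<epsilon>0 by blast
  qed
  moreover have muK: "mu2 K \<le> ennreal (9 * D\<^sup>2 * r\<^sup>2)"
    using mu2_plane_disc_le[OF r(1), of "xs 0" u w] by (simp add: K_def \<iota>_def D_def add.assoc)
  moreover have "mu2 K < \<infinity>" using muK by (simp add: le_less_trans)
  ultimately have "mu2 (flow f \<tau> ` K) \<le> ennreal \<epsilon> * mu2 K"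
    by (intro \<T>[rule_format, OF _ \<tau>(1)] conjI)
  also have "\<dots> \<le> ennreal \<epsilon> * ennreal (9 * D\<^sup>2 * r\<^sup>2)" by (intro mult_left_mono muK) simp
  also have "\<dots> = ennreal (\<epsilon> * (9 * D\<^sup>2 * r\<^sup>2))" using \<epsilon> by (simp add: ennreal_mult)
  finally have upper: "mu2 (flow f \<tau> ` K) \<le> ennreal (\<epsilon> * (9 * D\<^sup>2 * r\<^sup>2))" .
  have fg: "flow f \<tau> (xs 0 + \<iota> z) = flow g \<tau> (xs 0 + \<iota> z)" if "z \<in> cball 0 r" for z
  proof (rule flow_f_near[OF \<tau>(2), where s=0])
    have "exp (L * \<tau>) * norm (\<iota> z) \<le> exp (L * \<tau>) * exp (- (L * \<tau>))"
      using \<iota>r[OF that] r(4) by (intro mult_left_mono) auto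
    then show "exp (L * \<tau>) * norm (xs 0 + \<iota> z - xs 0) \<le> 1" by (simp flip: exp_add)
  qed
  define G where "G z = p (flow g \<tau> (xs 0 + \<iota> z) - xs 0)" for z
  have contG: "continuous_on (cball 0 r) G" unfolding G_def
    by (intro continuous_on_compose2[OF contp[of UNIV]] continuous_intros
        continuous_on_compose2[OF cont_flow[OF \<tau>(2), of UNIV]] cont\<iota>) auto
  have Gclose: "norm (G z - Lk z) \<le> norm z / (2 * Bn)" if z: "z \<in> cball 0 r" for z
  proof -
    have fx: "flow g \<tau> (xs 0) = xs 0" using flow_xs[OF \<tau>(2), of 0] xs_nT[of 0 k] by (simp add: \<tau>_def)
    have P: "Phi (0 + \<tau>) *v (Psi 0 *v \<iota> z) = \<iota> (Lk z)"
      using Phi_nT[of 0 k "\<iota> z"] by (simp add: \<tau>_def Psi_0 Phi_0 Mk\<iota> Lk_def)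
    have "norm (flow g \<tau> (xs 0 + \<iota> z) - xs 0 - \<iota> (Lk z)) \<le> \<eta> * norm (\<iota> z)"
      using \<rho>(2)[of 0 "xs 0" "xs 0 + \<iota> z"] \<iota>r[OF z] r(2) \<rho>(1) fx P by (simp add: dist_norm)
    also have "\<dots> \<le> \<eta> * (D * norm z)" using \<eta> \<iota>D by (intro mult_left_mono) auto
    finally have 1: "norm (flow g \<tau> (xs 0 + \<iota> z) - xs 0 - \<iota> (Lk z)) \<le> \<eta> * (D * norm z)" .
    have "G z - Lk z = p (flow g \<tau> (xs 0 + \<iota> z) - xs 0 - \<iota> (Lk z))"
      by (simp add: G_def linear_diff[OF p(1)] p\<iota>)
    then have "norm (G z - Lk z) \<le> B * norm (flow g \<tau> (xs 0 + \<iota> z) - xs 0 - \<iota> (Lk z))" using B by simp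
    also have "\<dots> \<le> B * (\<eta> * (D * norm z))" using B 1 by (intro mult_left_mono) auto
    also have "\<dots> = norm z / (2 * Bn)" using B D Bn by (simp add: \<eta>_def field_simps)
    finally show ?thesis .
  qed
  have sub: "Lk ` cball 0 (r / 2) \<subseteq> (\<lambda>x. p (x - xs 0)) ` (flow f \<tau> ` K)"
  proof -
    have "Lk ` cball 0 (r / 2) \<subseteq> G ` cball 0 r"
      by (rule image_contains_linear_image[OF contG r(1) linLk linN NL Bn(2,1) Gclose])
    also have "G ` cball 0 r = (\<lambda>x. p (x - xs 0)) ` (flow f \<tau> ` K)"
      unfolding K_def image_image G_def using fg by (intro image_cong) auto
    finally show ?thesis .
  qed
  have meas: "Lk ` cball 0 (r / 2) \<in> lmeasurable" by (intro measurable_linear_image linLk) simp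
  have "unit_ball_vol 2 * (r / 2)\<^sup>2 = measure lebesgue (cball (0 :: real^2) (r / 2))"
    using content_disc[of "r / 2" 0] r by simp
  also have "\<dots> \<le> \<bar>det (matrix Lk)\<bar> * measure lebesgue (cball (0 :: real^2) (r / 2))"
    using detLk by (simp add: mult_le_cancel_right1)
  also have "\<dots> = measure lebesgue (Lk ` cball 0 (r / 2))"
    by (subst measure_linear_image[OF linLk]) simp_all
  finally have "ennreal (unit_ball_vol 2 * (r / 2)\<^sup>2) \<le> ennreal (measure lebesgue (Lk ` cball 0 (r / 2)))"
    by (rule ennreal_leI)
  also have "\<dots> \<le> ennreal (unit_ball_vol 2 * B\<^sup>2) * mu2 (flow f \<tau> ` K)"
    by (rule mu2_projection_lower_bound[OF p(1) B(2,1) meas sub])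
  also have "\<dots> \<le> ennreal (unit_ball_vol 2 * B\<^sup>2) * ennreal (\<epsilon> * (9 * D\<^sup>2 * r\<^sup>2))"
    by (intro mult_left_mono upper) simp
  also have "\<dots> = ennreal (unit_ball_vol 2 * B\<^sup>2 * (\<epsilon> * (9 * D\<^sup>2 * r\<^sup>2)))"
    using \<epsilon> by (intro ennreal_mult[symmetric]) auto
  finally have "unit_ball_vol 2 * (r / 2)\<^sup>2 \<le> unit_ball_vol 2 * B\<^sup>2 * (\<epsilon> * (9 * D\<^sup>2 * r\<^sup>2))"
    using \<epsilon> by (subst (asm) ennreal_le_iff) auto
  then have "unit_ball_vol 2 * ((r / 2)\<^sup>2) \<le> unit_ball_vol 2 * (B\<^sup>2 * (\<epsilon> * (9 * D\<^sup>2)) * r\<^sup>2)"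
    by (simp add: mult_ac)
  then have "(r / 2)\<^sup>2 \<le> B\<^sup>2 * (\<epsilon> * (9 * D\<^sup>2)) * r\<^sup>2"
    using unit_ball_vol_pos[of 2] by (simp only: mult_le_cancel_left_pos)
  also have "\<dots> \<le> 1 / 8 * r\<^sup>2" using \<epsilon>BD by (intro mult_right_mono) auto
  finally show False using r(1) by (simp add: power_divide)
qed

end

section \<open>The Andronov--Witt condition implies uniform 2-contractivity\<close>

context periodic_orbit
begin

definition near :: "real \<Rightarrow> real^'n \<Rightarrow> bool" where
  "near r x \<longleftrightarrow> (\<exists>s\<in>{0..T}. norm (x - xs s) \<le> r)"

lemma nearI: "norm (x - xs t) \<le> r \<Longrightarrow> near r x"
  using ex_phase[of t] unfolding near_def by force

lemma near_flow: "near r x \<Longrightarrow> t \<ge> 0 \<Longrightarrow> near (exp (L * t) * r) (flow g t x)"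
  unfolding near_def[of r]
  by (elim bexE, rule nearI, rule order_trans[OF flow_near_orbit]) (auto intro: mult_left_mono)

lemma bound_on_period:
  fixes F :: "real \<Rightarrow> real^'n^'n"
  assumes "continuous_on {0..T} F"
  obtains B where "B > 0" "\<And>s v. s \<in> {0..T} \<Longrightarrow> norm (F s *v v) \<le> B * norm v"
proof -
  have "bounded (F ` {0..T})" by (intro compact_imp_bounded compact_continuous_image assms) auto
  then obtain B where B: "B > 0" "\<And>s. s \<in> {0..T} \<Longrightarrow> norm (F s) \<le> B" by (auto simp: bounded_pos)
  have "norm (F s *v v) \<le> real CARD('n) * real CARD('n) * B * norm v" if "s \<in> {0..T}" for s v
    using B(2)[OF that] B(1) by (intro order_trans[OF norm_matrix_vector_le] mult_mono) auto
  then show ?thesis using that[of "real CARD('n) * real CARD('n) * B"] B by simp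
qed

lemma cont_Psi: "continuous_on {0..b} Psi"
proof (rule continuous_on_subset)
  show "continuous_on {0..} Psi" by (rule has_vector_derivative_imp_continuous_on[OF Psi_deriv]) simp
qed auto

text \<open>Differences of solutions near the orbit are mapped in time \<open>\<tau>\<close>, a multiple of the period, to the direction \<open>e s\<close>
  with bounded expansion \<open>C\<close>, up to a relative error \<open>\<delta>\<close>.\<close>

definition squeezes :: "real \<Rightarrow> real \<Rightarrow> real \<Rightarrow> real \<Rightarrow> bool" where
  "squeezes C \<delta> \<tau> \<rho> \<longleftrightarrow> (\<forall>s\<in>{0..T}. flow g \<tau> (xs s) = xs s \<and>
    (\<forall>a\<in>cball (xs s) \<rho>. \<forall>a'\<in>cball (xs s) \<rho>. \<exists>\<alpha>. \<bar>\<alpha>\<bar> \<le> C * norm (a' - a) \<and>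
       norm (flow g \<tau> a' - flow g \<tau> a - \<alpha> *\<^sub>R e s) \<le> \<delta> * norm (a' - a)))"

text \<open>The powers of \<open>M\<close> converge to the projection onto \<open>e 0\<close> along the stable complement. Hence the
  linearized flow over many periods is close to a projection onto \<open>e s\<close>, with a bound \<open>C\<close> that does not depend on the
  number of periods.\<close>

lemma squeeze_estimate:
  assumes "andronov_witt f T (xs 0)"
  obtains C where "C > 0" "\<And>\<delta>. \<delta> > 0 \<Longrightarrow> \<exists>\<tau>>0. \<exists>\<rho>>0. squeezes C \<delta> \<tau> \<rho>"
proof -
  obtain a C0 q where a: "\<And>v. a \<bullet> (M *v v) = a \<bullet> v" "a \<bullet> e 0 = 1"
    and decay: "0 \<le> C0" "0 \<le> q" "q < 1"
    "\<And>j v. norm (((*v) M ^^ j) (v - (a \<bullet> v) *\<^sub>R e 0)) \<le> C0 * q ^ j * norm v"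
    using andronov_witt_splitting[OF assms] by metis
  obtain B1 where B1: "B1 > 0" "\<And>s v. s \<in> {0..T} \<Longrightarrow> norm (Phi s *v v) \<le> B1 * norm v"
    using bound_on_period[OF cont_Phi] by blast
  obtain B2 where B2: "B2 > 0" "\<And>s v. s \<in> {0..T} \<Longrightarrow> norm (Psi s *v v) \<le> B2 * norm v"
    using bound_on_period[OF cont_Psi] by blast
  define C where "C = norm a * B2 + 1"
  have C: "C > 0" using B2 by (simp add: C_def add_nonneg_pos)
  show ?thesis
  proof (rule that[OF C])
    fix \<delta> :: real assume \<delta>: "\<delta> > 0"
    have "(\<lambda>N. B1 * (C0 * q ^ N * B2)) \<longlonglongrightarrow> B1 * (C0 * 0 * B2)"
      using decay by (intro tendsto_intros LIMSEQ_power_zero) auto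
    then have "eventually (\<lambda>N. B1 * (C0 * q ^ N * B2) < \<delta> / 2) sequentially"
      using \<delta> by (intro order_tendstoD(2)[where y="B1 * (C0 * 0 * B2)"]) auto
    then have "eventually (\<lambda>N. B1 * (C0 * q ^ N * B2) < \<delta> / 2 \<and> N \<ge> 1) sequentially"
      by (intro eventually_conj eventually_ge_at_top)
    then obtain N where N: "B1 * (C0 * q ^ N * B2) < \<delta> / 2" "N \<ge> 1"
      by (metis (no_types, lifting) eventually_sequentially order_refl)
    define \<tau> where "\<tau> = real N * T"
    have \<tau>: "\<tau> > 0" using N T_pos by (simp add: \<tau>_def)
    obtain \<rho> where \<rho>: "\<rho> > 0" "\<And>s a a'. 0 \<le> s \<Longrightarrow> a \<in> cball (xs s) \<rho> \<Longrightarrow> a' \<in> cball (xs s) \<rho> \<Longrightarrow>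
      norm (flow g \<tau> a' - flow g \<tau> a - Phi (s + \<tau>) *v (Psi s *v (a' - a))) \<le> \<delta> / 2 * norm (a' - a)"
      using linear_estimate[of \<tau> "\<delta> / 2"] \<tau> \<delta> by (metis half_gt_zero less_imp_le)
    have Me: "((*v) M ^^ j) (e 0) = e 0" for j by (induction j) (simp_all add: M_e)
    show "\<exists>\<tau>>0. \<exists>\<rho>>0. squeezes C \<delta> \<tau> \<rho>" unfolding squeezes_def
    proof (rule exI[of _ \<tau>], rule conjI[OF \<tau>], rule exI[of _ \<rho>], rule conjI[OF \<rho>(1)], intro ballI conjI)
      fix s assume s: "s \<in> {0..T}"
      show "flow g \<tau> (xs s) = xs s" using flow_xs[of \<tau> s] \<tau> xs_nT[of s N] by (simp add: \<tau>_def)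
      fix x x' assume x: "x \<in> cball (xs s) \<rho>" "x' \<in> cball (xs s) \<rho>"
      define v where "v = Psi s *v (x' - x)"
      have v: "norm v \<le> B2 * norm (x' - x)" unfolding v_def by (rule B2(2)[OF s])
      define \<alpha> where "\<alpha> = a \<bullet> v"
      have "\<bar>\<alpha>\<bar> \<le> norm a * norm v" unfolding \<alpha>_def by (rule Cauchy_Schwarz_ineq2)
      also have "\<dots> \<le> norm a * (B2 * norm (x' - x))" by (intro mult_left_mono v) simp
      also have "\<dots> \<le> C * norm (x' - x)" by (simp add: C_def algebra_simps)
      finally have 1: "\<bar>\<alpha>\<bar> \<le> C * norm (x' - x)" .
      define d where "d = ((*v) M ^^ N) (v - \<alpha> *\<^sub>R e 0)"
      have linM: "linear ((*v) M ^^ N)"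
        by (induction N) (auto simp: linear_iff matrix_vector_right_distrib matrix_vector_mult_scaleR)
      have MN: "((*v) M ^^ N) v = d + \<alpha> *\<^sub>R e 0"
        by (simp add: d_def linear_diff[OF linM] linear_scale[OF linM] Me)
      have "Phi (s + \<tau>) *v v = Phi s *v d + \<alpha> *\<^sub>R e s"
        using Phi_nT[of s N v] Phi_e[of s] s
        by (simp add: \<tau>_def MN matrix_vector_right_distrib matrix_vector_mult_scaleR)
      then have eq: "flow g \<tau> x' - flow g \<tau> x - \<alpha> *\<^sub>R e s
          = (flow g \<tau> x' - flow g \<tau> x - Phi (s + \<tau>) *v v) + Phi s *v d" by simp
      have "norm (Phi s *v d) \<le> B1 * norm d" by (rule B1(2)[OF s])
      also have "\<dots> \<le> B1 * (C0 * q ^ N * norm v)"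
        unfolding d_def \<alpha>_def using B1 by (intro mult_left_mono decay(4)) simp
      also have "\<dots> \<le> B1 * (C0 * q ^ N * (B2 * norm (x' - x)))"
        using B1 decay v by (intro mult_left_mono) auto
      also have "\<dots> = (B1 * (C0 * q ^ N * B2)) * norm (x' - x)" by simp
      also have "\<dots> \<le> \<delta> / 2 * norm (x' - x)" using N by (intro mult_right_mono) auto
      finally have "norm (flow g \<tau> x' - flow g \<tau> x - \<alpha> *\<^sub>R e s) \<le> \<delta> / 2 * norm (x' - x) + \<delta> / 2 * norm (x' - x)"
        unfolding eq using \<rho>(2)[of s x x'] s x
        by (intro order_trans[OF norm_triangle_ineq] add_mono) (auto simp: v_def)
      then show "\<exists>\<alpha>. \<bar>\<alpha>\<bar> \<le> C * norm (x' - x) \<and>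
         norm (flow g \<tau> x' - flow g \<tau> x - \<alpha> *\<^sub>R e s) \<le> \<delta> * norm (x' - x)"
        using 1 by (intro exI[of _ \<alpha>]) simp
    qed
  qed
qed

lemma e_bound: "\<exists>E\<ge>1. \<forall>t. norm (e t) \<le> E"
proof -
  have "continuous_on {0..T} e"
    by (rule has_vector_derivative_imp_continuous_on[OF e_deriv])
  then have "bounded (e ` {0..T})" by (intro compact_imp_bounded compact_continuous_image) auto
  then obtain E where "\<forall>x\<in>e ` {0..T}. norm x \<le> E" unfolding bounded_iff by blast
  then have E: "norm (e s) \<le> E" if "s \<in> {0..T}" for s using that by blast
  have "norm (e t) \<le> max 1 E" for t
  proof -
    obtain s where s: "0 \<le> s" "s < T" "xs t = xs s" using ex_phase by blast
    then show ?thesis using E[of s] by (simp add: e_def)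
  qed
  then show ?thesis by (intro exI[of _ "max 1 E"]) auto
qed

lemma tangent_estimate: "\<exists>\<kappa>>0. \<forall>s \<alpha>. norm (xs (s + \<alpha>) - xs s - \<alpha> *\<^sub>R e s) \<le> \<kappa> * \<alpha>\<^sup>2"
proof -
  obtain E where E: "E \<ge> 1" "\<And>t. norm (e t) \<le> E" using e_bound by blast
  have xl: "norm (xs t - xs s) \<le> E * norm (t - s)" for s t
  proof (rule differentiable_bound[OF convex_UNIV, where f'="\<lambda>t h. h *\<^sub>R e t"])
    show "(xs has_derivative (\<lambda>h. h *\<^sub>R e x)) (at x within UNIV)" for x
      using xs_deriv[of x UNIV] by (simp add: has_vector_derivative_def e_def)
    show "onorm (\<lambda>h. h *\<^sub>R e x) \<le> E" for x
      by (rule onorm_le) (simp add: mult.commute[of E] mult_left_mono E)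
  qed auto
  have "norm (xs (s + \<alpha>) - xs s - \<alpha> *\<^sub>R e s) \<le> (L * E + 1) * \<alpha>\<^sup>2" for s \<alpha>
  proof -
    have "norm (xs (s + \<alpha>) - xs s - ((s + \<alpha>) - s) *\<^sub>R e s) \<le> norm ((s + \<alpha>) - s) * (L * (E * \<bar>\<alpha>\<bar>))"
    proof (rule vector_differentiable_bound_linearization[where S="closed_segment s (s + \<alpha>)"])
      show "(xs has_vector_derivative e x) (at x within closed_segment s (s + \<alpha>))" for x
        unfolding e_def by (rule xs_deriv)
      fix x assume x: "x \<in> closed_segment s (s + \<alpha>)"
      have "norm (e x - e s) \<le> L * norm (xs x - xs s)" unfolding e_def by (intro L xs_in_ball)
      also have "\<dots> \<le> L * (E * norm (x - s))" by (intro mult_left_mono xl L)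
      also have "norm (x - s) \<le> \<bar>\<alpha>\<bar>" using x by (auto simp: closed_segment_eq_real_ivl split: if_splits)
      finally show "norm (e x - e s) \<le> L * (E * \<bar>\<alpha>\<bar>)" using L(1) E(1) by (simp add: mult_left_mono)
    qed auto
    also have "\<dots> = (L * E) * \<alpha>\<^sup>2" by (simp add: power2_eq_square)
    also have "\<dots> \<le> (L * E + 1) * \<alpha>\<^sup>2" by (intro mult_right_mono) auto
    finally show ?thesis by simp
  qed
  moreover have "L * E + 1 > 0" using L(1) E(1) by (simp add: add_nonneg_pos)
  ultimately show ?thesis by blast
qed

lemma near_mono: "near r x \<Longrightarrow> r \<le> r' \<Longrightarrow> near r' x"
  unfolding near_def by force

text \<open>After time \<open>\<tau>\<close> a point at distance \<open>r\<close> from \<open>xs s\<close> is within \<open>r / 4\<close> of \<open>xs s + \<alpha> e s\<close>, which differs from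
  the point \<open>xs (s + \<alpha>)\<close> of the orbit by a term quadratic in \<open>r\<close>. The distance from the orbit is thus halved in
  time \<open>\<tau>\<close>, and it grows at most by the factor \<open>exp (L \<tau>)\<close> in between.\<close>

lemma orbital_stability:
  assumes "andronov_witt f T (xs 0)"
  obtains r1 \<Lambda> where "r1 > 0" "\<Lambda> \<ge> 1"
    "\<And>r x t. 0 < r \<Longrightarrow> r \<le> r1 \<Longrightarrow> near r x \<Longrightarrow> 0 \<le> t \<Longrightarrow> near (\<Lambda> * r) (flow g t x)"
proof -
  obtain C where C: "C > 0" "\<And>\<delta>. \<delta> > 0 \<Longrightarrow> \<exists>\<tau>>0. \<exists>\<rho>>0. squeezes C \<delta> \<tau> \<rho>"
    using squeeze_estimate[OF assms] by metis
  obtain \<tau> \<rho> where \<tau>: "\<tau> > 0" and \<rho>: "\<rho> > 0" and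
    sq: "squeezes C (1/4) \<tau> \<rho>"
    using C(2)[of "1/4"] by auto
  obtain \<kappa> where \<kappa>: "\<kappa> > 0" "\<And>s \<alpha>. norm (xs (s + \<alpha>) - xs s - \<alpha> *\<^sub>R e s) \<le> \<kappa> * \<alpha>\<^sup>2"
    using tangent_estimate by blast
  define r1 where "r1 = min \<rho> (1 / (4 * \<kappa> * C\<^sup>2))"
  have r1: "r1 > 0" "r1 \<le> \<rho>" using \<rho> \<kappa> C by (auto simp: r1_def)
  have half: "near (r / 2) (flow g \<tau> x)" if r: "0 < r" "r \<le> r1" and x: "near r x" for r x
  proof -
    obtain s where s: "s \<in> {0..T}" "norm (x - xs s) \<le> r" using x unfolding near_def by blast
    have "x \<in> cball (xs s) \<rho>" "xs s \<in> cball (xs s) \<rho>"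
      using s(2) r r1 \<rho> by (auto simp: dist_norm norm_minus_commute)
    then obtain \<alpha> where \<alpha>: "\<bar>\<alpha>\<bar> \<le> C * norm (x - xs s)"
      "norm (flow g \<tau> x - flow g \<tau> (xs s) - \<alpha> *\<^sub>R e s) \<le> 1/4 * norm (x - xs s)"
      using bspec[OF sq[unfolded squeezes_def] s(1)] by blast
    have fx: "flow g \<tau> (xs s) = xs s" using bspec[OF sq[unfolded squeezes_def] s(1)] by blast
    have "\<bar>\<alpha>\<bar> \<le> C * r" using \<alpha>(1) mult_left_mono[OF s(2), of C] C(1) by linarith
    then have "\<alpha>\<^sup>2 \<le> (C * r)\<^sup>2" by (metis abs_ge_zero power2_abs power_mono)
    then have "\<kappa> * \<alpha>\<^sup>2 \<le> \<kappa> * (C * r)\<^sup>2" using \<kappa>(1) by (intro mult_left_mono) auto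
    also have "\<dots> = (\<kappa> * C\<^sup>2 * r) * r" by (simp add: power2_eq_square)
    also have "\<dots> \<le> 1/4 * r"
    proof (rule mult_right_mono)
      have "\<kappa> * C\<^sup>2 * r \<le> \<kappa> * C\<^sup>2 * (1 / (4 * \<kappa> * C\<^sup>2))"
        using r \<kappa> by (intro mult_left_mono) (auto simp: r1_def)
      then show "\<kappa> * C\<^sup>2 * r \<le> 1/4" using \<kappa> C by simp
    qed (use r in simp)
    finally have k: "norm (xs (s + \<alpha>) - xs s - \<alpha> *\<^sub>R e s) \<le> 1/4 * r" using \<kappa>(2)[of s \<alpha>] by linarith
    have "flow g \<tau> x - xs (s + \<alpha>) = (flow g \<tau> x - flow g \<tau> (xs s) - \<alpha> *\<^sub>R e s)
        - (xs (s + \<alpha>) - xs s - \<alpha> *\<^sub>R e s)" by (simp add: fx)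
    then have "norm (flow g \<tau> x - xs (s + \<alpha>)) \<le> norm (flow g \<tau> x - flow g \<tau> (xs s) - \<alpha> *\<^sub>R e s)
        + norm (xs (s + \<alpha>) - xs s - \<alpha> *\<^sub>R e s)" by (metis norm_triangle_ineq4)
    also have "\<dots> \<le> r / 2" using \<alpha>(2) s(2) k by linarith
    finally show ?thesis by (rule nearI)
  qed
  have iter: "near r (flow g (real k * \<tau>) x)" if r: "0 < r" "r \<le> r1" and x: "near r x" for r x k
  proof (induction k)
    case 0 show ?case using x by (simp add: flow_0)
  next
    case (Suc k)
    have "flow g (real (Suc k) * \<tau>) x = flow g (real k * \<tau> + \<tau>) x" by (simp add: algebra_simps)
    also have "\<dots> = flow g \<tau> (flow g (real k * \<tau>) x)" using \<tau> by (intro flow_add) auto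
    finally show ?case using near_mono[OF half[OF r Suc]] r by simp
  qed
  show ?thesis
  proof (rule that[OF r1(1)])
    show "1 \<le> exp (L * \<tau>)" using L(1) \<tau> by simp
    fix r t :: real and x assume r: "0 < r" "r \<le> r1" and x: "near r x" and t: "0 \<le> t"
    obtain k s where s: "0 \<le> s" "s < \<tau>" "t = s + real k * \<tau>" using nonneg_reduce[OF \<tau> t] .
    have eq: "flow g t x = flow g s (flow g (real k * \<tau>) x)"
      using flow_add[of "real k * \<tau>" s x] s \<tau> by (simp add: add.commute)
    have "near (exp (L * s) * r) (flow g t x)"
      unfolding eq by (rule near_flow[OF iter[OF r x] s(1)])
    moreover have "exp (L * s) * r \<le> exp (L * \<tau>) * r"
      using s r L(1) by (intro mult_right_mono) (auto simp: mult_left_mono)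
    ultimately show "near (exp (L * \<tau>) * r) (flow g t x)" by (rule near_mono)
  qed
qed

text \<open>The image of a ball of radius \<open>r\<close> lies within \<open>2 \<delta> r\<close> of a segment of length proportional to \<open>r\<close>. It is covered
  by about \<open>1 / \<delta>\<close> balls of radius \<open>4 \<delta> r\<close>, whose squared radii sum up to a multiple of \<open>\<delta> r\<^sup>2\<close>.\<close>

lemma squeeze_mu2:
  assumes "andronov_witt f T (xs 0)"
  obtains \<tau> \<rho> where "\<tau> > 0" "\<rho> > 0"
    "\<And>K. (\<And>x. x \<in> K \<Longrightarrow> near \<rho> x) \<Longrightarrow> mu2 (flow g \<tau> ` K) \<le> ennreal (1/2) * mu2 K"
proof -
  obtain C where C: "C > 0" "\<And>\<delta>. \<delta> > 0 \<Longrightarrow> \<exists>\<tau>>0. \<exists>\<rho>>0. squeezes C \<delta> \<tau> \<rho>"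
    using squeeze_estimate[OF assms] by metis
  obtain E where E: "E \<ge> 1" "\<And>t. norm (e t) \<le> E" using e_bound by blast
  \<comment> \<open>With this \<open>\<delta>\<close>, the total \<open>64 C E \<delta> + 48 \<delta>\<^sup>2\<close> of the squared radii for \<open>r = 1\<close> is at most 1/2.\<close>
  define \<delta> where "\<delta> = 1 / (256 * (C * E + 1))"
  have CE: "C * E > 0" using C E by simp
  have \<delta>: "\<delta> > 0" "C * E * \<delta> \<le> 1 / 256" "\<delta> \<le> 1 / 256" using CE by (auto simp: \<delta>_def field_simps)
  obtain \<tau> \<rho> where \<tau>: "\<tau> > 0" and \<rho>: "\<rho> > 0" and
    sq: "squeezes C \<delta> \<tau> \<rho>"
    using C(2)[OF \<delta>(1)] by auto
  show ?thesis
  proof (rule that[OF \<tau>, of "\<rho> / 2"])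
    show "\<rho> / 2 > 0" using \<rho> by simp
    fix K assume K: "\<And>x. x \<in> K \<Longrightarrow> near (\<rho> / 2) x"
    show "mu2 (flow g \<tau> ` K) \<le> ennreal (1/2) * mu2 K"
    proof (rule mu2_image_le[where ?r0.0="\<rho> / 4" and D="4 * \<delta>"])
      fix c r assume r: "(0::real) < r" "r \<le> \<rho> / 4"
      show "\<exists>C'. finite C' \<and> (\<forall>(c', r')\<in>C'. 0 < r' \<and> r' \<le> 4 * \<delta> * r) \<and>
        flow g \<tau> ` (K \<inter> ball c r) \<subseteq> (\<Union>(c', r')\<in>C'. ball c' r') \<and> (\<Sum>(c', r')\<in>C'. r'\<^sup>2) \<le> 1/2 * r\<^sup>2"
      proof (cases "K \<inter> ball c r = {}")
        case True then show ?thesis by (intro exI[of _ "{}"]) auto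
      next
        case False
        then obtain x where x: "x \<in> K" "x \<in> ball c r" by blast
        obtain s where s: "s \<in> {0..T}" "norm (x - xs s) \<le> \<rho> / 2" using K[OF x(1)] unfolding near_def by blast
        define h where "h = \<delta> * r / E"
        have h: "h > 0" "h * E = \<delta> * r" using \<delta> r E by (auto simp: h_def)
        define m where "m = nat \<lceil>2 * C * E / \<delta>\<rceil>"
        have "2 * C * E / \<delta> \<ge> 0" using C E \<delta> by simp
        then have m: "2 * C * E / \<delta> \<le> real m" "real m \<le> 2 * C * E / \<delta> + 1" unfolding m_def by linarith+
        have mh: "2 * C * r \<le> real m * h"
        proof -
          have "2 * C * r = (2 * C * E / \<delta>) * h" using \<delta> E by (simp add: h_def)
          also have "\<dots> \<le> real m * h" using m h by (intro mult_right_mono) auto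
          finally show ?thesis .
        qed
        define cc where "cc j = flow g \<tau> x + (of_int j * h) *\<^sub>R e s" for j :: int
        define C' where "C' = (\<lambda>j. (cc j, 4 * \<delta> * r)) ` {- int m..int m}"
        have "flow g \<tau> ` (K \<inter> ball c r) \<subseteq> (\<Union>(c', r')\<in>C'. ball c' r')"
        proof
          fix z assume "z \<in> flow g \<tau> ` (K \<inter> ball c r)"
          then obtain y where y: "y \<in> K" "y \<in> ball c r" "z = flow g \<tau> y" by blast
          have "norm (y - x) \<le> norm (c - x) + norm (c - y)" by norm
          then have yx: "norm (y - x) \<le> 2 * r" using x y by (simp add: dist_norm)
          have "norm (y - xs s) \<le> norm (y - x) + norm (x - xs s)" by norm
          then have "x \<in> cball (xs s) \<rho>" "y \<in> cball (xs s) \<rho>"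
            using s(2) yx r \<rho> by (auto simp: dist_norm norm_minus_commute)
          then obtain \<alpha> where \<alpha>: "\<bar>\<alpha>\<bar> \<le> C * norm (y - x)"
            "norm (flow g \<tau> y - flow g \<tau> x - \<alpha> *\<^sub>R e s) \<le> \<delta> * norm (y - x)"
            using bspec[OF sq[unfolded squeezes_def] s(1)] by blast
          have "\<bar>\<alpha>\<bar> \<le> C * (2 * r)" using \<alpha>(1) mult_left_mono[OF yx, of C] C by linarith
          then have "\<bar>\<alpha>\<bar> \<le> real m * h" using mh by simp
          from grid_point[OF h(1) this] obtain j where j: "j \<in> {- int m..int m}" "\<bar>\<alpha> - of_int j * h\<bar> \<le> h"
            by blast
          have "z - cc j = (flow g \<tau> y - flow g \<tau> x - \<alpha> *\<^sub>R e s) + (\<alpha> - of_int j * h) *\<^sub>R e s"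
            by (simp add: y cc_def algebra_simps)
          also have "norm \<dots> \<le> \<delta> * norm (y - x) + \<bar>\<alpha> - of_int j * h\<bar> * norm (e s)"
            using \<alpha>(2) by (intro order_trans[OF norm_triangle_ineq]) simp
          also have "\<dots> \<le> \<delta> * (2 * r) + h * E"
            using \<delta> yx j E h by (intro add_mono mult_mono mult_left_mono) auto
          also have "\<dots> < 4 * \<delta> * r" using h \<delta> r by simp
          finally have "z \<in> ball (cc j) (4 * \<delta> * r)" by (simp add: dist_norm norm_minus_commute)
          then show "z \<in> (\<Union>(c', r')\<in>C'. ball c' r')" using j(1) by (auto simp: C'_def)
        qed
        moreover have "(\<Sum>(c', r')\<in>C'. r'\<^sup>2) \<le> 1/2 * r\<^sup>2"
        proof -
          have "(\<Sum>(c', r')\<in>C'. r'\<^sup>2) \<le> real (card {- int m..int m}) * (4 * \<delta> * r)\<^sup>2"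
            unfolding C'_def by (rule sum_squares_equal_radii) simp
          also have "\<dots> = (2 * real m + 1) * (16 * \<delta>\<^sup>2 * r\<^sup>2)" by (simp add: power_mult_distrib)
          also have "\<dots> \<le> (4 * C * E / \<delta> + 3) * (16 * \<delta>\<^sup>2 * r\<^sup>2)"
            using m(2) by (intro mult_right_mono) auto
          also have "\<dots> = (64 * (C * E * \<delta>) + 48 * \<delta>\<^sup>2) * r\<^sup>2"
            using \<delta>(1) by (simp add: field_simps power2_eq_square)
          also have "\<dots> \<le> 1/2 * r\<^sup>2"
          proof (rule mult_right_mono)
            have "\<delta>\<^sup>2 \<le> \<delta> * 1" unfolding power2_eq_square using \<delta> by (intro mult_left_mono) auto
            then show "64 * (C * E * \<delta>) + 48 * \<delta>\<^sup>2 \<le> 1/2" using \<delta> by linarith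
          qed simp
          finally show ?thesis .
        qed
        ultimately show ?thesis using \<delta> r by (intro exI[of _ C']) (auto simp: C'_def)
      qed
    qed (use \<rho> \<delta> in auto)
  qed
qed

text \<open>The forward orbit \<open>Y\<close> of a thin tube \<open>U\<close> is positively invariant and stays near the orbit. It is open by
  invariance of domain, so its closure \<open>X\<close> is the closure of its interior. An arbitrary time consists of many squeezing
  steps and a remainder shorter than \<open>\<tau>\<close>, during which the 2-measure grows by a bounded factor.\<close>

theorem andronov_witt_imp_contractive:
  assumes aw: "andronov_witt f T (xs 0)"
  shows "\<exists>X. regular_tubular_nbhd f (xs ` {0..T}) X \<and>
     (\<exists>S. open S \<and> X \<subseteq> S \<and> forward_complete_on f S) \<and> uniformly_2_contractive f X"
proof -
  obtain r1 \<Lambda> where r1: "r1 > 0" and \<Lambda>: "\<Lambda> \<ge> 1" and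
    st: "\<And>r x t. 0 < r \<Longrightarrow> r \<le> r1 \<Longrightarrow> near r x \<Longrightarrow> 0 \<le> t \<Longrightarrow> near (\<Lambda> * r) (flow g t x)"
    using orbital_stability[OF aw] by metis
  obtain \<tau> \<rho> where \<tau>: "\<tau> > 0" and \<rho>: "\<rho> > 0" and
    sq: "\<And>K. (\<And>x. x \<in> K \<Longrightarrow> near \<rho> x) \<Longrightarrow> mu2 (flow g \<tau> ` K) \<le> ennreal (1/2) * mu2 K"
    using squeeze_mu2[OF aw] by metis
  \<comment> \<open>Solutions that start within \<open>r3\<close> of the orbit stay within 1 of it, where \<open>f\<close> and \<open>g\<close> agree. Solutions that start within \<open>r2\<close> stay in the region of squeezing and within \<open>r3\<close>.\<close>
  define r3 where "r3 = min r1 (1 / \<Lambda>)"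
  have r3: "r3 > 0" "r3 \<le> r1" "\<Lambda> * r3 \<le> 1"
    using r1 \<Lambda> by (auto simp: r3_def min_def field_simps)
  define r2 where "r2 = min (r3 / 2) \<rho> / (2 * \<Lambda>)"
  have r2: "r2 > 0" "2 * (\<Lambda> * r2) \<le> \<rho>" "2 * (\<Lambda> * r2) \<le> r3 / 2"
    using r3 \<rho> \<Lambda> by (auto simp: r2_def)
  have "r2 \<le> \<Lambda> * r2" using \<Lambda> r2(1) by simp
  then have r21: "r2 \<le> r1" using r2 r3 by linarith
  define S where "S = (\<Union>s\<in>{0..T}. ball (xs s) r3)"
  define U where "U = (\<Union>s\<in>{0..T}. ball (xs s) r2)"
  define Y where "Y = (\<Union>t\<in>{0..}. flow g t ` U)"
  define X where "X = closure Y"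
  have Un: "near r2 x" if "x \<in> U" for x
    using that unfolding U_def near_def by (force simp: dist_norm norm_minus_commute)
  have Sn: "near r3 x" if "x \<in> S" for x
    using that unfolding S_def near_def by (force simp: dist_norm norm_minus_commute)
  have Yn: "near (\<Lambda> * r2) y" if "y \<in> Y" for y
    using that st[OF r2(1) r21 Un] unfolding Y_def by auto
  have Xn: "\<exists>s\<in>{0..T}. norm (x - xs s) < 2 * (\<Lambda> * r2)" if x: "x \<in> X" for x
  proof -
    have "\<Lambda> * r2 > 0" using \<Lambda> r2(1) by simp
    then obtain y where y: "y \<in> Y" "dist y x < \<Lambda> * r2"
      using x closure_approachable[of x Y] unfolding X_def by blast
    obtain s where s: "s \<in> {0..T}" "norm (y - xs s) \<le> \<Lambda> * r2" using Yn[OF y(1)] unfolding near_def by blast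
    have "norm (x - xs s) \<le> dist y x + norm (y - xs s)" by (simp add: dist_norm) norm
    then show ?thesis using y s by (intro bexI[of _ s]) auto
  qed
  have X\<rho>: "near \<rho> x" if "x \<in> X" for x
    using Xn[OF that] r2(2) unfolding near_def by force
  have XS: "X \<subseteq> S"
  proof
    fix x assume "x \<in> X"
    then obtain s where s: "s \<in> {0..T}" "norm (x - xs s) < 2 * (\<Lambda> * r2)" using Xn by blast
    then have "x \<in> ball (xs s) r3" using r2(3) r3(1) by (simp add: dist_norm norm_minus_commute)
    then show "x \<in> S" using s(1) unfolding S_def by blast
  qed
  have fS: "flow_defined f t x \<and> flow f t x = flow g t x" if x: "x \<in> S" and t: "t \<ge> 0" for x t
  proof -
    have "flow g r x \<in> cball 0 R" if r: "0 \<le> r" for r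
    proof -
      have "near (\<Lambda> * r3) (flow g r x)" by (rule st[OF r3(1,2) Sn[OF x] r])
      then obtain s where "norm (flow g r x - xs s) \<le> \<Lambda> * r3" unfolding near_def by blast
      then show ?thesis using r3(3) by (intro in_ball_near[of _ s]) linarith
    qed
    then show ?thesis using flow_f_eq[OF t] by blast
  qed
  have openY: "open Y" unfolding Y_def
  proof (intro open_UN ballI)
    fix t :: real assume "t \<in> {0..}"
    then have t: "t \<ge> 0" by simp
    have "inj_on (flow g t) U" using flow_inj[OF t] by (auto simp: inj_on_def)
    moreover have "open U" unfolding U_def by auto
    ultimately show "open (flow g t ` U)" using cont_flow[OF t] invariance_of_domain by blast
  qed
  have invY: "flow g t ` Y \<subseteq> Y" if t: "t \<ge> 0" for t
  proof
    fix y assume "y \<in> flow g t ` Y"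
    then obtain s u where su: "s \<ge> 0" "u \<in> U" "y = flow g t (flow g s u)" unfolding Y_def by auto
    then have "y = flow g (s + t) u" using t by (simp add: flow_add)
    then show "y \<in> Y" unfolding Y_def using su t by (auto intro!: bexI[of _ "s + t"])
  qed
  have invX: "flow g t ` X \<subseteq> X" if t: "t \<ge> 0" for t
    unfolding X_def
    by (rule image_closure_subset[OF cont_flow[OF t] closed_closure])
      (rule order_trans[OF invY[OF t] closure_subset])
  have UY: "U \<subseteq> Y"
  proof
    fix u assume "u \<in> U"
    then have "flow g 0 u \<in> Y" unfolding Y_def by (intro UN_I[of 0]) auto
    then show "u \<in> Y" by (simp add: flow_0)
  qed
  have YX: "Y \<subseteq> interior X" unfolding X_def by (rule interior_maximal[OF closure_subset openY])
  have "regular_tubular_nbhd f (xs ` {0..T}) X"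
    unfolding regular_tubular_nbhd_def positively_invariant_def forward_complete_on_def
  proof (intro conjI ballI allI impI)
    have "norm x \<le> R" if "x \<in> X" for x
    proof -
      obtain s where "norm (x - xs s) < 2 * (\<Lambda> * r2)" using Xn \<open>x \<in> X\<close> by blast
      moreover have "r3 \<le> \<Lambda> * r3" using \<Lambda> r3(1) by simp
      ultimately have "norm (x - xs s) \<le> 1" using r2(3) r3 by linarith
      then show ?thesis using in_ball_near[of x s] by simp
    qed
    then have "bounded X" unfolding bounded_iff by blast
    then show "compact X" unfolding X_def by (simp add: compact_eq_bounded_closed)
    show "X = closure (interior X)"
    proof
      show "X \<subseteq> closure (interior X)" using closure_mono[OF YX] by (simp add: X_def)
      show "closure (interior X) \<subseteq> X"
        using closure_mono[OF interior_subset, of X] by (simp add: X_def)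
    qed
    show "flow_defined f t x" if "x \<in> X" "0 \<le> t" for x t using fS that XS by blast
    show "flow f t ` X \<subseteq> X" if "0 < t" for t
      using invX[of t] fS[of _ t] XS that by (auto simp: image_subset_iff subset_iff)
    show "xs ` {0..T} \<subseteq> interior X"
    proof
      fix x assume "x \<in> xs ` {0..T}"
      then obtain s where s: "s \<in> {0..T}" "x = xs s" by blast
      then have "x \<in> ball (xs s) r2" using r2(1) by simp
      then have "x \<in> U" unfolding U_def using s(1) by blast
      then show "x \<in> interior X" using UY YX by blast
    qed
  qed
  moreover have "open S" unfolding S_def by auto
  moreover have "forward_complete_on f S" using fS by (auto simp: forward_complete_on_def)
  moreover have "uniformly_2_contractive f X"
    unfolding uniformly_2_contractive_def
  proof (intro allI impI)
    fix \<epsilon> :: real assume \<epsilon>: "0 < \<epsilon> \<and> \<epsilon> < 1"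
    define D where "D = exp (L * \<tau>)"
    have D: "D > 0" by (simp add: D_def)
    have iter: "mu2 (flow g (real j * \<tau>) ` K) \<le> ennreal ((1/2) ^ j) * mu2 K \<and> flow g (real j * \<tau>) ` K \<subseteq> X"
      if K: "K \<subseteq> X" for K j
    proof (induction j)
      case 0 then show ?case using K by (simp add: flow_0 image_def)
    next
      case (Suc j)
      define K' where "K' = flow g (real j * \<tau>) ` K"
      have "flow g (real (Suc j) * \<tau>) x = flow g \<tau> (flow g (real j * \<tau>) x)" for x
        using flow_add[of "real j * \<tau>" \<tau> x] \<tau> by (simp add: algebra_simps)
      then have eq: "flow g (real (Suc j) * \<tau>) ` K = flow g \<tau> ` K'" by (simp add: K'_def image_image)
      have K'X: "K' \<subseteq> X" using Suc by (simp add: K'_def)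
      have "mu2 (flow g \<tau> ` K') \<le> ennreal (1/2) * mu2 K'" using K'X X\<rho> by (intro sq) blast
      also have "\<dots> \<le> ennreal (1/2) * (ennreal ((1/2) ^ j) * mu2 K)"
        using Suc by (intro mult_left_mono) (auto simp: K'_def)
      also have "\<dots> = (ennreal (1/2) * ennreal ((1/2) ^ j)) * mu2 K" by (simp only: mult.assoc)
      also have "ennreal (1/2) * ennreal ((1/2) ^ j) = ennreal ((1/2) ^ Suc j)"
        by (subst ennreal_mult[symmetric]) simp_all
      finally have "mu2 (flow g \<tau> ` K') \<le> ennreal ((1/2) ^ Suc j) * mu2 K" .
      moreover have "flow g \<tau> ` K' \<subseteq> X"
        by (rule order_trans[OF image_mono[OF K'X] invX]) (use \<tau> in simp)
      ultimately show ?case unfolding eq by (rule conjI)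
    qed
    obtain k where k: "(1/2::real) ^ k < \<epsilon> / (4 * D\<^sup>2)"
      using real_arch_pow_inv[of "\<epsilon> / (4 * D\<^sup>2)" "1/2"] \<epsilon> D by auto
    show "\<exists>\<T>>0. \<forall>K. compact K \<and> K \<subseteq> X \<and> mu2 K < \<infinity> \<longrightarrow> (\<forall>t\<ge>\<T>. mu2 (flow f t ` K) \<le> ennreal \<epsilon> * mu2 K)"
    proof (intro exI[of _ "real (Suc k) * \<tau>"] conjI allI impI)
      show "0 < real (Suc k) * \<tau>" using \<tau> by simp
      fix K t assume "compact K \<and> K \<subseteq> X \<and> mu2 K < \<infinity>" and t: "real (Suc k) * \<tau> \<le> t"
      then have K: "K \<subseteq> X" by blast
      have t0: "t \<ge> 0" using t \<tau> by (meson less_imp_le mult_nonneg_nonneg of_nat_0_le_iff order_trans)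
      obtain j s where s: "0 \<le> s" "s < \<tau>" "t = s + real j * \<tau>" using nonneg_reduce[OF \<tau> t0] .
      have "(real j + 1) * \<tau> = real j * \<tau> + \<tau>" by (simp only: distrib_right mult_1)
      then have "real (Suc k) * \<tau> < (real j + 1) * \<tau>" using t s by linarith
      then have "real (Suc k) < real j + 1" using \<tau> by (simp only: mult_less_cancel_right_pos)
      then have jk: "k \<le> j" by simp
      define K' where "K' = flow g (real j * \<tau>) ` K"
      have "flow f t x = flow g s (flow g (real j * \<tau>) x)" if "x \<in> K" for x
        using fS[of x t] that K XS t0 flow_add[of "real j * \<tau>" s x] s \<tau> by (auto simp: add.commute)
      then have eq: "flow f t ` K = flow g s ` K'" unfolding K'_def image_image by (intro image_cong) auto
      have "mu2 (flow g s ` K') \<le> ennreal (4 * D\<^sup>2) * mu2 K'"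
      proof (rule mu2_lipschitz_image_le[OF D])
        fix x y
        have "norm (flow g s x - flow g s y) \<le> exp (L * s) * norm (x - y)"
          by (rule flow_lipschitz[OF s(1)])
        also have "\<dots> \<le> D * norm (x - y)"
          using s L(1) by (intro mult_right_mono) (auto simp: D_def mult_left_mono)
        finally show "norm (flow g s x - flow g s y) \<le> D * norm (x - y)" .
      qed
      also have "\<dots> \<le> ennreal (4 * D\<^sup>2) * (ennreal ((1/2) ^ j) * mu2 K)"
        using iter[OF K, of j] by (intro mult_left_mono) (auto simp: K'_def)
      also have "\<dots> = (ennreal (4 * D\<^sup>2) * ennreal ((1/2) ^ j)) * mu2 K" by (simp only: mult.assoc)
      also have "ennreal (4 * D\<^sup>2) * ennreal ((1/2) ^ j) = ennreal (4 * D\<^sup>2 * (1/2) ^ j)"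
        by (subst ennreal_mult[symmetric]) simp_all
      also have "ennreal (4 * D\<^sup>2 * (1/2) ^ j) * mu2 K \<le> ennreal \<epsilon> * mu2 K"
      proof (intro mult_right_mono ennreal_leI)
        have "(1/2::real) ^ j \<le> (1/2) ^ k" using jk by (intro power_decreasing) auto
        then have "(1/2::real) ^ j \<le> \<epsilon> / (4 * D\<^sup>2)" using k by linarith
        then have "4 * D\<^sup>2 * (1/2) ^ j \<le> 4 * D\<^sup>2 * (\<epsilon> / (4 * D\<^sup>2))" by (intro mult_left_mono) auto
        then show "4 * D\<^sup>2 * (1/2) ^ j \<le> \<epsilon>" using D by simp
      qed simp
      finally show "mu2 (flow f t ` K) \<le> ennreal \<epsilon> * mu2 K" unfolding eq .
    qed
  qed
  ultimately show ?thesis using XS by blast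
qed

end

theorem mainTheorem5:
  fixes f :: "real^'n \<Rightarrow> real^'n"
    and xs :: "real \<Rightarrow> real^'n"
    and x0 :: "real^'n"
    and T :: real
    and \<Gamma> :: "(real^'n) set"
    and A :: "real \<Rightarrow> real^'n^'n"
  assumes "C1_map f"
    and "is_solution f UNIV xs" and "xs 0 = x0"
    and "has_minimal_period xs T"
    and "\<Gamma> = xs ` {0..T}"
    and "A = (\<lambda>t. jacobian f (at (xs t)))"
  shows "(andronov_witt f T x0 \<longleftrightarrow>
            (\<exists>P :: real \<Rightarrow> real^'n^'n.
               (\<forall>t. P (t + T) = P t) \<and> continuous_on UNIV P \<and> (\<forall>t. pos_definite (P t)) \<and>
               piecewise_C1_on 0 T P \<and>
               (\<forall>t\<ge>0. top_two_sum_neg (A t) (P t) (vector_derivative P (at_right t)) \<and>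
                      top_two_sum_neg (A t) (P t) (vector_derivative P (at_left t)))))
       \<and> (andronov_witt f T x0 \<longleftrightarrow>
            (\<exists>X. regular_tubular_nbhd f \<Gamma> X \<and>
               (\<exists>S. open S \<and> X \<subseteq> S \<and> forward_complete_on f S) \<and>
               uniformly_2_contractive f X))"
proof -
  have "continuous_on {0..T} xs"
    using assms(2) unfolding is_solution_def
    by (intro has_vector_derivative_imp_continuous_on[of _ _ "\<lambda>t. f (xs t)"])
      (auto intro: has_vector_derivative_at_within)
  then have "bounded (xs ` {0..T})" by (intro compact_imp_bounded compact_continuous_image) auto
  then obtain B where "\<forall>x\<in>xs ` {0..T}. norm x \<le> B" unfolding bounded_iff by blast
  then have B: "norm (xs t) \<le> B" if "t \<in> {0..T}" for t using that by blast
  define R where "R = B + 1"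
  have T: "T > 0" and period: "\<And>t. xs (t + T) = xs t"
    using assms(4) by (auto simp: has_minimal_period_def)
  have R: "norm (xs t) + 1 \<le> R" for t
  proof -
    obtain s where "s \<in> {0..T}" "xs t = xs s"
      using periodic_reduce[where x=xs and t=t, OF T period] by force
    then show ?thesis using B[of s] by (simp add: R_def)
  qed
  obtain L where L: "L \<ge> 0" "\<And>x y. x \<in> cball 0 R \<Longrightarrow> y \<in> cball 0 R \<Longrightarrow> norm (f x - f y) \<le> L * norm (x - y)"
    using C1_map_lipschitz_cball[OF assms(1)] by blast
  interpret orb: periodic_orbit f xs T R L
    by unfold_locales (fact assms(1) assms(2) assms(4) R L)+
  have A: "A = orb.A" unfolding assms(6) by (rule ext) (simp add: orb.A_def)
  have G: "\<Gamma> = xs ` {0..T}" by (rule assms(5))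
  have x0: "x0 = xs 0" using assms(3) by simp
  show ?thesis unfolding A G x0
  proof (intro conjI iffI)
    assume "andronov_witt f T (xs 0)"
    then show "\<exists>P. (\<forall>t. P (t + T) = P t) \<and> continuous_on UNIV P \<and> (\<forall>t. pos_definite (P t)) \<and>
       piecewise_C1_on 0 T P \<and>
       (\<forall>t\<ge>0. top_two_sum_neg (orb.A t) (P t) (vector_derivative P (at_right t)) \<and>
              top_two_sum_neg (orb.A t) (P t) (vector_derivative P (at_left t)))"
      by (rule orb.andronov_witt_imp_lyapunov)
  next
    assume "\<exists>P. (\<forall>t. P (t + T) = P t) \<and> continuous_on UNIV P \<and> (\<forall>t. pos_definite (P t)) \<and>
       piecewise_C1_on 0 T P \<and>
       (\<forall>t\<ge>0. top_two_sum_neg (orb.A t) (P t) (vector_derivative P (at_right t)) \<and>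
              top_two_sum_neg (orb.A t) (P t) (vector_derivative P (at_left t)))"
    then obtain P where "\<forall>t. P (t + T) = P t" "continuous_on UNIV P" "\<forall>t. pos_definite (P t)"
      "piecewise_C1_on 0 T P"
      "\<forall>t\<ge>0. top_two_sum_neg (orb.A t) (P t) (vector_derivative P (at_right t)) \<and>
              top_two_sum_neg (orb.A t) (P t) (vector_derivative P (at_left t))"
      by (elim exE conjE)
    then show "andronov_witt f T (xs 0)"
      by (intro orb.lyapunov_imp_andronov_witt[of P]) simp_all
  next
    assume "andronov_witt f T (xs 0)"
    then show "\<exists>X. regular_tubular_nbhd f (xs ` {0..T}) X \<and>
       (\<exists>S. open S \<and> X \<subseteq> S \<and> forward_complete_on f S) \<and> uniformly_2_contractive f X"
      by (rule orb.andronov_witt_imp_contractive)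
  next
    assume "\<exists>X. regular_tubular_nbhd f (xs ` {0..T}) X \<and>
       (\<exists>S. open S \<and> X \<subseteq> S \<and> forward_complete_on f S) \<and> uniformly_2_contractive f X"
    then obtain X where X: "regular_tubular_nbhd f (xs ` {0..T}) X" "uniformly_2_contractive f X" by blast
    have "xs 0 \<in> xs ` {0..T}" using T by auto
    then have "xs 0 \<in> interior X" using X(1) unfolding regular_tubular_nbhd_def by blast
    then show "andronov_witt f T (xs 0)" using X(2) by (rule orb.contractive_imp_andronov_witt)
  qed
qed

end
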